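(* Fix $r>\frac d2$, $c>0$, $T>0$ and assume that the solution $(u,\psi)$ of the first order Klein--Gordon--Schrödinger system $$i\partial_t u + c\langle\nabla\rangle_c u - c\langle\nabla\rangle_c^{-1}|\psi|^2=0,\qquad i\partial_t\psi+\tfrac12\Delta\psi+\tfrac12\psi(u+\overline u)=0$$ on $\mathbb T^d$ satisfies $u\in\mathcal C([0,T],H^{r+1})$ and $\psi\in\mathcal C([0,T],H^{r+2(1+\alpha)})$, $0\le\alpha\le1$. Then there exists a $\tau_0>0$ such that for all $0<\tau\le\tau_0$ the following estimate holds for $(u^n,\psi^n)$ defined by $$u^{n+1}=e^{i\tau c\langle\nabla\rangle_c}u^n-i\tau c\langle\nabla\rangle_c^{-1}e^{i\tau c\langle\nabla\rangle_c}\Big(\overline{\psi^n}\,\varphi_1\big(i\tau(\Delta-c^2)\big)\psi^n\Big),$$ $$\psi^{n+1}=e^{\frac i2\tau\Delta}\psi^n+\tfrac{i}{2}\tau\, e^{\frac i2\tau\Delta}\Big(\psi^n\Big[\varphi_1\big(i\tau(c\langle\nabla\rangle_c-\tfrac12\Delta)\big)u^n+\varphi_1\big(-i\tau(c\langle\nabla\rangle_c+\tfrac12\Delta)\big)\overline{u^n}\Big]\Big)$$ with $u^0=u(0)$, $\psi^0=\psi(0)$: $$\|u(t_n)-u^n\|_r+\|\psi(t_n)-\psi^n\|_r\le \tau K_1\Big(\sup_{t_n\le t\le t_{n+1}}\|u(t)\|_{r+1},\sup_{t_n\le t\le t_{n+1}}\|\psi(t)\|_{r+1}\Big)+\tau c^{-2\alpha}K_2\Big(\sup_{t_n\le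 t\le t_{n+1}}\|\psi(t)\|_{r+2(1+\alpha)}\Big),$$ where, in particular, $K_1$ and $K_2$ can be chosen independently of $c$.
   Context: $H^s=H^s(\mathbb T^d)$ is the Sobolev space with norm $\|\cdot\|_s$. $\langle\nabla\rangle_c=\sqrt{c^2-\Delta}$, i.e. the Fourier multiplier $\sqrt{|k|^2+c^2}$, $k\in\mathbb Z^d$; $c\langle\nabla\rangle_c^{-1}$ is $c$ times its inverse. $\varphi_1(\xi)=\frac{e^\xi-1}{\xi}$ for $\xi\in\mathbb C$ (with $\varphi_1(0)=1$); functions of $\Delta$ and $\langle\nabla\rangle_c$ are Fourier multipliers and act on the function or bracketed product immediately to their right, so that e.g. $\overline\psi\,\varphi_1(\cdot)\psi$ is the pointwise product of $\overline\psi$ and $\varphi_1(\cdot)\psi$. $\tau>0$ is the time step, $t_n=n\tau$, $t_{n+1}=t_n+\tau$, with $[t_n,t_{n+1}]\subset[0,T]$. $K_1(\cdot),K_2(\cdot)$ denote constants depending on the indicated quantities.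
   Formalization: The suprema in K_1 and K_2 are taken over 0 ≤ t ≤ t_{n+1} instead of t_n ≤ t ≤ t_{n+1}; with only the last time window the global bound with c-independent K_1, K_2 fails (resonant high-frequency data with c√(N²+c²)=N²/2). *)

theory Defs
  imports "HOL-Analysis.Analysis"
begin

text \<open>
  A function on the torus $T^d = (R / 2 \pi Z)^d$ is represented by a function on
  \<open>real ^ 'd\<close> that is \<open>2 * pi\<close>-periodic in every coordinate; \<open>d\<close> is \<open>CARD('d)\<close>, and the
  frequencies $k \in Z^d$ are the elements of \<open>int ^ 'd\<close>.
\<close>

definition torus_periodic :: "(real ^ 'd \<Rightarrow> complex) \<Rightarrow> bool" where
  "torus_periodic f \<longleftrightarrow> (\<forall>x i. f (x + axis i (2 * pi)) = f x)"

definition torus_cell :: "(real ^ 'd) set" where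
  "torus_cell = cbox 0 (\<chi> i. 2 * pi)"

definition freq_dot :: "int ^ 'd \<Rightarrow> real ^ 'd \<Rightarrow> real" where
  "freq_dot k x = (\<Sum>i\<in>UNIV. of_int (k $ i) * x $ i)"

definition freq_sq :: "int ^ 'd \<Rightarrow> real" where
  "freq_sq k = (\<Sum>i\<in>UNIV. (of_int (k $ i))\<^sup>2)"

definition fourier_coeff :: "(real ^ 'd \<Rightarrow> complex) \<Rightarrow> int ^ 'd \<Rightarrow> complex" where
  "fourier_coeff f k =
     (LINT x:torus_cell|lebesgue. f x * cis (- freq_dot k x)) / of_real ((2 * pi) ^ CARD('d))"

text \<open>
  The Sobolev space of order \<open>s \<ge> 0\<close>: square integrable functions whose Fourier
  coefficients are square summable with weight $(1 + |k|^2)^s$. As usual, two functions that agree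
  almost everywhere have the same Fourier coefficients and represent the same element.
  \<open>sobolev_norm s f\<close> is the norm only for \<open>f \<in> sobolev s\<close> (a divergent sum would give \<open>0\<close>).
\<close>

definition sobolev :: "real \<Rightarrow> (real ^ 'd \<Rightarrow> complex) set" where
  "sobolev s = {f. torus_periodic f \<and> f \<in> borel_measurable lebesgue \<and>
     set_integrable lebesgue torus_cell (\<lambda>x. (cmod (f x))\<^sup>2) \<and>
     (\<lambda>k. (1 + freq_sq k) powr s * (cmod (fourier_coeff f k))\<^sup>2) summable_on UNIV}"

definition sobolev_norm :: "real \<Rightarrow> (real ^ 'd \<Rightarrow> complex) \<Rightarrow> real" where
  "sobolev_norm s f =
     sqrt (\<Sum>\<^sub>\<infinity>k. (1 + freq_sq k) powr s * (cmod (fourier_coeff f k))\<^sup>2)"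

definition sobolev_continuous ::
    "real \<Rightarrow> real \<Rightarrow> (real \<Rightarrow> real ^ 'd \<Rightarrow> complex) \<Rightarrow> bool" where
  "sobolev_continuous T s f \<longleftrightarrow>
     (\<forall>t\<in>{0..T}. f t \<in> sobolev s \<and>
        ((\<lambda>t'. sobolev_norm s (\<lambda>x. f t' x - f t x)) \<longlongrightarrow> 0) (at t within {0..T}))"

text \<open>\<open>f'\<close> is the derivative at \<open>t\<close> (one-sided at \<open>0\<close> and \<open>T\<close>) of the curve \<open>f\<close> in
  the Sobolev space of order \<open>s\<close>.\<close>

definition sobolev_deriv ::
    "real \<Rightarrow> real \<Rightarrow> (real \<Rightarrow> real ^ 'd \<Rightarrow> complex) \<Rightarrow> real \<Rightarrow> (real ^ 'd \<Rightarrow> complex) \<Rightarrow> bool" where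
  "sobolev_deriv T s f t f' \<longleftrightarrow> f' \<in> sobolev s \<and>
     ((\<lambda>t'. sobolev_norm s (\<lambda>x. (f t' x - f t x) / of_real (t' - t) - f' x)) \<longlongrightarrow> 0)
       (at t within {0..T})"

text \<open>
  The Fourier multiplier with symbol \<open>m\<close>, as the sum of its Fourier series. The series converges
  absolutely whenever the multiplier maps the given function into a Sobolev space of order greater
  than \<open>CARD('d) / 2\<close>, which is the case in all the uses below.
\<close>

definition fourier_multiplier ::
    "(int ^ 'd \<Rightarrow> complex) \<Rightarrow> (real ^ 'd \<Rightarrow> complex) \<Rightarrow> real ^ 'd \<Rightarrow> complex" where
  "fourier_multiplier m f x = (\<Sum>\<^sub>\<infinity>k. m k * fourier_coeff f k * cis (freq_dot k x))"

definition laplace_symbol :: "int ^ 'd \<Rightarrow> complex" where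
  "laplace_symbol k = of_real (- freq_sq k)"

definition nabla_symbol :: "real \<Rightarrow> int ^ 'd \<Rightarrow> complex" where
  "nabla_symbol c k = of_real (sqrt (freq_sq k + c\<^sup>2))"

definition phi1 :: "complex \<Rightarrow> complex" where
  "phi1 z = (if z = 0 then 1 else (exp z - 1) / z)"

text \<open>
  A solution on \<open>[0, T]\<close>, with the time derivatives taken in the Sobolev space of order \<open>s\<close>. The
  equations may be required at every \<open>x\<close>, because \<open>u'\<close> and \<open>\<psi>'\<close> can be modified on a null set.
\<close>

definition KGS_solution ::
    "real \<Rightarrow> real \<Rightarrow> real \<Rightarrow> (real \<Rightarrow> real ^ 'd \<Rightarrow> complex) \<Rightarrow> (real \<Rightarrow> real ^ 'd \<Rightarrow> complex) \<Rightarrow> bool" where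
  "KGS_solution c T s u \<psi> \<longleftrightarrow>
     (\<forall>t\<in>{0..T}. \<exists>u' \<psi>'. sobolev_deriv T s u t u' \<and> sobolev_deriv T s \<psi> t \<psi>' \<and>
        (\<forall>x. \<i> * u' x
             + fourier_multiplier (\<lambda>k. of_real c * nabla_symbol c k) (u t) x
             - fourier_multiplier (\<lambda>k. of_real c * inverse (nabla_symbol c k))
                 (\<lambda>y. of_real ((cmod (\<psi> t y))\<^sup>2)) x = 0) \<and>
        (\<forall>x. \<i> * \<psi>' x
             + 1 / 2 * fourier_multiplier laplace_symbol (\<psi> t) x
             + 1 / 2 * \<psi> t x * (u t x + cnj (u t x)) = 0))"

definition KGS_step_u ::
    "real \<Rightarrow> real \<Rightarrow> (real ^ 'd \<Rightarrow> complex) \<Rightarrow> (real ^ 'd \<Rightarrow> complex) \<Rightarrow> real ^ 'd \<Rightarrow> complex" where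
  "KGS_step_u c \<tau> u \<psi> = (\<lambda>x.
     fourier_multiplier (\<lambda>k. exp (\<i> * of_real \<tau> * of_real c * nabla_symbol c k)) u x
     - \<i> * of_real \<tau> *
       fourier_multiplier
         (\<lambda>k. of_real c * inverse (nabla_symbol c k) * exp (\<i> * of_real \<tau> * of_real c * nabla_symbol c k))
         (\<lambda>y. cnj (\<psi> y) *
            fourier_multiplier (\<lambda>k. phi1 (\<i> * of_real \<tau> * (laplace_symbol k - of_real (c\<^sup>2)))) \<psi> y) x)"

definition KGS_step_psi ::
    "real \<Rightarrow> real \<Rightarrow> (real ^ 'd \<Rightarrow> complex) \<Rightarrow> (real ^ 'd \<Rightarrow> complex) \<Rightarrow> real ^ 'd \<Rightarrow> complex" where
  "KGS_step_psi c \<tau> u \<psi> = (\<lambda>x.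
     fourier_multiplier (\<lambda>k. exp (\<i> / 2 * of_real \<tau> * laplace_symbol k)) \<psi> x
     + \<i> / 2 * of_real \<tau> *
       fourier_multiplier (\<lambda>k. exp (\<i> / 2 * of_real \<tau> * laplace_symbol k))
         (\<lambda>y. \<psi> y *
            (fourier_multiplier
               (\<lambda>k. phi1 (\<i> * of_real \<tau> * (of_real c * nabla_symbol c k - 1 / 2 * laplace_symbol k))) u y
             + fourier_multiplier
               (\<lambda>k. phi1 (- \<i> * of_real \<tau> * (of_real c * nabla_symbol c k + 1 / 2 * laplace_symbol k)))
               (\<lambda>z. cnj (u z)) y)) x)"

primrec KGS_scheme ::
    "real \<Rightarrow> real \<Rightarrow> (real ^ 'd \<Rightarrow> complex) \<Rightarrow> (real ^ 'd \<Rightarrow> complex) \<Rightarrow> nat \<Rightarrow>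
      (real ^ 'd \<Rightarrow> complex) \<times> (real ^ 'd \<Rightarrow> complex)" where
  "KGS_scheme c \<tau> u0 \<psi>0 0 = (u0, \<psi>0)"
| "KGS_scheme c \<tau> u0 \<psi>0 (Suc n) =
     (case KGS_scheme c \<tau> u0 \<psi>0 n of (u, \<psi>) \<Rightarrow> (KGS_step_u c \<tau> u \<psi>, KGS_step_psi c \<tau> u \<psi>))"

end

theory Submission
  imports Defs
begin

text \<open>
The whole argument takes place on the Fourier side. With the weight \<open>weight k\<close> $= 1 + |k|^2$, a
function in the Sobolev space of order \<open>s\<close> is a family of coefficients with finite norm \<open>hnorm s\<close>,
a product of functions is a convolution of families, and for \<open>s > d / 2\<close> the norm is
submultiplicative up to a constant (\<open>hs_conv_majorant\<close>).

Passing from functions to coefficients needs one nontrivial fact: a function of the Sobolev space is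
only an equivalence class, so the coefficients of $|\psi|^2$ and $\psi (u + \overline u)$ are
convolutions only because \<open>\<psi>\<close> agrees almost everywhere with its absolutely convergent Fourier series
(\<open>AE_eq_fseries\<close>). That is the completeness of the characters in $L^1$ of the torus. By the
Stone--Weierstrass theorem, a function with vanishing coefficients has integral zero over every
compact subset of the open cell, and inner regularity of Lebesgue measure finishes the argument.

The local error is estimated without integrals in time. If $U' = - i \omega U + G$ coefficientwise
and $D$ is a curve with $D(0) = 0$, then $e^{i \omega s} U(t + s) - D(s)$ has derivative
$e^{i \omega s} G(t + s) - D'(s)$, and a mean value inequality in the weighted norm
(\<open>hnorm_mean_value\<close>) turns a bound for this derivative into a bound for
$U(t + \tau) - e^{- i \omega \tau} (U(t) + D(\tau))$ (\<open>duhamel_error\<close>). Both components of the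
scheme have the form $e^{- i \omega \tau} (U(t) + D(\tau))$, where $D'$ is a bilinear expression in
the values at time \<open>t\<close> whose phase replaces the exact one. In the equation for \<open>\<psi>\<close> the two phases
differ by the inner product $j \cdot (k - j)$ of two frequencies, which costs one derivative on each
factor. In the equation for \<open>u\<close> they differ by such a term and by
$|k|^2 / 2 - (c \sqrt{|k|^2 + c^2} - c^2)$, which lies between \<open>0\<close> and
$\min (1, c^{- 2 \alpha}) (1 + |k|^2)^{1 + \alpha}$ (\<open>kg_freq_approx\<close>). All constants
are independent of \<open>c\<close>, since the multiplier $c / \sqrt{|k|^2 + c^2}$ is at most \<open>1\<close>.

Together with the stability of one step, a discrete Gronwall argument gives convergence as long as
the error stays at most \<open>1\<close>. With the suprema over all of \<open>[0, T]\<close> this determines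
\<open>\<tau>0\<close>, which may depend on the solution; afterwards the estimate is repeated with the suprema up to
$t_{n + 1}$ only (\<open>convergence\<close>). Finally, the Gronwall factor depends on the norm of \<open>u\<close>,
whereas \<open>K2\<close> may depend on \<open>\<psi>\<close> only. The product of the dispersive error $m M^2$,
$m = \min (1, c^{- 2 \alpha})$, with a factor $Y$ is therefore split by
$m M^2 Y \<le> c^{- 2 \alpha} M^4 + Y^2$.
\<close>

section \<open>Weighted square-summable families over the frequency lattice\<close>

text \<open>
The weight $1 + |k|^2$.
\<close>

definition weight :: "int ^ 'd \<Rightarrow> real" where
  "weight k = 1 + freq_sq k"

text \<open>
Membership in the weighted $\ell^2$ space of order \<open>s\<close>; the coefficients of functions in
\<open>sobolev s\<close> have this property.
\<close>

definition hs :: "real \<Rightarrow> (int ^ 'd \<Rightarrow> complex) \<Rightarrow> bool" where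
  "hs s a \<longleftrightarrow> (\<lambda>k. weight k powr s * (cmod (a k))\<^sup>2) summable_on UNIV"

text \<open>
The weighted norm; as for \<open>sobolev_norm\<close>, it is meaningful only together with \<open>hs s a\<close>.
\<close>

definition hnorm :: "real \<Rightarrow> (int ^ 'd \<Rightarrow> complex) \<Rightarrow> real" where
  "hnorm s a = sqrt (\<Sum>\<^sub>\<infinity>k. weight k powr s * (cmod (a k))\<^sup>2)"

text \<open>
Absolute summability.
\<close>

abbreviation ell1 :: "('i \<Rightarrow> complex) \<Rightarrow> bool" where
  "ell1 a \<equiv> (\<lambda>k. cmod (a k)) summable_on UNIV"

lemma freq_sq_nonneg [simp]: "0 \<le> freq_sq k"
  by (simp add: freq_sq_def sum_nonneg)

lemma weight_ge_1 [simp]: "1 \<le> weight k"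
  by (simp add: weight_def)

lemma weight_pos [simp]: "0 < weight k" and weight_nonneg [simp]: "0 \<le> weight k"
  and weight_neq_0 [simp]: "weight k \<noteq> 0"
  using weight_ge_1[of k] by linarith+

lemma weight_powr_ge_1: "0 \<le> s \<Longrightarrow> 1 \<le> weight k powr s"
  by (rule ge_one_powr_ge_zero) auto

lemma freq_sq_uminus [simp]: "freq_sq (- k) = freq_sq k"
  by (simp add: freq_sq_def)

lemma weight_uminus [simp]: "weight (- k) = weight k"
  by (simp add: weight_def)

lemma hnorm_nonneg [simp]: "0 \<le> hnorm s a"
  by (simp add: hnorm_def infsum_nonneg)

lemma hnorm_sq: "(hnorm s a)\<^sup>2 = (\<Sum>\<^sub>\<infinity>k. weight k powr s * (cmod (a k))\<^sup>2)"
  by (simp add: hnorm_def infsum_nonneg)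

lemma hs_finite_sum_le:
  assumes "hs s a" "finite K"
  shows "(\<Sum>k\<in>K. weight k powr s * (cmod (a k))\<^sup>2) \<le> (hnorm s a)\<^sup>2"
  unfolding hnorm_sq using assms
  by (intro finite_sum_le_infsum) (auto simp: hs_def)

text \<open>
Bounds for the weighted norm are obtained from finite partial sums throughout, so that no
interchange of infinite sums is needed.
\<close>

lemma hs_hnorm_leI:
  assumes B: "0 \<le> B"
    and le: "\<And>K. finite K \<Longrightarrow> (\<Sum>k\<in>K. weight k powr s * (cmod (a k))\<^sup>2) \<le> B\<^sup>2"
  shows "hs s a" and "hnorm s a \<le> B"
proof -
  show hs: "hs s a"
    unfolding hs_def using le by (intro nonneg_bounded_partial_sums_imp_summable_on[where C = "B\<^sup>2"])
      (auto intro!: eventually_finite_subsets_at_top_weakI)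
  have "(hnorm s a)\<^sup>2 \<le> B\<^sup>2"
    unfolding hnorm_sq using hs le
    by (intro infsum_le_finite_sums) (auto simp: hs_def)
  thus "hnorm s a \<le> B" using B by (rule power2_le_imp_le)
qed

lemma L2_weight_eq:
  "L2_set (\<lambda>k. weight k powr (s/2) * cmod (a k)) K
    = sqrt (\<Sum>k\<in>K. weight k powr s * (cmod (a k))\<^sup>2)"
  unfolding L2_set_def
  by (intro arg_cong[of _ _ sqrt] sum.cong)
     (auto simp: power_mult_distrib power2_eq_square simp flip: powr_add)

lemma hs_L2_le:
  assumes "hs s a" "finite K"
  shows "L2_set (\<lambda>k. weight k powr (s/2) * cmod (a k)) K \<le> hnorm s a"
  unfolding L2_weight_eq
  using real_sqrt_le_mono[OF hs_finite_sum_le[OF assms]] by simp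

lemma hs_L2_leI:
  assumes "0 \<le> B"
    and "\<And>K. finite K \<Longrightarrow> L2_set (\<lambda>k. weight k powr (s/2) * cmod (a k)) K \<le> B"
  shows "hs s a" and "hnorm s a \<le> B"
proof -
  have "(\<Sum>k\<in>K. weight k powr s * (cmod (a k))\<^sup>2) \<le> B\<^sup>2" if "finite K" for K
    using assms(2)[OF that] assms(1) unfolding L2_weight_eq by (simp add: real_sqrt_le_iff sqrt_le_D)
  from hs_hnorm_leI[OF assms(1) this] show "hs s a" and "hnorm s a \<le> B" by auto
qed

text \<open>
The norm only sees absolute values: majorants may replace the families themselves.
\<close>

lemma hs_mono:
  assumes b: "hs s b" and le: "\<And>k. cmod (a k) \<le> cmod (b k)"
  shows "hs s a" and "hnorm s a \<le> hnorm s b"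
proof -
  have "(\<Sum>k\<in>K. weight k powr s * (cmod (a k))\<^sup>2) \<le> (hnorm s b)\<^sup>2" if "finite K" for K
    using le by (intro order_trans[OF sum_mono hs_finite_sum_le[OF b that]])
      (auto intro!: mult_left_mono power_mono)
  from hs_hnorm_leI[OF hnorm_nonneg this] show "hs s a" and "hnorm s a \<le> hnorm s b" by auto
qed

lemma hs_add:
  assumes "hs s a" "hs s b"
  shows "hs s (\<lambda>k. a k + b k)" and "hnorm s (\<lambda>k. a k + b k) \<le> hnorm s a + hnorm s b" (is ?G1)
proof -
  have "L2_set (\<lambda>k. weight k powr (s/2) * cmod (a k + b k)) K \<le> hnorm s a + hnorm s b"
    if "finite K" for K
  proof -
    have "L2_set (\<lambda>k. weight k powr (s/2) * cmod (a k + b k)) K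
       \<le> L2_set (\<lambda>k. weight k powr (s/2) * cmod (a k) + weight k powr (s/2) * cmod (b k)) K"
      by (intro L2_set_mono) (auto simp: norm_triangle_ineq simp flip: distrib_left)
    also have "\<dots> \<le> L2_set (\<lambda>k. weight k powr (s/2) * cmod (a k)) K
                   + L2_set (\<lambda>k. weight k powr (s/2) * cmod (b k)) K"
      by (rule L2_set_triangle_ineq)
    finally show ?thesis using hs_L2_le[OF assms(1) that] hs_L2_le[OF assms(2) that] by linarith
  qed
  from hs_L2_leI[OF _ this]
  show "hs s (\<lambda>k. a k + b k)" and ?G1 by auto
qed

lemma hs_bound_mult:
  assumes a: "hs s a" and C: "0 \<le> C" and le: "\<And>k. cmod (b k) \<le> C * cmod (a k)"
  shows "hs s b" and "hnorm s b \<le> C * hnorm s a"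
proof -
  have "(\<Sum>k\<in>K. weight k powr s * (cmod (b k))\<^sup>2) \<le> (C * hnorm s a)\<^sup>2" if "finite K" for K
  proof -
    have "(\<Sum>k\<in>K. weight k powr s * (cmod (b k))\<^sup>2) \<le> (\<Sum>k\<in>K. weight k powr s * (C * cmod (a k))\<^sup>2)"
      by (intro sum_mono mult_left_mono power_mono le) auto
    also have "\<dots> = C\<^sup>2 * (\<Sum>k\<in>K. weight k powr s * (cmod (a k))\<^sup>2)"
      by (simp add: sum_distrib_left power_mult_distrib mult_ac)
    also have "\<dots> \<le> C\<^sup>2 * (hnorm s a)\<^sup>2"
      by (intro mult_left_mono hs_finite_sum_le[OF a that]) auto
    finally show ?thesis by (simp add: power_mult_distrib)
  qed
  from hs_hnorm_leI[OF _ this] C show "hs s b" and "hnorm s b \<le> C * hnorm s a" by auto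
qed

lemma hs_uminus [simp]: "hs s (\<lambda>k. - a k) = hs s a" "hnorm s (\<lambda>k. - a k) = hnorm s a"
  by (simp_all add: hs_def hnorm_def)

lemma hs_diff:
  assumes "hs s a" "hs s b"
  shows "hs s (\<lambda>k. a k - b k)" and "hnorm s (\<lambda>k. a k - b k) \<le> hnorm s a + hnorm s b"
  using hs_add[of s a "\<lambda>k. - b k"] assms by auto

lemma hnorm_triangle3:
  assumes "hs s (\<lambda>k. a k - b k)" "hs s (\<lambda>k. b k - c k)"
  shows "hnorm s (\<lambda>k. a k - c k) \<le> hnorm s (\<lambda>k. a k - b k) + hnorm s (\<lambda>k. b k - c k)"
  using hs_add(2)[OF assms] by simp

lemma hs_cmult:
  assumes "hs s a" shows "hs s (\<lambda>k. c * a k)" "hnorm s (\<lambda>k. c * a k) \<le> cmod c * hnorm s a"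
  using hs_bound_mult[OF assms, of "cmod c" "\<lambda>k. c * a k"] by (auto simp: norm_mult)

lemma hs_cmod_eq:
  assumes "\<And>k. cmod (a k) = cmod (b k)"
  shows "hs s a = hs s b" "hnorm s a = hnorm s b"
  by (simp_all add: hs_def hnorm_def assms)

lemma hs_zero [simp]: "hs s (\<lambda>k. 0)" "hnorm s (\<lambda>k. 0) = 0"
  by (simp_all add: hs_def hnorm_def)

lemma hs_order_mono:
  assumes "hs t a" "s \<le> t"
  shows "hs s a" and "hnorm s a \<le> hnorm t a"
proof -
  have "(\<Sum>k\<in>K. weight k powr s * (cmod (a k))\<^sup>2) \<le> (hnorm t a)\<^sup>2" if "finite K" for K
    by (rule order_trans[OF sum_mono hs_finite_sum_le[OF assms(1) that]])
       (use assms(2) in \<open>auto intro!: mult_right_mono powr_mono\<close>)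
  from hs_hnorm_leI[OF hnorm_nonneg this] show "hs s a" and "hnorm s a \<le> hnorm t a" by auto
qed

lemma hs_weight_shift:
  "hs s (\<lambda>k. of_real (weight k powr p) * a k) = hs (s + 2 * p) a"
  "hnorm s (\<lambda>k. of_real (weight k powr p) * a k) = hnorm (s + 2 * p) a" (is ?G1)
proof -
  have "weight k powr s * (cmod (of_real (weight k powr p) * a k))\<^sup>2
      = weight k powr (s + 2 * p) * (cmod (a k))\<^sup>2" for k
  proof -
    have "(weight k powr p)\<^sup>2 = weight k powr (2 * p)"
      by (simp add: power2_eq_square flip: powr_add)
    thus ?thesis by (simp add: norm_mult power_mult_distrib powr_add)
  qed
  thus "hs s (\<lambda>k. of_real (weight k powr p) * a k) = hs (s + 2 * p) a"
    and ?G1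
    by (simp_all add: hs_def hnorm_def)
qed

lemma cmod_le_hnorm:
  assumes "hs s a" "0 \<le> s"
  shows "cmod (a k) \<le> hnorm s a"
proof -
  have "1 * (cmod (a k))\<^sup>2 \<le> weight k powr s * (cmod (a k))\<^sup>2"
    by (intro mult_right_mono weight_powr_ge_1 assms) auto
  also have "\<dots> \<le> (hnorm s a)\<^sup>2"
    using hs_finite_sum_le[OF assms(1), of "{k}"] by simp
  finally have "(cmod (a k))\<^sup>2 \<le> (hnorm s a)\<^sup>2" by simp
  thus ?thesis by (rule power2_le_imp_le) simp
qed

lemma hs_reflect:
  "hs s (\<lambda>k. cnj (a (- k))) = hs s a" "hnorm s (\<lambda>k. cnj (a (- k))) = hnorm s a"
proof -
  have bij: "bij_betw uminus (UNIV :: (int ^ 'd) set) UNIV"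
    by (rule bij_uminus)
  show "hs s (\<lambda>k. cnj (a (- k))) = hs s a"
    using summable_on_reindex_bij_betw[OF bij, of "\<lambda>k. weight k powr s * (cmod (a k))\<^sup>2"]
    by (simp add: hs_def)
  show "hnorm s (\<lambda>k. cnj (a (- k))) = hnorm s a"
    using infsum_reindex_bij_betw[OF bij, of "\<lambda>k. weight k powr s * (cmod (a k))\<^sup>2"]
    by (simp add: hnorm_def)
qed

lemma summable_int_weight:
  assumes "p > 1 / 2"
  shows "(\<lambda>m::int. (1 + (of_int m)\<^sup>2) powr (-p) :: real) summable_on UNIV"
proof -
  let ?f = "\<lambda>m::int. (1 + (of_int m)\<^sup>2) powr (-p) :: real"
  have le: "(1 + (real n)\<^sup>2) powr (-p) \<le> real n powr (- (2 * p))" if "n \<ge> 1" for n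
  proof -
    have "(1 + (real n)\<^sup>2) powr (-p) \<le> ((real n)\<^sup>2) powr (-p)"
      using that assms by (intro powr_mono2') auto
    also have "\<dots> = (real n powr 2) powr (-p)" using that by (subst powr_numeral) auto
    also have "\<dots> = real n powr (- (2 * p))" by (subst powr_powr) simp
    finally show ?thesis .
  qed
  have s: "summable (\<lambda>n. real n powr (- (2 * p)))"
    using assms by (subst summable_real_powr_iff) simp
  have "summable (\<lambda>n. (1 + (real n)\<^sup>2) powr (-p))"
    by (rule summable_comparison_test'[OF s, of 1]) (use le in simp)
  hence nat: "(\<lambda>n::nat. ?f (int n)) summable_on UNIV"
    by (intro summable_nonneg_imp_summable_on) auto
  have 1: "?f summable_on (int ` UNIV)"
    using nat by (subst summable_on_reindex) (auto simp: o_def)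
  have 2: "?f summable_on ((\<lambda>n. - int n) ` UNIV)"
    using nat by (subst summable_on_reindex) (auto simp: o_def inj_on_def)
  have sub: "m \<in> int ` UNIV \<union> (\<lambda>n. - int n) ` UNIV" for m :: int
    by (cases m rule: int_cases2) auto
  show ?thesis
    by (rule summable_on_subset[OF summable_on_union[OF 1 2]]) (use sub in blast)
qed

text \<open>
By $(1 + |k|^2)^d \<ge> \prod_i (1 + k_i^2)$ the sum over the lattice is dominated by a product of
one-dimensional sums with exponent $s / d > 1 / 2$.
\<close>

lemma summable_weight:
  assumes "s > real CARD('d::finite) / 2"
  shows "(\<lambda>k::int ^ 'd. weight k powr (-s)) summable_on UNIV"
proof -
  \<comment> \<open>Each coordinate receives the share \<open>s / d\<close> of the exponent.\<close>
  define p where "p = s / CARD('d)"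
  let ?g = "\<lambda>m::int. (1 + (of_int m)\<^sup>2) powr (-p) :: real"
  have p: "p > 1 / 2" using assms by (simp add: p_def field_simps)
  define G where "G = (\<Sum>\<^sub>\<infinity>m. ?g m)"
  have le: "weight k powr (-s) \<le> (\<Prod>i\<in>UNIV. ?g (k $ i))" for k :: "int ^ 'd"
  proof -
    have "(\<Prod>i\<in>UNIV. (1 + (of_int (k $ i))\<^sup>2) powr p) \<le> (\<Prod>i\<in>(UNIV::'d set). weight k powr p)"
    proof (intro prod_mono conjI powr_mono2)
      fix i :: 'd
      have "(of_int (k $ i))\<^sup>2 \<le> freq_sq k"
        unfolding freq_sq_def by (rule member_le_sum) auto
      thus "1 + (of_int (k $ i))\<^sup>2 \<le> weight k" by (simp add: weight_def)
    qed (use p in auto)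
    also have "\<dots> = weight k powr (p * CARD('d))"
      by (simp add: powr_realpow[symmetric] powr_powr)
    also have "p * CARD('d) = s" by (simp add: p_def)
    finally have *: "(\<Prod>i\<in>UNIV. (1 + (of_int (k $ i))\<^sup>2) powr p) \<le> weight k powr s" .
    have pos: "(\<Prod>i\<in>UNIV. (1 + (of_int (k $ i))\<^sup>2) powr p) > (0::real)"
      by (intro prod_pos) (auto simp: add_pos_nonneg add_nonneg_eq_0_iff)
    have "(\<Prod>i\<in>UNIV. ?g (k $ i)) = inverse (\<Prod>i\<in>UNIV. (1 + (of_int (k $ i))\<^sup>2) powr p)"
      using prod_inversef[of "\<lambda>i. (1 + (of_int (k $ i))\<^sup>2) powr p :: real" UNIV]
      by (simp add: powr_minus o_def)
    moreover have "weight k powr (-s) = inverse (weight k powr s)" by (simp add: powr_minus)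
    ultimately show ?thesis using * pos by (simp add: le_imp_inverse_le)
  qed
  have "(\<Sum>k\<in>K. weight k powr (-s)) \<le> G ^ CARD('d)" if K: "finite K" for K :: "(int ^ 'd) set"
  proof -
    define M where "M = (\<Union>k\<in>K. range (\<lambda>i. k $ i))"
    have M: "finite M" using K by (auto simp: M_def)
    let ?h = "\<lambda>k::int^'d. \<lambda>i. k $ i"
    have inj: "inj_on ?h K" by (auto simp: inj_on_def vec_eq_iff fun_eq_iff)
    have "(\<Sum>k\<in>K. weight k powr (-s)) \<le> (\<Sum>k\<in>K. \<Prod>i\<in>UNIV. ?g (k $ i))"
      by (intro sum_mono le)
    also have "\<dots> = (\<Sum>f\<in>?h ` K. \<Prod>i\<in>UNIV. ?g (f i))"
      by (simp add: sum.reindex[OF inj])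
    also have "\<dots> \<le> (\<Sum>f\<in>PiE (UNIV::'d set) (\<lambda>_. M). \<Prod>i\<in>UNIV. ?g (f i))"
      by (intro sum_mono2 finite_PiE M) (auto simp: M_def intro!: prod_nonneg)
    also have "\<dots> = (\<Prod>i\<in>(UNIV::'d set). \<Sum>m\<in>M. ?g m)"
      using M by (subst prod_sum_PiE) auto
    also have "\<dots> \<le> (\<Prod>i\<in>(UNIV::'d set). G)"
      unfolding G_def
      by (intro prod_mono conjI sum_nonneg finite_sum_le_infsum summable_int_weight p M) auto
    finally show ?thesis by simp
  qed
  thus ?thesis
    by (intro nonneg_bounded_partial_sums_imp_summable_on[where C = "G ^ CARD('d)"])
       (auto intro!: eventually_finite_subsets_at_top_weakI)
qed

section \<open>Convolution\<close>

text \<open>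
Convolution over the frequency lattice, the coefficients of a product of functions.
\<close>

definition conv :: "(int ^ 'd \<Rightarrow> complex) \<Rightarrow> (int ^ 'd \<Rightarrow> complex) \<Rightarrow> int ^ 'd \<Rightarrow> complex" where
  "conv a b k = (\<Sum>\<^sub>\<infinity>j. a j * b (k - j))"

text \<open>
The constant of the algebra property in dimension \<open>d\<close>, for order \<open>s > d / 2\<close>.
\<close>

definition alg_const :: "'d::finite itself \<Rightarrow> real \<Rightarrow> real" where
  "alg_const _ s = sqrt (2 * 4 powr s * (\<Sum>\<^sub>\<infinity>k::int ^ 'd. weight k powr (-s)))"

lemma alg_const_nonneg [simp]: "0 \<le> alg_const d s"
  by (simp add: alg_const_def infsum_nonneg)

text \<open>
The left-hand side is $2 |j \cdot (k - j)|$.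
\<close>

lemma freq_sq_inner_bound:
  "\<bar>freq_sq k - freq_sq j - freq_sq (k - j)\<bar>
    \<le> 2 * (sqrt (freq_sq j) * sqrt (freq_sq (k - j)))"
proof -
  let ?x = "\<lambda>i. real_of_int (j $ i)" and ?y = "\<lambda>i. real_of_int ((k - j) $ i)"
  have "freq_sq k = (\<Sum>i\<in>UNIV. (?x i + ?y i)\<^sup>2)"
    by (simp add: freq_sq_def)
  also have "\<dots> = freq_sq j + freq_sq (k - j) + 2 * (\<Sum>i\<in>UNIV. ?x i * ?y i)"
    by (simp only: power2_sum freq_sq_def sum.distrib sum_distrib_left mult.assoc)
  finally have 1: "freq_sq k - freq_sq j - freq_sq (k - j) = 2 * (\<Sum>i\<in>UNIV. ?x i * ?y i)" by simp
  have "\<bar>\<Sum>i\<in>UNIV. ?x i * ?y i\<bar> \<le> (\<Sum>i\<in>UNIV. \<bar>?x i\<bar> * \<bar>?y i\<bar>)"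
    by (rule order_trans[OF sum_abs]) (simp add: abs_mult)
  also have "\<dots> \<le> L2_set ?x UNIV * L2_set ?y UNIV"
    by (rule L2_set_mult_ineq)
  finally show ?thesis unfolding 1 by (simp add: L2_set_def freq_sq_def)
qed

lemma freq_sq_inner_bound_weight:
  "\<bar>freq_sq k - freq_sq j - freq_sq (k - j)\<bar>
    \<le> 2 * (weight j powr (1/2) * weight (k - j) powr (1/2))"
proof -
  have "sqrt (freq_sq j) * sqrt (freq_sq (k - j)) \<le> sqrt (weight j) * sqrt (weight (k - j))"
    by (intro mult_mono real_sqrt_le_mono) (auto simp: weight_def)
  thus ?thesis using freq_sq_inner_bound[of k j] by (simp add: powr_half_sqrt)
qed

lemma weight_split: "weight k \<le> 2 * (weight j + weight (k - j))"
proof -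
  have "2 * (sqrt (freq_sq j) * sqrt (freq_sq (k - j))) \<le> freq_sq j + freq_sq (k - j)"
    using sum_squares_bound[of "sqrt (freq_sq j)" "sqrt (freq_sq (k - j))"] by simp
  thus ?thesis using freq_sq_inner_bound[of k j] by (simp add: weight_def)
qed

lemma weight_powr_split:
  assumes "0 \<le> s"
  shows "weight k powr s \<le> 4 powr s * (weight j powr s + weight (k - j) powr s)"
proof -
  obtain m where m: "weight j \<le> m" "weight (k - j) \<le> m"
    and ms: "m powr s \<le> weight j powr s + weight (k - j) powr s"
    by (cases "weight j \<le> weight (k - j)")
       (auto intro: that[of "weight j"] that[of "weight (k - j)"])
  have "weight k \<le> 2 * (weight j + weight (k - j))" by (rule weight_split)
  also have "\<dots> \<le> 2 * (m + m)" by (intro mult_left_mono add_mono m) simp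
  finally have "weight k \<le> 4 * m" by simp
  hence "weight k powr s \<le> (4 * m) powr s" by (intro powr_mono2 assms) auto
  also have "\<dots> = 4 powr s * m powr s"
    using order_trans[OF weight_nonneg m(1)] by (simp add: powr_mult)
  also have "\<dots> \<le> 4 powr s * (weight j powr s + weight (k - j) powr s)"
    using ms by simp
  finally show ?thesis .
qed

lemma hs_abs_summable:
  fixes a :: "int ^ 'd::finite \<Rightarrow> complex"
  assumes "s > real CARD('d) / 2" "hs s a"
  shows "ell1 a"
proof (rule summable_on_comparison_test)
  show "(\<lambda>k. weight k powr (-s) + weight k powr s * (cmod (a k))\<^sup>2) summable_on UNIV"
    using assms by (intro summable_on_add summable_weight) (auto simp: hs_def)
  fix k
  let ?x = "weight k powr (s/2) * cmod (a k)" and ?y = "weight k powr (-s/2)"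
  have 1: "weight k powr (s/2) * weight k powr (-s/2) = 1"
    by (simp flip: powr_add)
  have 2: "?x\<^sup>2 = weight k powr s * (cmod (a k))\<^sup>2" "?y\<^sup>2 = weight k powr (-s)"
    by (simp_all add: power_mult_distrib power2_eq_square flip: powr_add)
  have "?x * ?y = (weight k powr (s/2) * weight k powr (-s/2)) * cmod (a k)"
    by (simp only: mult_ac)
  hence "cmod (a k) = ?x * ?y" unfolding 1 by simp
  also have "\<dots> \<le> ?x\<^sup>2 + ?y\<^sup>2"
  proof -
    have "2 * (?x * ?y) \<le> ?x\<^sup>2 + ?y\<^sup>2"
      using sum_squares_bound[of ?x ?y] by (simp only: mult.assoc)
    moreover have "0 \<le> ?x * ?y" by simp
    ultimately show ?thesis by linarith
  qed
  finally show "cmod (a k) \<le> weight k powr (-s) + weight k powr s * (cmod (a k))\<^sup>2"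
    unfolding 2 by simp
qed auto

lemma infsum_Cauchy_Schwarz:
  fixes f g :: "'a \<Rightarrow> real"
  assumes f: "(\<lambda>x. (f x)\<^sup>2) summable_on A" and g: "(\<lambda>x. (g x)\<^sup>2) summable_on A"
    and nonneg: "\<And>x. x \<in> A \<Longrightarrow> 0 \<le> f x" "\<And>x. x \<in> A \<Longrightarrow> 0 \<le> g x"
  shows "(\<lambda>x. f x * g x) summable_on A"
    and "(\<Sum>\<^sub>\<infinity>x\<in>A. f x * g x)\<^sup>2 \<le> (\<Sum>\<^sub>\<infinity>x\<in>A. (f x)\<^sup>2) * (\<Sum>\<^sub>\<infinity>x\<in>A. (g x)\<^sup>2)"
proof -
  let ?F = "\<Sum>\<^sub>\<infinity>x\<in>A. (f x)\<^sup>2" and ?G = "\<Sum>\<^sub>\<infinity>x\<in>A. (g x)\<^sup>2"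
  have F: "0 \<le> ?F" "0 \<le> ?G" by (auto intro: infsum_nonneg)
  have fin: "(\<Sum>x\<in>X. f x * g x) \<le> sqrt (?F * ?G)" if X: "finite X" "X \<subseteq> A" for X
  proof (rule real_le_rsqrt)
    have "(\<Sum>x\<in>X. f x * g x)\<^sup>2 \<le> (\<Sum>x\<in>X. (f x)\<^sup>2) * (\<Sum>x\<in>X. (g x)\<^sup>2)"
      by (rule Cauchy_Schwarz_ineq_sum)
    also have "\<dots> \<le> ?F * ?G"
      by (intro mult_mono finite_sum_le_infsum f g X F sum_nonneg) auto
    finally show "(\<Sum>x\<in>X. f x * g x)\<^sup>2 \<le> ?F * ?G" .
  qed
  show sm: "(\<lambda>x. f x * g x) summable_on A"
    by (rule nonneg_bounded_partial_sums_imp_summable_on[where C = "sqrt (?F * ?G)"])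
       (use nonneg fin in \<open>auto intro!: eventually_finite_subsets_at_top_weakI\<close>)
  have "(\<Sum>\<^sub>\<infinity>x\<in>A. f x * g x) \<le> sqrt (?F * ?G)"
    by (rule infsum_le_finite_sums[OF sm fin])
  hence "(\<Sum>\<^sub>\<infinity>x\<in>A. f x * g x)\<^sup>2 \<le> (sqrt (?F * ?G))\<^sup>2"
    by (intro power_mono infsum_nonneg) (use nonneg in auto)
  thus "(\<Sum>\<^sub>\<infinity>x\<in>A. f x * g x)\<^sup>2 \<le> ?F * ?G" using F by simp
qed

lemma infsum_finite_sum:
  fixes f :: "'a \<Rightarrow> 'b \<Rightarrow> 'c::{topological_comm_monoid_add, t2_space}"
  assumes "finite K" "\<And>k. k \<in> K \<Longrightarrow> f k summable_on A"
  shows "(\<lambda>x. \<Sum>k\<in>K. f k x) summable_on A"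
    and "(\<Sum>\<^sub>\<infinity>x\<in>A. \<Sum>k\<in>K. f k x) = (\<Sum>k\<in>K. \<Sum>\<^sub>\<infinity>x\<in>A. f k x)" (is ?G1)
proof -
  have "((\<lambda>x. \<Sum>k\<in>K. f k x) has_sum (\<Sum>k\<in>K. \<Sum>\<^sub>\<infinity>x\<in>A. f k x)) A"
    using assms by (induction K rule: finite_induct) (auto intro!: has_sum_add)
  thus "(\<lambda>x. \<Sum>k\<in>K. f k x) summable_on A"
    and ?G1
    by (auto simp: has_sum_iff)
qed

lemma bij_reflect_shift: "bij_betw (\<lambda>j. k - j) UNIV (UNIV :: 'a::ab_group_add set)"
  by (rule bij_betwI[where g = "\<lambda>j. k - j"]) auto

lemma bij_shift: "bij_betw (\<lambda>k. k - j) UNIV (UNIV :: 'a::ab_group_add set)"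
  by (rule bij_betwI[where g = "\<lambda>k. k + j"]) auto

lemma abs_summable_conv:
  fixes a b :: "int ^ 'd \<Rightarrow> complex"
  assumes "ell1 a" "\<And>k. cmod (b k) \<le> B"
  shows "(\<lambda>j. cmod (a j) * cmod (b (k - j))) summable_on UNIV"
    and "(\<lambda>j. cmod (a j * b (k - j))) summable_on UNIV"
    and "(\<lambda>j. a j * b (k - j)) summable_on UNIV"
proof -
  have B: "0 \<le> B" using order_trans[OF norm_ge_zero assms(2)] .
  show 1: "(\<lambda>j. cmod (a j) * cmod (b (k - j))) summable_on UNIV"
    by (rule summable_on_comparison_test[OF summable_on_cmult_left[OF assms(1), of B]])
       (auto intro!: mult_left_mono assms(2))
  thus 2: "(\<lambda>j. cmod (a j * b (k - j))) summable_on UNIV" by (simp add: norm_mult)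
  thus "(\<lambda>j. a j * b (k - j)) summable_on UNIV" by (rule abs_summable_summable)
qed

text \<open>
The algebra property, for anything dominated by the convolution of the absolute values.
\<close>

theorem hs_conv_majorant:
  fixes a b c :: "int ^ 'd::finite \<Rightarrow> complex"
  assumes s: "s > real CARD('d) / 2" and a: "hs s a" and b: "hs s b"
    and le: "\<And>k. cmod (c k) \<le> (\<Sum>\<^sub>\<infinity>j. cmod (a j) * cmod (b (k - j)))"
  shows "hs s c" and "hnorm s c \<le> alg_const TYPE('d) s * hnorm s a * hnorm s b" (is ?G1)
proof -
  have s0: "0 \<le> s" using s by (meson divide_nonneg_nonneg less_eq_real_def of_nat_0_le_iff order_trans zero_le_numeral)
  define A where "A = (\<lambda>k. weight k powr s * (cmod (a k))\<^sup>2)"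
  define B where "B = (\<lambda>k. weight k powr s * (cmod (b k))\<^sup>2)"
  define S where "S = (\<Sum>\<^sub>\<infinity>k::int ^ 'd. weight k powr (-s))"
  have AB: "0 \<le> A k" "0 \<le> B k" for k by (auto simp: A_def B_def)
  have A: "A summable_on UNIV" and B: "B summable_on UNIV"
    using a b by (auto simp: hs_def A_def B_def)
  have Bk: "(\<lambda>k. B (k - j)) summable_on UNIV" "(\<Sum>\<^sub>\<infinity>k. B (k - j)) = (hnorm s b)\<^sup>2" for j
    using B summable_on_reindex_bij_betw[OF bij_shift[of j], of B]
      infsum_reindex_bij_betw[OF bij_shift[of j], of B]
    by (simp_all add: hnorm_sq B_def)
  have Bbd: "B k \<le> (hnorm s b)\<^sup>2" for k
    using hs_finite_sum_le[OF b, of "{k}"] by (simp add: B_def)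
  have ABs: "(\<lambda>j. A j * B (k - j)) summable_on UNIV" for k
    by (rule summable_on_comparison_test[OF summable_on_cmult_left[OF A, of "(hnorm s b)\<^sup>2"]])
       (auto intro!: mult_left_mono mult_nonneg_nonneg AB Bbd)
  note W = summable_weight[OF s]
  have Wk: "(\<lambda>j::int^'d. weight (k - j) powr (-s)) summable_on UNIV"
    "(\<Sum>\<^sub>\<infinity>j::int^'d. weight (k - j) powr (-s)) = S" for k
    using W summable_on_reindex_bij_betw[OF bij_reflect_shift[of k], of "\<lambda>j. weight j powr (-s)"]
      infsum_reindex_bij_betw[OF bij_reflect_shift[of k], of "\<lambda>j. weight j powr (-s)"]
    by (simp_all add: S_def)
  have S0: "0 \<le> S" by (auto simp: S_def intro: infsum_nonneg)
  \<comment> \<open>Cauchy-Schwarz against the inverse weights, whose convolution is dominated by the inverse weight itself.\<close>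
  have main: "weight k powr s * (cmod (c k))\<^sup>2 \<le> 2 * 4 powr s * S * (\<Sum>\<^sub>\<infinity>j. A j * B (k - j))" for k
  proof -
    define f where "f j = weight j powr (s/2) * cmod (a j) * (weight (k - j) powr (s/2) * cmod (b (k - j)))" for j
    define g where "g j = weight j powr (-s/2) * weight (k - j) powr (-s/2)" for j
    have f2: "(f j)\<^sup>2 = A j * B (k - j)" for j
      by (simp add: f_def A_def B_def power_mult_distrib) (simp add: power2_eq_square flip: powr_add)
    have g2: "(g j)\<^sup>2 = weight j powr (-s) * weight (k - j) powr (-s)" for j
      by (simp add: g_def power_mult_distrib) (simp add: power2_eq_square flip: powr_add)
    have fg: "f j * g j = cmod (a j) * cmod (b (k - j))" for j
    proof -
      have "weight i powr (s/2) * weight i powr (-s/2) = 1" for i :: "int ^ 'd"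
        by (simp flip: powr_add)
      moreover have "f j * g j = (weight j powr (s/2) * weight j powr (-s/2))
          * (weight (k - j) powr (s/2) * weight (k - j) powr (-s/2)) * (cmod (a j) * cmod (b (k - j)))"
        unfolding f_def g_def by (simp only: mult_ac)
      ultimately show ?thesis by simp
    qed
    have wg: "weight k powr s * (g j)\<^sup>2 \<le> 4 powr s * (weight j powr (-s) + weight (k - j) powr (-s))" for j
    proof -
      have "weight k powr s * (g j)\<^sup>2 \<le> 4 powr s * (weight j powr s + weight (k - j) powr s) * (g j)\<^sup>2"
        by (intro mult_right_mono weight_powr_split s0) auto
      also have "\<dots> = 4 powr s * (weight j powr s * weight j powr (-s) * weight (k - j) powr (-s)
          + weight (k - j) powr s * weight (k - j) powr (-s) * weight j powr (-s))"
        unfolding g2 by (simp add: algebra_simps)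
      also have "\<dots> = 4 powr s * (weight j powr (-s) + weight (k - j) powr (-s))"
        by (simp add: add.commute flip: powr_add)
      finally show ?thesis .
    qed
    have g2s: "(\<lambda>j. (g j)\<^sup>2) summable_on UNIV"
    proof (rule summable_on_comparison_test[OF W])
      show "(g j)\<^sup>2 \<le> weight j powr (-s)" for j
      proof -
        have "weight (k - j) powr (-s) \<le> 1" using s0 by (simp add: powr_minus weight_powr_ge_1 inverse_le_1_iff)
        thus ?thesis unfolding g2 by (simp add: mult_left_le)
      qed
    qed auto
    have "weight k powr s * (\<Sum>\<^sub>\<infinity>j. (g j)\<^sup>2) = (\<Sum>\<^sub>\<infinity>j. weight k powr s * (g j)\<^sup>2)"
      by (rule infsum_cmult_right[OF g2s, symmetric])
    also have "\<dots> \<le> (\<Sum>\<^sub>\<infinity>j. 4 powr s * (weight j powr (-s) + weight (k - j) powr (-s)))"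
      by (intro infsum_mono summable_on_cmult_right summable_on_add g2s W Wk wg)
    also have "\<dots> = 4 powr s * (S + S)"
      by (simp add: infsum_cmult_right' infsum_add[OF W Wk(1)] Wk(2)) (simp add: S_def)
    finally have gS: "weight k powr s * (\<Sum>\<^sub>\<infinity>j. (g j)\<^sup>2) \<le> 2 * 4 powr s * S" by simp
    have "(cmod (c k))\<^sup>2 \<le> (\<Sum>\<^sub>\<infinity>j. f j * g j)\<^sup>2"
      using le[of k] unfolding fg by (intro power_mono) auto
    also have "\<dots> \<le> (\<Sum>\<^sub>\<infinity>j. (f j)\<^sup>2) * (\<Sum>\<^sub>\<infinity>j. (g j)\<^sup>2)"
      by (rule infsum_Cauchy_Schwarz(2)) (auto simp: f2 ABs g2s, auto simp: f_def g_def)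
    finally have "weight k powr s * (cmod (c k))\<^sup>2
        \<le> weight k powr s * ((\<Sum>\<^sub>\<infinity>j. (f j)\<^sup>2) * (\<Sum>\<^sub>\<infinity>j. (g j)\<^sup>2))"
      by (intro mult_left_mono) auto
    also have "\<dots> = (weight k powr s * (\<Sum>\<^sub>\<infinity>j. (g j)\<^sup>2)) * (\<Sum>\<^sub>\<infinity>j. A j * B (k - j))"
      unfolding f2 by (simp only: mult_ac)
    also have "\<dots> \<le> 2 * 4 powr s * S * (\<Sum>\<^sub>\<infinity>j. A j * B (k - j))"
      by (intro mult_right_mono gS infsum_nonneg mult_nonneg_nonneg AB)
    finally show ?thesis .
  qed
  have "(\<Sum>k\<in>K. weight k powr s * (cmod (c k))\<^sup>2) \<le> (alg_const TYPE('d) s * hnorm s a * hnorm s b)\<^sup>2"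
    if K: "finite K" for K
  proof -
    have "(\<Sum>k\<in>K. weight k powr s * (cmod (c k))\<^sup>2)
        \<le> (\<Sum>k\<in>K. 2 * 4 powr s * S * (\<Sum>\<^sub>\<infinity>j. A j * B (k - j)))"
      by (intro sum_mono main)
    also have "\<dots> = 2 * 4 powr s * S * (\<Sum>k\<in>K. \<Sum>\<^sub>\<infinity>j. A j * B (k - j))"
      by (simp add: sum_distrib_left)
    also have "(\<Sum>k\<in>K. \<Sum>\<^sub>\<infinity>j. A j * B (k - j)) = (\<Sum>\<^sub>\<infinity>j. \<Sum>k\<in>K. A j * B (k - j))"
      by (rule infsum_finite_sum(2)[OF K ABs, symmetric])
    also have "\<dots> \<le> (\<Sum>\<^sub>\<infinity>j. A j * (hnorm s b)\<^sup>2)"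
    proof (rule infsum_mono)
      show "(\<lambda>j. \<Sum>k\<in>K. A j * B (k - j)) summable_on UNIV"
        by (rule infsum_finite_sum(1)[OF K ABs])
      show "(\<lambda>j. A j * (hnorm s b)\<^sup>2) summable_on UNIV"
        by (rule summable_on_cmult_left[OF A])
      fix j
      have "(\<Sum>k\<in>K. B (k - j)) \<le> (hnorm s b)\<^sup>2"
        unfolding Bk(2)[of j, symmetric] by (intro finite_sum_le_infsum Bk K) (auto simp: AB)
      thus "(\<Sum>k\<in>K. A j * B (k - j)) \<le> A j * (hnorm s b)\<^sup>2"
        by (simp add: AB mult_left_mono flip: sum_distrib_left)
    qed
    also have "\<dots> = (hnorm s a)\<^sup>2 * (hnorm s b)\<^sup>2"
      unfolding infsum_cmult_left[OF A] by (simp add: hnorm_sq A_def)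
    finally have "(\<Sum>k\<in>K. weight k powr s * (cmod (c k))\<^sup>2)
      \<le> 2 * 4 powr s * S * ((hnorm s a)\<^sup>2 * (hnorm s b)\<^sup>2)"
      using S0 by (simp add: mult_left_mono)
    also have "\<dots> = (alg_const TYPE('d) s * hnorm s a * hnorm s b)\<^sup>2"
      using S0 by (simp add: alg_const_def power_mult_distrib S_def)
    finally show ?thesis .
  qed
  from hs_hnorm_leI[OF _ this]
  show "hs s c" and ?G1 by simp_all
qed

lemma conv_commute: "conv a b k = conv b a k"
  using infsum_reindex_bij_betw[OF bij_reflect_shift[of k], of "\<lambda>j. a j * b (k - j)"]
  by (simp add: conv_def mult.commute)

text \<open>
An order \<open>r > d / 2\<close>. The parameter \<open>ty\<close> only records the dimension.
\<close>

locale sobolev_algebra =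
  fixes r :: real and ty :: "'d::finite itself"
  assumes r_gt: "r > real CARD('d) / 2"
begin

text \<open>
The constant of the algebra property in the fixed order \<open>r\<close>.
\<close>

definition algc :: real where
  "algc = alg_const ty r"

lemma algc_eq: "alg_const TYPE('d) r = algc"
  by (simp add: algc_def alg_const_def)

lemma algc_nonneg [simp]: "0 \<le> algc"
  by (simp add: algc_def)

lemma r_nonneg: "0 \<le> r"
  using r_gt by (meson divide_nonneg_nonneg less_eq_real_def of_nat_0_le_iff order_trans zero_le_numeral)

lemma hs_l1: "hs r (a :: int ^ 'd \<Rightarrow> complex) \<Longrightarrow> ell1 a"
  by (rule hs_abs_summable[OF r_gt])

lemma conv_summable:
  fixes a b :: "int ^ 'd \<Rightarrow> complex"
  assumes "hs r a" "hs r b"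
  shows "(\<lambda>j. cmod (a j) * cmod (b (k - j))) summable_on UNIV"
    and "(\<lambda>j. cmod (a j * b (k - j))) summable_on UNIV"
    and "(\<lambda>j. a j * b (k - j)) summable_on UNIV"
  by (rule abs_summable_conv[OF hs_l1[OF assms(1)] cmod_le_hnorm[OF assms(2) r_nonneg]])+

lemma hs_conv:
  fixes a b :: "int ^ 'd \<Rightarrow> complex"
  assumes "hs r a" "hs r b"
  shows "hs r (conv a b)" "hnorm r (conv a b) \<le> algc * hnorm r a * hnorm r b" (is ?G1)
proof -
  have "cmod (conv a b k) \<le> (\<Sum>\<^sub>\<infinity>j. cmod (a j) * cmod (b (k - j)))" for k
    using norm_infsum_bound[OF conv_summable(2)[OF assms, of k]] by (simp add: conv_def norm_mult)
  from hs_conv_majorant[OF r_gt assms this, unfolded algc_eq]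
  show "hs r (conv a b)" ?G1 by auto
qed

lemma conv_diff_left:
  fixes a b :: "int ^ 'd \<Rightarrow> complex"
  assumes "hs r a" "hs r a'" "hs r b"
  shows "conv (\<lambda>k. a k - a' k) b k = conv a b k - conv a' b k"
  unfolding conv_def left_diff_distrib
  using infsum_add[OF conv_summable(3)[OF assms(1,3)] conv_summable(3)[OF assms(2,3), THEN summable_on_uminus[THEN iffD2]], of k k]
  by (simp add: infsum_uminus)

lemma conv_diff_right:
  fixes a b :: "int ^ 'd \<Rightarrow> complex"
  assumes "hs r a" "hs r b" "hs r b'"
  shows "conv a (\<lambda>k. b k - b' k) k = conv a b k - conv a b' k"
  using conv_diff_left[OF assms(2,3,1), of k] by (simp add: conv_commute[of a])

lemma conv_add_left:
  fixes a b :: "int ^ 'd \<Rightarrow> complex"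
  assumes "hs r a" "hs r a'" "hs r b"
  shows "conv (\<lambda>k. a k + a' k) b k = conv a b k + conv a' b k"
  unfolding conv_def distrib_right
  using infsum_add[OF conv_summable(3)[OF assms(1,3)] conv_summable(3)[OF assms(2,3)], of k k] by simp

lemma hs_conv_diff:
  fixes a b :: "int ^ 'd \<Rightarrow> complex"
  assumes "hs r a" "hs r a'" "hs r b" "hs r b'"
  shows "hs r (\<lambda>k. conv a b k - conv a' b' k)"
    and "hnorm r (\<lambda>k. conv a b k - conv a' b' k)
      \<le> algc * (hnorm r (\<lambda>k. a k - a' k) * hnorm r b + hnorm r a' * hnorm r (\<lambda>k. b k - b' k))"
proof -
  have eq: "(\<lambda>k. conv a b k - conv a' b' k)
    = (\<lambda>k. conv (\<lambda>k. a k - a' k) b k + conv a' (\<lambda>k. b k - b' k) k)"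
    using assms by (auto simp: conv_diff_left conv_diff_right)
  note d = hs_diff(1)[OF assms(1,2)] hs_diff(1)[OF assms(3,4)]
  show "hs r (\<lambda>k. conv a b k - conv a' b' k)"
    unfolding eq by (intro hs_add hs_conv assms d)
  show "hnorm r (\<lambda>k. conv a b k - conv a' b' k)
      \<le> algc * (hnorm r (\<lambda>k. a k - a' k) * hnorm r b + hnorm r a' * hnorm r (\<lambda>k. b k - b' k))"
    unfolding eq
    using hs_add(2)[OF hs_conv(1)[OF d(1) assms(3)] hs_conv(1)[OF assms(2) d(2)]]
      hs_conv(2)[OF d(1) assms(3)] hs_conv(2)[OF assms(2) d(2)]
    by (simp add: algebra_simps)
qed

text \<open>
A bilinear expression whose symbol costs one derivative on each factor.
\<close>

lemma hs_bilinear_gradient: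
  fixes a b c :: "int ^ 'd \<Rightarrow> complex"
  assumes a: "hs (r + 1) a" and b: "hs (r + 1) b"
    and le: "\<And>k. cmod (c k) \<le> (\<Sum>\<^sub>\<infinity>j. weight j powr (1/2) * cmod (a j) * (weight (k - j) powr (1/2) * cmod (b (k - j))))"
  shows "hs r c" "hnorm r c \<le> algc * hnorm (r + 1) a * hnorm (r + 1) b" (is ?G1)
proof -
  let ?d = "\<lambda>a k. of_real (weight k powr (1/2)) * a k"
  have "hs r (?d a)" "hs r (?d b)" using a b by (simp_all add: hs_weight_shift)
  from hs_conv_majorant[OF r_gt this, of c, unfolded algc_eq] le
  show "hs r c" ?G1
    by (simp_all add: norm_mult hs_weight_shift)
qed

lemma hs_bilinear_gradient_summable:
  fixes a b :: "int ^ 'd \<Rightarrow> complex"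
  assumes a: "hs (r + 1) a" and b: "hs (r + 1) b"
  shows "(\<lambda>j. weight j powr (1/2) * cmod (a j) * (weight (k - j) powr (1/2) * cmod (b (k - j)))) summable_on UNIV"
proof -
  let ?d = "\<lambda>a k. of_real (weight k powr (1/2)) * a k"
  have "hs r (?d a)" "hs r (?d b)" using a b by (simp_all add: hs_weight_shift)
  from conv_summable(1)[OF this, of k] show ?thesis by (simp add: norm_mult)
qed

end

text \<open>
A bilinear expression followed by \<open>2 * p\<close> derivatives.
\<close>

lemma hs_bilinear_outer:
  fixes a b c :: "int ^ 'd::finite \<Rightarrow> complex"
  assumes p: "0 \<le> p" and r: "r > real CARD('d) / 2" and a: "hs (r + 2 * p) a" and b: "hs (r + 2 * p) b"
    and le: "\<And>k. cmod (c k) \<le> weight k powr p * (\<Sum>\<^sub>\<infinity>j. cmod (a j) * cmod (b (k - j)))"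
  shows "hs r c" "hnorm r c \<le> alg_const TYPE('d) (r + 2 * p) * hnorm (r + 2 * p) a * hnorm (r + 2 * p) b" (is ?G1)
proof -
  define d :: "int ^ 'd \<Rightarrow> complex" where "d k = of_real (\<Sum>\<^sub>\<infinity>j. cmod (a j) * cmod (b (k - j)))" for k
  have nn: "0 \<le> (\<Sum>\<^sub>\<infinity>j. cmod (a j) * cmod (b (k - j)))" for k by (intro infsum_nonneg) auto
  have d: "hs (r + 2 * p) d" "hnorm (r + 2 * p) d \<le> alg_const TYPE('d) (r + 2 * p) * hnorm (r + 2 * p) a * hnorm (r + 2 * p) b"
    using hs_conv_majorant[of "r + 2 * p" a b d] p r a b nn by (auto simp: d_def)
  have "hs r (\<lambda>k. of_real (weight k powr p) * d k)" using d(1) by (simp add: hs_weight_shift)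
  moreover have "cmod (c k) \<le> cmod (of_real (weight k powr p) * d k)" for k
    using le[of k] nn[of k] by (simp add: norm_mult d_def)
  ultimately have "hs r c" "hnorm r c \<le> hnorm r (\<lambda>k. of_real (weight k powr p) * d k)"
    by (rule hs_mono)+
  thus "hs r c" ?G1
    using d(2) by (simp_all add: hs_weight_shift)
qed

section \<open>Curves of coefficient families\<close>

text \<open>
The mean value inequality for a curve that is differentiable coefficient by coefficient only. On a
finite set of frequencies it follows from the real mean value theorem for the inner product of the
curve with its own increment.
\<close>

lemma hnorm_mean_value:
  fixes F F' :: "real \<Rightarrow> int ^ 'd \<Rightarrow> complex"
  assumes t: "0 \<le> t" and B: "0 \<le> B"
    and deriv: "\<And>k s. s \<in> {0..t} \<Longrightarrow> ((\<lambda>s. F s k) has_vector_derivative F' s k) (at s within {0..t})"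
    and bound: "\<And>s. s \<in> {0..t} \<Longrightarrow> hs r (F' s) \<and> hnorm r (F' s) \<le> B"
  shows "hs r (\<lambda>k. F t k - F 0 k)" and "hnorm r (\<lambda>k. F t k - F 0 k) \<le> t * B"
proof -
  define z where "z k = F t k - F 0 k" for k
  have main: "L2_set (\<lambda>k. weight k powr (r/2) * cmod (z k)) K \<le> t * B" if K: "finite K" for K
  proof (cases "t = 0")
    case True thus ?thesis by (simp add: z_def L2_set_def)
  next
    case False
    hence t': "0 < t" using t by simp
    define n where "n = L2_set (\<lambda>k. weight k powr (r/2) * cmod (z k)) K"
    have n0: "0 \<le> n" by (simp add: n_def)
    \<comment> \<open>The inner product of \<open>F s\<close> with the increment \<open>z\<close>, restricted to \<open>K\<close>.\<close>
    define \<phi> where "\<phi> s = (\<Sum>k\<in>K. weight k powr r * Re (cnj (z k) * F s k))" for s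
    define \<phi>' where "\<phi>' s = (\<Sum>k\<in>K. weight k powr r * Re (cnj (z k) * F' s k))" for s
    have d: "(\<phi> has_derivative (\<lambda>h. h *\<^sub>R \<phi>' s)) (at s within {0..t})" if s: "s \<in> {0..t}" for s
    proof -
      have "(\<phi> has_vector_derivative \<phi>' s) (at s within {0..t})"
        unfolding \<phi>_def \<phi>'_def
        by (intro has_vector_derivative_sum has_vector_derivative_mult_right
            bounded_linear.has_vector_derivative[OF bounded_linear_Re] deriv s)
      thus ?thesis by (simp add: has_vector_derivative_def)
    qed
    obtain s where s: "s \<in> {0<..<t}" and eq: "\<phi> t - \<phi> 0 = (t - 0) *\<^sub>R \<phi>' s"
      using mvt_simple[OF t', of \<phi> "\<lambda>s h. h *\<^sub>R \<phi>' s"] d by auto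
    hence s': "s \<in> {0..t}" by auto
    have n2: "\<phi> t - \<phi> 0 = n\<^sup>2"
    proof -
      have "\<phi> t - \<phi> 0 = (\<Sum>k\<in>K. weight k powr r * (cmod (z k))\<^sup>2)"
        unfolding \<phi>_def sum_subtractf[symmetric] right_diff_distrib[symmetric] minus_complex.sel(1)[symmetric]
        by (simp add: z_def[symmetric] mult.commute[of "cnj _"] flip: complex_norm_square right_diff_distrib)
      thus ?thesis by (simp add: n_def L2_weight_eq sum_nonneg)
    qed
    have "\<phi>' s \<le> (\<Sum>k\<in>K. \<bar>weight k powr (r/2) * cmod (z k)\<bar> * \<bar>weight k powr (r/2) * cmod (F' s k)\<bar>)"
      unfolding \<phi>'_def
    proof (rule sum_mono)
      fix k
      have "Re (cnj (z k) * F' s k) \<le> cmod (z k) * cmod (F' s k)"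
        using complex_Re_le_cmod[of "cnj (z k) * F' s k"] by (simp add: norm_mult)
      hence "weight k powr r * Re (cnj (z k) * F' s k) \<le> weight k powr r * (cmod (z k) * cmod (F' s k))"
        by (intro mult_left_mono) auto
      also have "\<dots> = (weight k powr (r/2) * weight k powr (r/2)) * (cmod (z k) * cmod (F' s k))"
        by (simp flip: powr_add)
      also have "\<dots> = \<bar>weight k powr (r/2) * cmod (z k)\<bar> * \<bar>weight k powr (r/2) * cmod (F' s k)\<bar>"
        by (simp only: abs_mult abs_norm_cancel powr_nonneg_iff abs_of_nonneg[OF powr_ge_zero] mult_ac)
      finally show "weight k powr r * Re (cnj (z k) * F' s k)
        \<le> \<bar>weight k powr (r/2) * cmod (z k)\<bar> * \<bar>weight k powr (r/2) * cmod (F' s k)\<bar>" .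
    qed
    also have "\<dots> \<le> n * L2_set (\<lambda>k. weight k powr (r/2) * cmod (F' s k)) K"
      unfolding n_def by (rule L2_set_mult_ineq)
    also have "\<dots> \<le> n * B"
      using hs_L2_le[of r "F' s" K] bound[OF s'] K by (intro mult_left_mono n0) auto
    finally have "t * \<phi>' s \<le> t * (n * B)" by (rule mult_left_mono[OF _ t])
    moreover have "n\<^sup>2 = t * \<phi>' s" using n2 eq by simp
    ultimately have "n\<^sup>2 \<le> t * (n * B)" by simp
    hence "n * n \<le> n * (t * B)" by (simp add: power2_eq_square mult_ac)
    hence "n \<le> t * B" using n0 t B by (cases "n = 0") auto
    thus ?thesis by (simp add: n_def)
  qed
  have "0 \<le> t * B" using t B by simp
  from hs_L2_leI[OF this main]
  show "hs r (\<lambda>k. F t k - F 0 k)" and "hnorm r (\<lambda>k. F t k - F 0 k) \<le> t * B"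
    by (auto simp: z_def)
qed

lemma has_vector_derivative_iff_quotient:
  fixes f :: "real \<Rightarrow> complex"
  shows "(f has_vector_derivative D) (at s within S)
    \<longleftrightarrow> ((\<lambda>t. (f t - f s) / of_real (t - s)) \<longlongrightarrow> D) (at s within S)"
proof -
  have "(f has_vector_derivative D) (at s within S)
    \<longleftrightarrow> ((\<lambda>t. ((f t - f s) - (t - s) *\<^sub>R D) /\<^sub>R \<bar>t - s\<bar>) \<longlongrightarrow> 0) (at s within S)"
    by (simp add: has_vector_derivative_def has_derivative_within bounded_linear_scaleR_left
        real_norm_def diff_diff_eq divide_inverse)
  also have "\<dots> \<longleftrightarrow> ((\<lambda>t. norm (((f t - f s) - (t - s) *\<^sub>R D) /\<^sub>R \<bar>t - s\<bar>)) \<longlongrightarrow> 0) (at s within S)"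
    by (simp only: tendsto_norm_zero_iff)
  also have "\<dots> \<longleftrightarrow> ((\<lambda>t. norm ((f t - f s) / of_real (t - s) - D)) \<longlongrightarrow> 0) (at s within S)"
  proof (rule tendsto_cong)
    have "norm (((f t - f s) - (t - s) *\<^sub>R D) /\<^sub>R \<bar>t - s\<bar>) = norm ((f t - f s) / of_real (t - s) - D)"
      if "t \<noteq> s" for t
    proof -
      have "(f t - f s) / of_real (t - s) - D = ((f t - f s) - (t - s) *\<^sub>R D) / of_real (t - s)"
        using that by (simp add: field_simps scaleR_conv_of_real)
      hence "norm ((f t - f s) / of_real (t - s) - D) = norm ((f t - f s) - (t - s) *\<^sub>R D) / \<bar>t - s\<bar>"
        by (simp only: norm_divide norm_of_real)
      thus ?thesis by (simp only: norm_scaleR abs_inverse abs_idempotent divide_inverse_commute)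
    qed
    thus "\<forall>\<^sub>F t in at s within S. norm (((f t - f s) - (t - s) *\<^sub>R D) /\<^sub>R \<bar>t - s\<bar>)
        = norm ((f t - f s) / of_real (t - s) - D)"
      by (simp add: eventually_at_filter)
  qed
  also have "\<dots> \<longleftrightarrow> ((\<lambda>t. (f t - f s) / of_real (t - s)) \<longlongrightarrow> D) (at s within S)"
    unfolding tendsto_norm_zero_iff by (rule Lim_null[symmetric])
  finally show ?thesis .
qed

text \<open>
Termwise differentiation with absolutely summable coefficients: the difference quotients converge
uniformly by the Weierstrass M-test.
\<close>

lemma has_vector_derivative_infsum:
  fixes a :: "'i \<Rightarrow> complex" and f :: "'i \<Rightarrow> real \<Rightarrow> complex"
  assumes a: "ell1 a"
    and deriv: "\<And>j. (f j has_vector_derivative f' j) (at s within S)"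
    and f': "\<And>j. cmod (f' j) \<le> 1"
    and Lip: "\<And>j t. cmod (f j t - f j s) \<le> \<bar>t - s\<bar>"
    and bd: "\<And>j t. cmod (f j t) \<le> \<bar>t\<bar>"
  shows "((\<lambda>t. \<Sum>\<^sub>\<infinity>j. a j * f j t) has_vector_derivative (\<Sum>\<^sub>\<infinity>j. a j * f' j)) (at s within S)"
proof -
  have sm: "(\<lambda>j. a j * g j) summable_on UNIV" if "\<And>j. cmod (g j) \<le> M" for g M
  proof (rule abs_summable_summable[OF summable_on_comparison_test[OF summable_on_cmult_left[OF a, of M]]])
    show "norm (a j * g j) \<le> cmod (a j) * M" for j
      by (simp add: norm_mult that mult_left_mono)
  qed auto
  define q where "q j t = a j * ((f j t - f j s) / of_real (t - s))" for j t
  have qle: "cmod ((f j t - f j s) / of_real (t - s)) \<le> 1" if "t \<noteq> s" for j t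
    using Lip[of j t] that by (simp add: norm_divide divide_le_eq flip: of_real_diff)
  have "uniform_limit (S - {s}) (\<lambda>X t. \<Sum>j\<in>X. q j t) (\<lambda>t. \<Sum>\<^sub>\<infinity>j. q j t) (finite_subsets_at_top UNIV)"
  proof (rule Weierstrass_m_test_general[OF _ a])
    fix j t assume "t \<in> S - {s}"
    thus "cmod (q j t) \<le> cmod (a j)"
      using mult_left_mono[OF qle[of t j], of "cmod (a j)"]
      unfolding q_def norm_mult[of "a j"] by simp
  qed
  hence "((\<lambda>t. \<Sum>\<^sub>\<infinity>j. q j t) \<longlongrightarrow> (\<Sum>\<^sub>\<infinity>j. a j * f' j)) (at s within S)"
  proof (rule swap_uniform_limit'[rotated 2])
    show "\<forall>\<^sub>F X in finite_subsets_at_top UNIV. ((\<lambda>t. \<Sum>j\<in>X. q j t) \<longlongrightarrow> (\<Sum>j\<in>X. a j * f' j)) (at s within S)"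
      unfolding q_def using deriv
      by (intro always_eventually allI tendsto_sum tendsto_mult tendsto_const)
         (simp add: has_vector_derivative_iff_quotient)
    show "((\<lambda>X. \<Sum>j\<in>X. a j * f' j) \<longlongrightarrow> (\<Sum>\<^sub>\<infinity>j. a j * f' j)) (finite_subsets_at_top UNIV)"
      by (rule infsum_tendsto[OF sm[OF f']])
    show "\<forall>\<^sub>F t in at s within S. t \<in> S - {s}" by (auto simp: eventually_at_filter)
    show "finite_subsets_at_top UNIV \<noteq> bot" by simp
  qed
  moreover have "(\<Sum>\<^sub>\<infinity>j. q j t) = ((\<Sum>\<^sub>\<infinity>j. a j * f j t) - (\<Sum>\<^sub>\<infinity>j. a j * f j s)) / of_real (t - s)" for t
  proof -
    have "(\<Sum>\<^sub>\<infinity>j. a j * f j t) - (\<Sum>\<^sub>\<infinity>j. a j * f j s) = (\<Sum>\<^sub>\<infinity>j. a j * (f j t - f j s))"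
    proof -
      have "(\<lambda>j. a j * f j t) summable_on UNIV" "(\<lambda>j. - (a j * f j s)) summable_on UNIV"
        using sm[OF bd] by (auto simp: summable_on_uminus)
      from infsum_add[OF this] show ?thesis by (simp add: infsum_uminus right_diff_distrib)
    qed
    moreover have "(\<Sum>\<^sub>\<infinity>j. q j t) = (\<Sum>\<^sub>\<infinity>j. a j * (f j t - f j s)) * inverse (of_real (t - s))"
      unfolding q_def divide_inverse mult.assoc[symmetric] by (rule infsum_cmult_left')
    ultimately show ?thesis by (simp add: divide_inverse)
  qed
  ultimately show ?thesis unfolding has_vector_derivative_iff_quotient by simp
qed

text \<open>
The integral of $e^{i l \sigma}$ over $0 \<le> \sigma \<le> s$, in the form in which it occurs in the
scheme.
\<close>

definition int_cis :: "real \<Rightarrow> real \<Rightarrow> complex" where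
  "int_cis l s = of_real s * phi1 (\<i> * of_real s * of_real l)"

lemma int_cis_0 [simp]: "int_cis l 0 = 0"
  by (simp add: int_cis_def)

lemma int_cis_eq:
  "int_cis l s = (if l = 0 then of_real s else (cis (l * s) - 1) / (\<i> * of_real l))"
  by (auto simp: int_cis_def phi1_def cis_conv_exp mult_ac)

lemma int_cis_has_vector_derivative:
  "(int_cis l has_vector_derivative cis (l * s)) (at s within S)"
proof (cases "l = 0")
  case True
  have "((\<lambda>s. of_real s :: complex) has_vector_derivative 1) (at s within S)"
    by (auto intro!: derivative_eq_intros simp: has_vector_derivative_def scaleR_conv_of_real)
  thus ?thesis using True by (simp add: int_cis_eq[abs_def])
next
  case False
  let ?A = "\<i> * complex_of_real l"
  have cis: "cis (l * s) = exp (s *\<^sub>R ?A)" for s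
    by (simp add: cis_conv_exp scaleR_conv_of_real mult_ac)
  have "((\<lambda>s. (exp (s *\<^sub>R ?A) - 1) * inverse ?A) has_vector_derivative exp (s *\<^sub>R ?A) * ?A * inverse ?A)
      (at s within S)"
    using has_vector_derivative_diff[OF exp_scaleR_has_vector_derivative_right has_vector_derivative_const]
    by (intro has_vector_derivative_mult_left) simp
  hence "((\<lambda>s. (cis (l * s) - 1) / ?A) has_vector_derivative cis (l * s)) (at s within S)"
  proof -
    have nz: "?A \<noteq> 0" using False by simp
    have "exp (s *\<^sub>R ?A) * ?A * inverse ?A = exp (s *\<^sub>R ?A)" for s
      by (subst mult.assoc) (simp only: right_inverse[OF nz] mult_1_right)
    thus ?thesis if "((\<lambda>s. (exp (s *\<^sub>R ?A) - 1) * inverse ?A) has_vector_derivative exp (s *\<^sub>R ?A) * ?A * inverse ?A)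
      (at s within S)" using that unfolding cis divide_inverse by (simp only:)
  qed
  thus ?thesis using False by (simp add: int_cis_eq[abs_def])
qed

lemma norm_cis_diff_le: "cmod (cis x - cis y) \<le> \<bar>x - y\<bar>"
proof -
  have "cis x - cis y = cis y * (exp (\<i> * of_real (x - y)) - 1)"
    by (simp add: cis_conv_exp right_diff_distrib ring_distribs flip: exp_add)
  hence "cmod (cis x - cis y) = 2 * \<bar>sin ((x - y) / 2)\<bar>"
    by (simp only: norm_mult norm_cis dist_exp_i_1 mult_1)
  also have "\<dots> \<le> \<bar>x - y\<bar>"
    using abs_sin_x_le_abs_x[of "(x - y) / 2"] by simp
  finally show ?thesis .
qed

lemma int_cis_lipschitz: "cmod (int_cis l t - int_cis l s) \<le> \<bar>t - s\<bar>"
proof (cases "l = 0")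
  case True thus ?thesis by (simp add: int_cis_eq flip: of_real_diff)
next
  case False
  hence "int_cis l t - int_cis l s = (cis (l * t) - cis (l * s)) / (\<i> * of_real l)"
    by (simp add: int_cis_eq diff_divide_distrib)
  thus ?thesis using norm_cis_diff_le[of "l * t" "l * s"] False
    by (simp add: norm_divide norm_mult divide_le_eq abs_mult mult.commute flip: right_diff_distrib)
qed

lemma norm_int_cis_le: "cmod (int_cis l t) \<le> \<bar>t\<bar>"
  using int_cis_lipschitz[of l t 0] by simp

section \<open>Fourier coefficients of functions on the torus\<close>

text \<open>
Lebesgue integrability over one period cell.
\<close>

abbreviation cell_integrable :: "(real ^ 'd \<Rightarrow> complex) \<Rightarrow> bool" where
  "cell_integrable \<equiv> set_integrable lebesgue torus_cell"

text \<open>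
The function with coefficients \<open>a\<close>; the series is used only for absolutely summable \<open>a\<close>.
\<close>

definition fseries :: "(int ^ 'd \<Rightarrow> complex) \<Rightarrow> real ^ 'd \<Rightarrow> complex" where
  "fseries a x = (\<Sum>\<^sub>\<infinity>k. a k * cis (freq_dot k x))"

lemma fourier_multiplier_eq: "fourier_multiplier m f = fseries (\<lambda>k. m k * fourier_coeff f k)"
  by (rule ext) (simp add: fourier_multiplier_def fseries_def)

lemma freq_dot_add: "freq_dot (j + k) x = freq_dot j x + freq_dot k x"
  and freq_dot_diff: "freq_dot (j - k) x = freq_dot j x - freq_dot k x"
  and freq_dot_uminus: "freq_dot (- k) x = - freq_dot k x"
  by (simp_all add: freq_dot_def sum.distrib sum_subtractf sum_negf algebra_simps)

lemma continuous_on_freq_dot [continuous_intros]: "continuous_on S (freq_dot k)"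
  unfolding freq_dot_def[abs_def] by (intro continuous_intros)

lemma continuous_on_cis_freq_dot: "continuous_on S (\<lambda>x. cis (freq_dot k x))"
  unfolding cis_conv_exp by (intro continuous_intros)

lemma torus_cell_sets [measurable, simp]: "torus_cell \<in> sets borel" "torus_cell \<in> sets lebesgue"
  by (simp_all add: torus_cell_def)

lemma torus_cell_emeasure: "emeasure lebesgue (torus_cell :: (real ^ 'd) set) < \<infinity>"
  using emeasure_bounded_finite[of "torus_cell :: (real ^ 'd) set"] by (simp add: torus_cell_def)

lemma cell_integrable_const: "cell_integrable (\<lambda>x. c)"
  unfolding set_integrable_def using torus_cell_emeasure by (intro integrable_indicator) auto

lemma cell_integrable_mult_bounded:
  assumes g: "cell_integrable g" and h: "continuous_on UNIV h" and B: "\<And>x. cmod (h x) \<le> B"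
  shows "cell_integrable (\<lambda>x. g x * h x)"
proof -
  have B0: "0 \<le> B" using order_trans[OF norm_ge_zero B] .
  have hm: "h \<in> borel_measurable lebesgue"
    by (intro measurable_completion) (use borel_measurable_continuous_onI[OF h] in simp)
  have "integrable lebesgue (\<lambda>x. (indicat_real torus_cell x *\<^sub>R g x) * h x)"
  proof (rule Bochner_Integration.integrable_bound)
    show "integrable lebesgue (\<lambda>x. B * cmod (indicat_real torus_cell x *\<^sub>R g x))"
      using g unfolding set_integrable_def by (intro integrable_mult_right integrable_norm)
    show "(\<lambda>x. (indicat_real torus_cell x *\<^sub>R g x) * h x) \<in> borel_measurable lebesgue"
      using g hm unfolding set_integrable_def by (intro borel_measurable_times) auto
    show "AE x in lebesgue. norm ((indicat_real torus_cell x *\<^sub>R g x) * h x)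
        \<le> norm (B * cmod (indicat_real torus_cell x *\<^sub>R g x))"
      using B B0 by (intro AE_I2) (auto simp: norm_mult mult.commute[of B] indicator_def intro!: mult_left_mono)
  qed
  thus ?thesis by (simp add: set_integrable_def)
qed

lemma cell_integrable_mult_cis: "cell_integrable g \<Longrightarrow> cell_integrable (\<lambda>x. g x * cis (freq_dot k x))"
  by (rule cell_integrable_mult_bounded[where B = 1]) (auto intro: continuous_on_cis_freq_dot)

lemma cell_integrable_mult_cis_minus: "cell_integrable g \<Longrightarrow> cell_integrable (\<lambda>x. g x * cis (- freq_dot k x))"
  using cell_integrable_mult_cis[of g "- k"] by (simp add: freq_dot_uminus)

lemma cell_integrable_add: "cell_integrable f \<Longrightarrow> cell_integrable g \<Longrightarrow> cell_integrable (\<lambda>x. f x + g x)"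
  and cell_integrable_diff: "cell_integrable f \<Longrightarrow> cell_integrable g \<Longrightarrow> cell_integrable (\<lambda>x. f x - g x)"
  by (rule set_integral_add set_integral_diff; assumption)+

lemma cell_integrable_cmult: "cell_integrable f \<Longrightarrow> cell_integrable (\<lambda>x. c * f x)"
  by (rule set_integrable_mult_right) auto

lemma cell_integrable_cnj: "cell_integrable f \<Longrightarrow> cell_integrable (\<lambda>x. cnj (f x))"
  unfolding set_integrable_def using integrable_cnj[of lebesgue "\<lambda>x. indicat_real torus_cell x *\<^sub>R f x"]
  by simp

lemma fourier_coeff_add:
  "cell_integrable f \<Longrightarrow> cell_integrable g \<Longrightarrow> fourier_coeff (\<lambda>x. f x + g x) k = fourier_coeff f k + fourier_coeff g k"
  unfolding fourier_coeff_def distrib_right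
  by (subst set_integral_add(2)) (auto simp: cell_integrable_mult_cis_minus add_divide_distrib)

lemma fourier_coeff_diff:
  "cell_integrable f \<Longrightarrow> cell_integrable g \<Longrightarrow> fourier_coeff (\<lambda>x. f x - g x) k = fourier_coeff f k - fourier_coeff g k"
  unfolding fourier_coeff_def left_diff_distrib
  by (subst set_integral_diff(2)) (auto simp: cell_integrable_mult_cis_minus diff_divide_distrib)

lemma fourier_coeff_cmult: "fourier_coeff (\<lambda>x. c * f x) k = c * fourier_coeff f k"
  unfolding fourier_coeff_def mult.assoc by simp

lemma fourier_coeff_cnj: "fourier_coeff (\<lambda>x. cnj (f x)) k = cnj (fourier_coeff f (- k))"
proof -
  have "(LINT x:torus_cell|lebesgue. cnj (f x) * cis (- freq_dot k x))
     = cnj (LINT x:torus_cell|lebesgue. f x * cis (- freq_dot (- k) x))"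
    unfolding set_lebesgue_integral_def
    by (subst Bochner_Integration.integral_cnj[symmetric]) (simp add: freq_dot_uminus cis_cnj)
  thus ?thesis by (simp add: fourier_coeff_def)
qed


lemma fourier_coeff_mult_cis:
  "fourier_coeff (\<lambda>x. g x * cis (freq_dot j x)) k = fourier_coeff g (k - j)"
  by (simp add: fourier_coeff_def mult.assoc cis_mult freq_dot_diff)

lemma fourier_coeff_mult_trig_poly:
  assumes g: "cell_integrable g" and J: "finite J"
  shows "fourier_coeff (\<lambda>x. g x * (\<Sum>j\<in>J. a j * cis (freq_dot j x))) k = (\<Sum>j\<in>J. a j * fourier_coeff g (k - j))" (is ?G1)
    and "cell_integrable (\<lambda>x. g x * (\<Sum>j\<in>J. a j * cis (freq_dot j x)))" (is ?G2)
proof -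
  have "fourier_coeff (\<lambda>x. g x * (\<Sum>j\<in>J. a j * cis (freq_dot j x))) k = (\<Sum>j\<in>J. a j * fourier_coeff g (k - j))
    \<and> cell_integrable (\<lambda>x. g x * (\<Sum>j\<in>J. a j * cis (freq_dot j x)))"
    using J
  proof (induction J rule: finite_induct)
    case empty
    show ?case by (simp add: fourier_coeff_def set_lebesgue_integral_def set_integrable_def)
  next
    case (insert j J)
    have eq: "(\<lambda>x. g x * (\<Sum>j\<in>insert j J. a j * cis (freq_dot j x)))
      = (\<lambda>x. a j * (g x * cis (freq_dot j x)) + g x * (\<Sum>j\<in>J. a j * cis (freq_dot j x)))"
      using insert.hyps by (auto simp: algebra_simps)
    have 1: "cell_integrable (\<lambda>x. a j * (g x * cis (freq_dot j x)))"
      by (intro cell_integrable_cmult cell_integrable_mult_cis g)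
    show ?case unfolding eq
      using insert 1 by (simp add: fourier_coeff_add fourier_coeff_cmult fourier_coeff_mult_cis cell_integrable_add)
  qed
  thus ?G1
    and ?G2 by auto
qed

lemma fourier_coeff_mult_le:
  assumes g: "cell_integrable g" and h: "continuous_on UNIV h" and B: "\<And>x. cmod (h x) \<le> B"
  shows "cmod (fourier_coeff (\<lambda>x. g x * h x) (k :: int ^ 'd))
    \<le> B * (LINT x:torus_cell|lebesgue. cmod (g x)) / (2 * pi) ^ CARD('d)"
proof -
  have "cmod (LINT x:torus_cell|lebesgue. g x * h x * cis (- freq_dot k x))
     \<le> (LINT x:torus_cell|lebesgue. B * cmod (g x))"
    unfolding set_lebesgue_integral_def
  proof (rule order_trans[OF integral_norm_bound integral_mono])
    show "integrable lebesgue (\<lambda>x. norm (indicat_real torus_cell x *\<^sub>R (g x * h x * cis (- freq_dot k x))))"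
      using cell_integrable_mult_cis_minus[OF cell_integrable_mult_bounded[OF assms]]
      unfolding set_integrable_def by (rule integrable_norm)
    have "integrable lebesgue (\<lambda>x. B * cmod (indicat_real torus_cell x *\<^sub>R g x))"
      using g unfolding set_integrable_def by (intro integrable_mult_right integrable_norm)
    thus "integrable lebesgue (\<lambda>x. indicat_real torus_cell x *\<^sub>R (B * cmod (g x)))"
      by (simp add: mult_ac)
    show "norm (indicat_real torus_cell x *\<^sub>R (g x * h x * cis (- freq_dot k x)))
      \<le> indicat_real torus_cell x *\<^sub>R (B * cmod (g x))" for x
      using B[of x] by (auto simp: norm_mult mult.commute[of B] indicator_def intro!: mult_left_mono)
  qed
  hence "cmod (LINT x:torus_cell|lebesgue. g x * h x * cis (- freq_dot k x))
     \<le> B * (LINT x:torus_cell|lebesgue. cmod (g x))" by simp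
  moreover have "cmod (of_real ((2 * pi) ^ CARD('d))) = (2 * pi) ^ CARD('d)"
    by (simp only: norm_of_real) simp
  ultimately show ?thesis by (simp only: fourier_coeff_def norm_divide) (simp add: divide_right_mono)
qed

lemma fseries_uniform_limit:
  fixes a :: "int ^ 'd \<Rightarrow> complex"
  assumes "ell1 a"
  shows "uniform_limit UNIV (\<lambda>J x. \<Sum>k\<in>J. a k * cis (freq_dot k x)) (fseries a) (finite_subsets_at_top UNIV)"
  unfolding fseries_def[abs_def]
  by (rule Weierstrass_m_test_general[OF _ assms]) (simp add: norm_mult)

lemma continuous_on_fseries:
  fixes a :: "int ^ 'd \<Rightarrow> complex"
  assumes "ell1 a"
  shows "continuous_on UNIV (fseries a)"
  by (rule uniform_limit_theorem[OF _ fseries_uniform_limit[OF assms]])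
     (auto intro!: always_eventually continuous_on_sum continuous_on_mult continuous_on_const continuous_on_cis_freq_dot)

lemma norm_fseries_le:
  fixes a :: "int ^ 'd \<Rightarrow> complex"
  assumes "ell1 a"
  shows "cmod (fseries a x) \<le> (\<Sum>\<^sub>\<infinity>k. cmod (a k))"
proof -
  have "(\<lambda>k. norm (a k * cis (freq_dot k x))) summable_on UNIV" using assms by (simp add: norm_mult)
  from norm_infsum_bound[OF this] show ?thesis by (simp add: fseries_def norm_mult)
qed

lemma cell_integrable_mult_fseries:
  assumes "cell_integrable g" "ell1 a"
  shows "cell_integrable (\<lambda>x. g x * fseries a x)"
  by (rule cell_integrable_mult_bounded[OF assms(1) continuous_on_fseries norm_fseries_le]; fact assms(2))

lemma cell_integrable_fseries:
  assumes "ell1 a"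
  shows "cell_integrable (fseries a)"
  using cell_integrable_mult_fseries[OF cell_integrable_const[of 1] assms] by simp

text \<open>
The factor \<open>g\<close> is merely integrable: its own Fourier series need not converge.
\<close>

theorem fourier_coeff_mult_fseries:
  fixes a :: "int ^ 'd \<Rightarrow> complex"
  assumes g: "cell_integrable g" and a: "ell1 a"
  shows "fourier_coeff (\<lambda>x. g x * fseries a x) = conv a (fourier_coeff g)"
proof
  fix k
  define N where "N = (LINT x:torus_cell|lebesgue. cmod (g x)) / (2 * pi) ^ CARD('d)"
  have N: "0 \<le> N" unfolding N_def set_lebesgue_integral_def
    by (intro divide_nonneg_nonneg integral_nonneg) (auto simp: indicator_def)
  let ?S = "\<lambda>J x. \<Sum>j\<in>J. a j * cis (freq_dot j x)"
  have "((\<lambda>J. \<Sum>j\<in>J. a j * fourier_coeff g (k - j)) \<longlongrightarrow> fourier_coeff (\<lambda>x. g x * fseries a x) k)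
    (finite_subsets_at_top UNIV)"
  proof (rule tendstoI)
    fix e :: real assume e: "e > 0"
    have e': "e / (N + 1) > 0" using e N by (intro divide_pos_pos) linarith+
    have ev: "\<forall>\<^sub>F J in finite_subsets_at_top UNIV. finite J \<and> (\<forall>x. dist (?S J x) (fseries a x) < e / (N + 1))"
    proof (rule eventually_conj)
      show "\<forall>\<^sub>F J in finite_subsets_at_top UNIV. finite (J :: (int ^ 'd) set)"
        by (rule eventually_finite_subsets_at_top_weakI)
    qed (use uniform_limitD[OF fseries_uniform_limit[OF a] e'] in simp)
    show "\<forall>\<^sub>F J in finite_subsets_at_top UNIV.
      dist (\<Sum>j\<in>J. a j * fourier_coeff g (k - j)) (fourier_coeff (\<lambda>x. g x * fseries a x) k) < e"
      using ev
    proof eventually_elim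
      fix J assume J: "finite J \<and> (\<forall>x. dist (?S J x) (fseries a x) < e / (N + 1))"
      have "(\<Sum>j\<in>J. a j * fourier_coeff g (k - j)) - fourier_coeff (\<lambda>x. g x * fseries a x) k
        = fourier_coeff (\<lambda>x. g x * (?S J x - fseries a x)) k"
        using J fourier_coeff_diff[OF fourier_coeff_mult_trig_poly(2)[OF g] cell_integrable_mult_fseries[OF g a], of J a k]
          fourier_coeff_mult_trig_poly(1)[OF g, of J a k]
        by (simp add: right_diff_distrib)
      also have "cmod \<dots> \<le> (e / (N + 1)) * (LINT x:torus_cell|lebesgue. cmod (g x)) / (2 * pi) ^ CARD('d)"
      proof (rule fourier_coeff_mult_le[OF g])
        show "continuous_on UNIV (\<lambda>x. ?S J x - fseries a x)"
          by (intro continuous_on_diff continuous_on_fseries a continuous_on_sum continuous_on_mult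
              continuous_on_const continuous_on_cis_freq_dot)
        show "cmod (?S J x - fseries a x) \<le> e / (N + 1)" for x
          using J by (auto simp: dist_norm intro: less_imp_le)
      qed
      also have "\<dots> = e / (N + 1) * N" by (simp add: N_def)
      also have "\<dots> < e" using e N by (simp add: field_simps)
      finally show "dist (\<Sum>j\<in>J. a j * fourier_coeff g (k - j)) (fourier_coeff (\<lambda>x. g x * fseries a x) k) < e"
        by (simp add: dist_norm)
    qed
  qed
  thus "fourier_coeff (\<lambda>x. g x * fseries a x) k = conv a (fourier_coeff g) k"
    unfolding conv_def by (intro infsumI[symmetric]) (simp add: has_sum_def)
qed

lemma integral_cis_period:
  assumes "n \<in> \<int>"
  shows "has_bochner_integral lborel (\<lambda>y. indicat_real {0..2 * pi} y *\<^sub>R cis (n * y)) (if n = 0 then 2 * pi else 0)"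
proof -
  have "has_bochner_integral lborel (\<lambda>y. indicat_real {0..2 * pi} y *\<^sub>R cis (n * y)) (int_cis n (2 * pi) - int_cis n 0)"
  proof (rule has_bochner_integral_FTC_Icc)
    show "continuous_on {0..2 * pi} (\<lambda>y. cis (n * y))"
      unfolding cis_conv_exp by (intro continuous_intros)
  qed (auto intro: int_cis_has_vector_derivative)
  moreover have "cis (2 * pi * n) = 1"
    using assms by (intro cis_multiple_2pi) auto
  ultimately show ?thesis by (auto simp: int_cis_eq mult_ac)
qed

text \<open>
Over the standard basis the integrand is a product of functions of one coordinate, and so is
Lebesgue measure.
\<close>

lemma integral_cis_freq:
  fixes m :: "int ^ 'd"
  shows "(LINT x:torus_cell|lebesgue. cis (freq_dot m x)) = (if m = 0 then of_real ((2 * pi) ^ CARD('d)) else 0)"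
proof -
  let ?g = "\<lambda>(b :: real ^ 'd) y. indicat_real {0..2 * pi} y *\<^sub>R cis (freq_dot m b * y)"
  have fb: "freq_dot m b \<in> \<int>" if "b \<in> Basis" for b
  proof -
    from that obtain i where "b = axis i 1" by (auto simp: Basis_vec_def)
    thus ?thesis by (simp add: freq_dot_def axis_def if_distrib[of "\<lambda>x. _ * x"] sum.delta cong: if_cong)
  qed
  have fsum: "freq_dot m x = (\<Sum>b\<in>Basis. freq_dot m b * (x \<bullet> b))" for x
  proof -
    have lin: "linear (freq_dot m)"
      by (rule linearI) (simp_all add: freq_dot_def algebra_simps sum.distrib sum_distrib_left)
    have "freq_dot m x = freq_dot m (\<Sum>b\<in>Basis. (x \<bullet> b) *\<^sub>R b)" by (simp add: euclidean_representation)
    also have "\<dots> = (\<Sum>b\<in>Basis. freq_dot m b * (x \<bullet> b))"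
      by (simp add: linear_sum[OF lin] linear_scale[OF lin] mult.commute)
    finally show ?thesis .
  qed
  have prod: "indicat_real torus_cell x *\<^sub>R cis (freq_dot m x) = (\<Prod>b\<in>Basis. ?g b (x \<bullet> b))" for x :: "real ^ 'd"
  proof -
    have "x \<in> torus_cell \<longleftrightarrow> (\<forall>b\<in>Basis. x \<bullet> b \<in> {0..2 * pi})"
      by (auto simp: torus_cell_def mem_box Basis_vec_def inner_axis)
    hence 1: "indicat_real torus_cell x = (\<Prod>b\<in>Basis. indicat_real {0..2 * pi} (x \<bullet> b))"
      by (auto simp: indicator_def)
    have 2: "cis (freq_dot m x) = (\<Prod>b\<in>Basis. cis (freq_dot m b * (x \<bullet> b)))"
      unfolding fsum[of x] by (simp add: cis_conv_exp sum_distrib_left exp_sum)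
    show ?thesis unfolding 1 2 scaleR_conv_of_real by (simp add: prod.distrib)
  qed
  have gint: "integrable lborel (?g b)" "integral\<^sup>L lborel (?g b) = (if freq_dot m b = 0 then 2 * pi else 0)"
    if "b \<in> Basis" for b
    using integral_cis_period[OF fb[OF that]] by (auto simp: has_bochner_integral_iff)
  have gm: "?g b \<in> borel_measurable borel" for b
    by (intro borel_measurable_scaleR borel_measurable_indicator borel_measurable_continuous_onI continuous_intros)
      (auto simp: cis_conv_exp intro!: continuous_intros)
  interpret product_sigma_finite "\<lambda>_::real ^ 'd. lborel :: real measure" ..
  have meas: "(\<lambda>x. \<Prod>b\<in>Basis. ?g b (x \<bullet> b)) \<in> borel_measurable (borel :: (real ^ 'd) measure)"
    by (intro borel_measurable_prod measurable_compose[OF _ gm]) simp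
  have "(LINT x:torus_cell|lebesgue. cis (freq_dot m x)) = (LINT x|lborel. (\<Prod>b\<in>Basis. ?g b (x \<bullet> b)))"
    unfolding set_lebesgue_integral_def prod by (rule integral_completion) (use meas in simp)
  also have "\<dots> = (LINT f|(\<Pi>\<^sub>M b\<in>Basis. lborel). (\<Prod>b\<in>Basis. ?g b ((\<Sum>c\<in>Basis. f c *\<^sub>R c) \<bullet> b)))"
    by (subst lborel_eq, subst integral_distr) (use meas in auto)
  also have "\<dots> = (LINT f|(\<Pi>\<^sub>M b\<in>Basis. lborel). (\<Prod>b\<in>Basis. ?g b (f b)))"
    by (intro Bochner_Integration.integral_cong prod.cong refl) (simp only: inner_sum_left_Basis)
  also have "\<dots> = (\<Prod>b\<in>Basis. integral\<^sup>L lborel (?g b))"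
    by (intro product_integral_prod finite_Basis gint)
  also have "\<dots> = (\<Prod>b\<in>Basis. of_real (if freq_dot m b = 0 then 2 * pi else 0))"
    by (intro prod.cong refl gint)
  also have "\<dots> = (if m = 0 then of_real ((2 * pi) ^ CARD('d)) else 0)"
  proof (cases "m = 0")
    case True thus ?thesis by (simp add: freq_dot_def)
  next
    case False
    then obtain i where i: "m $ i \<noteq> 0" by (auto simp: vec_eq_iff)
    have "freq_dot m (axis i 1) \<noteq> 0"
      using i by (simp add: freq_dot_def axis_def if_distrib[of "\<lambda>x. _ * x"] sum.delta cong: if_cong)
    moreover have "(axis i 1 :: real ^ 'd) \<in> Basis" by (auto simp: Basis_vec_def)
    ultimately have "(\<Prod>b\<in>Basis. complex_of_real (if freq_dot m b = 0 then 2 * pi else 0)) = 0"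
      by (intro prod_zero) auto
    thus ?thesis using False by simp
  qed
  finally show ?thesis .
qed

lemma fourier_coeff_1: "fourier_coeff (\<lambda>x. 1) k = (if k = 0 then 1 else 0)"
  using integral_cis_freq[of "- k"] by (simp add: fourier_coeff_def freq_dot_uminus)

theorem fourier_coeff_fseries:
  assumes "ell1 a"
  shows "fourier_coeff (fseries a) = a"
proof
  fix k
  have "fourier_coeff (fseries a) k = (\<Sum>\<^sub>\<infinity>j. a j * (if k - j = 0 then 1 else 0))"
    using fourier_coeff_mult_fseries[OF cell_integrable_const[of 1] assms]
    by (simp add: conv_def fourier_coeff_1)
  also have "\<dots> = (\<Sum>\<^sub>\<infinity>j\<in>{k}. a j)"
    by (intro infsum_cong_neutral) auto
  finally show "fourier_coeff (fseries a) k = a k" by simp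
qed

lemma sobolev_norm_eq: "sobolev_norm s f = hnorm s (fourier_coeff f)"
  by (simp add: sobolev_norm_def hnorm_def weight_def)

lemma sobolev_hs: "f \<in> sobolev s \<Longrightarrow> hs s (fourier_coeff f)"
  by (simp add: sobolev_def hs_def weight_def)

lemma sobolev_cell_integrable:
  assumes "f \<in> sobolev s"
  shows "cell_integrable f"
proof -
  have f: "f \<in> borel_measurable lebesgue" and f2: "set_integrable lebesgue torus_cell (\<lambda>x. (cmod (f x))\<^sup>2)"
    using assms by (auto simp: sobolev_def)
  have 1: "set_integrable lebesgue torus_cell (\<lambda>x. 1 :: real)"
    unfolding set_integrable_def using torus_cell_emeasure by (intro integrable_indicator) auto
  show ?thesis unfolding set_integrable_def
  proof (rule Bochner_Integration.integrable_bound)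
    show "integrable lebesgue (\<lambda>x. indicat_real torus_cell x *\<^sub>R (1 + (cmod (f x))\<^sup>2))"
      using set_integral_add(1)[OF 1 f2] by (simp add: set_integrable_def)
    show "(\<lambda>x. indicat_real torus_cell x *\<^sub>R f x) \<in> borel_measurable lebesgue"
      using f by (intro borel_measurable_scaleR borel_measurable_indicator) auto
    have "y \<le> 1 + y\<^sup>2" if "0 \<le> y" for y :: real
      using sum_squares_bound[of 1 y] that by simp
    thus "AE x in lebesgue. norm (indicat_real torus_cell x *\<^sub>R f x)
        \<le> norm (indicat_real torus_cell x *\<^sub>R (1 + (cmod (f x))\<^sup>2))"
      by (intro AE_I2) (auto simp: indicator_def)
  qed
qed

section \<open>Completeness of the characters\<close>

text \<open>
Trigonometric polynomials, as functions.
\<close>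

inductive trig_poly :: "(real ^ 'd \<Rightarrow> complex) \<Rightarrow> bool" where
  char: "trig_poly (\<lambda>x. c * cis (freq_dot k x))"
| add: "trig_poly f \<Longrightarrow> trig_poly g \<Longrightarrow> trig_poly (\<lambda>x. f x + g x)"

lemma trig_poly_mult_char:
  assumes "trig_poly g" shows "trig_poly (\<lambda>x. c * cis (freq_dot k x) * g x)"
  using assms
proof induction
  case (char d j)
  have "(\<lambda>x. c * cis (freq_dot k x) * (d * cis (freq_dot j x))) = (\<lambda>x. (c * d) * cis (freq_dot (k + j) x))"
    by (auto simp: freq_dot_add mult_ac simp flip: cis_mult)
  thus ?case by (simp add: trig_poly.char)
next
  case (add f g)
  from trig_poly.add[OF add.IH] show ?case by (simp add: distrib_left)
qed

lemma trig_poly_mult: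
  assumes "trig_poly f" "trig_poly g" shows "trig_poly (\<lambda>x. f x * g x)"
  using assms(1)
proof induction
  case (char c k) show ?case by (rule trig_poly_mult_char[OF assms(2)])
next
  case (add f1 f2)
  from trig_poly.add[OF add.IH] show ?case by (simp add: distrib_right)
qed

lemma trig_poly_const: "trig_poly (\<lambda>x. c)"
  using trig_poly.char[of c 0] by (simp add: freq_dot_def)

lemma trig_poly_cmult: "trig_poly f \<Longrightarrow> trig_poly (\<lambda>x. c * f x)"
  using trig_poly_mult[OF trig_poly_const] by blast

lemma trig_poly_sum: "finite I \<Longrightarrow> (\<And>i. i \<in> I \<Longrightarrow> trig_poly (f i)) \<Longrightarrow> trig_poly (\<lambda>x. \<Sum>i\<in>I. f i x)"
  by (induction I rule: finite_induct) (auto intro: trig_poly.add trig_poly_const)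

lemma trig_poly_cell_integrable:
  assumes g: "cell_integrable g" and f: "trig_poly f"
  shows "cell_integrable (\<lambda>x. g x * f x)"
  using f
proof induction
  case (char c k)
  from cell_integrable_cmult[OF cell_integrable_mult_cis[OF g, of k], of c]
  show ?case by (simp add: mult_ac)
next
  case (add f1 f2)
  from cell_integrable_add[OF add.IH] show ?case by (simp add: distrib_left)
qed

lemma integral_trig_poly_eq_0:
  assumes g: "cell_integrable g" and zero: "\<And>k. fourier_coeff g k = 0" and f: "trig_poly f"
  shows "(LINT x:torus_cell|lebesgue. g x * f x) = 0"
  using f
proof induction
  case (char c k)
  have "(LINT x:torus_cell|lebesgue. g x * cis (freq_dot k x)) = 0"
    using zero[of "- k"] by (simp add: fourier_coeff_def freq_dot_uminus)
  moreover have "(LINT x:torus_cell|lebesgue. g x * (c * cis (freq_dot k x)))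
     = c * (LINT x:torus_cell|lebesgue. g x * cis (freq_dot k x))"
    by (simp add: mult.left_commute[of _ c])
  ultimately show ?case by simp
next
  case (add f1 f2)
  thus ?case
    by (simp add: distrib_left set_integral_add trig_poly_cell_integrable[OF g])
qed

text \<open>
The embedding of the torus in $C^d$. Real polynomials on $C^d$ pull back to trigonometric polynomials.
\<close>

definition torus_embed :: "real ^ 'd \<Rightarrow> complex ^ 'd" where
  "torus_embed x = (\<chi> i. cis (x $ i))"

lemma continuous_on_torus_embed: "continuous_on S torus_embed"
  unfolding torus_embed_def[abs_def] cis_conv_exp by (intro continuous_intros)

lemma trig_poly_cos_sin:
  fixes i :: "'d::finite"
  shows "trig_poly (\<lambda>x::real ^ 'd. complex_of_real (cos (x $ i)))" (is ?G1) "trig_poly (\<lambda>x::real ^ 'd. complex_of_real (sin (x $ i)))" (is ?G2)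
proof -
  have fd: "freq_dot (axis i 1) x = x $ i" for x :: "real ^ 'd"
    by (simp add: freq_dot_def axis_def if_distrib[of of_int] if_distrib[of "\<lambda>y. y * _"] sum.delta cong: if_cong)
  have eqs: "complex_of_real (cos y) = (1/2) * cis y + (1/2) * cis (- y)"
    "complex_of_real (sin y) = (-\<i>/2) * cis y + (\<i>/2) * cis (- y)" for y :: real
    by (auto simp: complex_eq_iff)
  have t: "trig_poly (\<lambda>x. a * cis (freq_dot (axis i 1) x) + b * cis (freq_dot (- axis i 1) x))" for a b
    by (intro trig_poly.intros)
  show ?G1 ?G2
    using t[of "1/2" "1/2"] t[of "-\<i>/2" "\<i>/2"] unfolding eqs by (simp_all only: freq_dot_uminus fd)
qed

lemma trig_poly_polynomial:
  assumes "real_polynomial_function p"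
  shows "trig_poly (\<lambda>x. complex_of_real (p (torus_embed x)))"
  using assms
proof induction
  case (linear f)
  interpret bounded_linear f by fact
  have fz: "f z = (\<Sum>i\<in>UNIV. Re (z $ i) * f (axis i 1) + Im (z $ i) * f (axis i \<i>))" for z
  proof -
    have "z = (\<Sum>i\<in>UNIV. Re (z $ i) *\<^sub>R axis i 1 + Im (z $ i) *\<^sub>R axis i \<i>)"
    proof (subst vec_eq_iff, intro allI)
      fix j
      have "(\<Sum>i\<in>UNIV. Re (z $ i) *\<^sub>R axis i 1 + Im (z $ i) *\<^sub>R axis i \<i>) $ j
        = (\<Sum>i\<in>UNIV. if i = j then z $ i else 0)"
        unfolding sum_component
      proof (intro sum.cong refl)
        fix i
        show "(Re (z $ i) *\<^sub>R axis i 1 + Im (z $ i) *\<^sub>R axis i \<i>) $ j = (if i = j then z $ i else 0)"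
          by (auto simp: axis_def complex_eq_iff)
      qed
      also have "\<dots> = z $ j" by simp
      finally show "z $ j = (\<Sum>i\<in>UNIV. Re (z $ i) *\<^sub>R axis i 1 + Im (z $ i) *\<^sub>R axis i \<i>) $ j" by simp
    qed
    hence "f z = f (\<Sum>i\<in>UNIV. Re (z $ i) *\<^sub>R axis i 1 + Im (z $ i) *\<^sub>R axis i \<i>)" by (rule arg_cong)
    thus ?thesis by (simp only: sum add scaleR real_scaleR_def)
  qed
  have "complex_of_real (f (torus_embed x))
    = (\<Sum>i\<in>UNIV. of_real (f (axis i 1)) * of_real (cos (x $ i)) + of_real (f (axis i \<i>)) * of_real (sin (x $ i)))" for x
    by (subst fz) (simp add: torus_embed_def mult_ac)
  moreover have "trig_poly (\<lambda>x. \<Sum>i\<in>UNIV. complex_of_real (f (axis i 1)) * of_real (cos (x $ i)) + of_real (f (axis i \<i>)) * of_real (sin (x $ i)))"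
    by (intro trig_poly_sum trig_poly.add trig_poly_cmult trig_poly_cos_sin) auto
  ultimately show ?case by (simp only:)
next
  case (const c) show ?case by (rule trig_poly_const)
next
  case (add f g) from trig_poly.add[OF add.IH] show ?case by simp
next
  case (mult f g) from trig_poly_mult[OF mult.IH] show ?case by simp
qed

text \<open>
The indicator of \<open>A\<close> is a bounded pointwise limit of continuous functions, hence, by the
Stone--Weierstrass theorem, of polynomials.
\<close>

lemma integral_closed_preimage_eq_0:
  fixes g :: "real ^ 'd \<Rightarrow> complex"
  assumes g: "cell_integrable g" and zero: "\<And>k. fourier_coeff g k = 0"
    and A: "closed A" "A \<noteq> {}"
  shows "(LINT x:torus_cell|lebesgue. g x * of_real (indicat_real A (torus_embed x))) = 0"
proof -
  define \<phi> where "\<phi> n z = max 0 (1 - real n * infdist z A)" for n z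
  have "\<exists>p. real_polynomial_function p \<and> (\<forall>x\<in>torus_cell. \<bar>\<phi> n (torus_embed x :: complex ^ 'd) - p (torus_embed x)\<bar> < 1 / real (Suc n))" for n
  proof -
    have c: "compact (torus_embed ` (torus_cell :: (real ^ 'd) set))"
      unfolding torus_cell_def by (intro compact_continuous_image continuous_on_torus_embed compact_cbox)
    have "continuous_on (torus_embed ` (torus_cell :: (real ^ 'd) set)) (\<phi> n)"
      unfolding \<phi>_def by (intro continuous_intros)
    from Stone_Weierstrass_real_polynomial_function[OF c this, of "1 / real (Suc n)"]
    show ?thesis by (metis image_eqI of_nat_0_less_iff zero_less_Suc zero_less_divide_1_iff)
  qed
  then obtain p where p: "\<And>n. real_polynomial_function (p n)"
    and pb: "\<And>n x. x \<in> torus_cell \<Longrightarrow> \<bar>\<phi> n (torus_embed x) - p n (torus_embed (x :: real ^ 'd))\<bar> < 1 / real (Suc n)"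
    by metis
  have \<phi>01: "0 \<le> \<phi> n z" "\<phi> n z \<le> 1" for n z
    by (auto simp: \<phi>_def infdist_nonneg)
  have \<phi>lim: "(\<lambda>n. \<phi> n z) \<longlonglongrightarrow> indicat_real A z" for z
  proof (cases "z \<in> A")
    case True thus ?thesis by (simp add: \<phi>_def)
  next
    case False
    hence pos: "infdist z A > 0"
      using A infdist_pos_not_in_closed by blast
    obtain N where N: "real N * infdist z A > 1" using reals_Archimedean3[OF pos] by blast
    have "\<phi> n z = 0" if "n \<ge> N" for n
    proof -
      have "real N * infdist z A \<le> real n * infdist z A" using that pos by (intro mult_right_mono) auto
      thus ?thesis using N by (simp add: \<phi>_def)
    qed
    hence "\<forall>\<^sub>F n in sequentially. \<phi> n z = indicat_real A z"
      using False by (auto simp: eventually_at_top_linorder)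
    thus ?thesis by (rule tendsto_eventually)
  qed
  have plim: "(\<lambda>n. p n (torus_embed x)) \<longlonglongrightarrow> indicat_real A (torus_embed x)" if "x \<in> torus_cell" for x :: "real ^ 'd"
  proof -
    have "(\<lambda>n. \<phi> n (torus_embed x) - p n (torus_embed x)) \<longlonglongrightarrow> 0"
      by (rule Lim_null_comparison[OF _ LIMSEQ_inverse_real_of_nat])
         (use pb[OF that] in \<open>auto simp: inverse_eq_divide intro!: always_eventually less_imp_le\<close>)
    from tendsto_diff[OF \<phi>lim[of "torus_embed x"] this] show ?thesis by simp
  qed
  have int: "cell_integrable (\<lambda>x. g x * of_real (p n (torus_embed x)))" for n
    by (rule trig_poly_cell_integrable[OF g trig_poly_polynomial[OF p]])
  have Em: "torus_embed \<in> borel_measurable (lebesgue :: (real ^ 'd) measure)"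
    by (intro measurable_completion) (use borel_measurable_continuous_onI[OF continuous_on_torus_embed] in simp)
  have Am: "(\<lambda>x::real ^ 'd. complex_of_real (indicat_real A (torus_embed x))) \<in> borel_measurable lebesgue"
    by (intro borel_measurable_of_real measurable_compose[OF Em] borel_measurable_indicator) (use A in auto)
  have "(\<lambda>n. LINT x:torus_cell|lebesgue. g x * of_real (p n (torus_embed x)))
    \<longlonglongrightarrow> (LINT x:torus_cell|lebesgue. g x * of_real (indicat_real A (torus_embed x)))"
    unfolding set_lebesgue_integral_def
  proof (rule integral_dominated_convergence[where w = "\<lambda>x. 2 * cmod (indicat_real torus_cell x *\<^sub>R g x)"])
    show "(\<lambda>x. indicat_real torus_cell x *\<^sub>R (g x * of_real (p n (torus_embed x)))) \<in> borel_measurable lebesgue" for n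
      using int[of n] unfolding set_integrable_def by auto
    have "(\<lambda>x. (indicat_real torus_cell x *\<^sub>R g x) * of_real (indicat_real A (torus_embed x))) \<in> borel_measurable lebesgue"
      using g Am unfolding set_integrable_def by (intro borel_measurable_times) auto
    thus "(\<lambda>x. indicat_real torus_cell x *\<^sub>R (g x * of_real (indicat_real A (torus_embed x)))) \<in> borel_measurable lebesgue"
      by simp
    show "integrable lebesgue (\<lambda>x. 2 * cmod (indicat_real torus_cell x *\<^sub>R g x))"
      using g unfolding set_integrable_def by (intro integrable_mult_right integrable_norm)
    show "AE x in lebesgue. (\<lambda>n. indicat_real torus_cell x *\<^sub>R (g x * of_real (p n (torus_embed x))))
      \<longlonglongrightarrow> indicat_real torus_cell x *\<^sub>R (g x * of_real (indicat_real A (torus_embed x)))"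
    proof (intro AE_I2)
      fix x :: "real ^ 'd"
      show "(\<lambda>n. indicat_real torus_cell x *\<^sub>R (g x * of_real (p n (torus_embed x))))
        \<longlonglongrightarrow> indicat_real torus_cell x *\<^sub>R (g x * of_real (indicat_real A (torus_embed x)))"
      proof (cases "x \<in> torus_cell")
        case True
        show ?thesis by (intro tendsto_intros plim True)
      qed simp
    qed
    show "AE x in lebesgue. norm (indicat_real torus_cell x *\<^sub>R (g x * of_real (p n (torus_embed x))))
      \<le> 2 * cmod (indicat_real torus_cell x *\<^sub>R g x)" for n
    proof (intro AE_I2)
      fix x :: "real ^ 'd"
      show "norm (indicat_real torus_cell x *\<^sub>R (g x * of_real (p n (torus_embed x))))
        \<le> 2 * cmod (indicat_real torus_cell x *\<^sub>R g x)"
      proof (cases "x \<in> torus_cell")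
        case True
        have "1 / real (Suc n) \<le> 1" by simp
        hence "\<bar>p n (torus_embed x)\<bar> \<le> 2"
          using pb[OF True, of n] \<phi>01[of n "torus_embed x"] by linarith
        thus ?thesis using True mult_left_mono[of "\<bar>p n (torus_embed x)\<bar>" 2 "cmod (g x)"]
          by (simp add: norm_mult mult.commute)
      qed simp
    qed
  qed
  moreover have "(LINT x:torus_cell|lebesgue. g x * of_real (p n (torus_embed x))) = 0" for n
    by (rule integral_trig_poly_eq_0[OF g zero trig_poly_polynomial[OF p]])
  ultimately show ?thesis by (simp add: LIMSEQ_const_iff)
qed

text \<open>
The embedding identifies opposite faces of the closed cell, so one of the points is taken from the
interior.
\<close>

lemma torus_embed_inj:
  assumes x: "x \<in> torus_cell" and y: "y \<in> box 0 (\<chi> i. 2 * pi)" and eq: "torus_embed x = torus_embed y"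
  shows "x = y"
proof (subst vec_eq_iff, intro allI)
  fix i
  have "cis (x $ i) = cis (y $ i)" using eq by (simp add: torus_embed_def vec_eq_iff)
  hence "sin (x $ i) = sin (y $ i) \<and> cos (x $ i) = cos (y $ i)" by (simp add: complex_eq_iff)
  then obtain n :: int where n: "x $ i = y $ i + 2 * pi * n" by (auto simp: sin_cos_eq_iff)
  have xy: "0 \<le> x $ i" "x $ i \<le> 2 * pi" "0 < y $ i" "y $ i < 2 * pi"
    using x y by (auto simp: torus_cell_def mem_box_cart)
  have "\<bar>2 * pi * n\<bar> < 2 * pi * 1" using n xy by linarith
  hence "\<bar>real_of_int n\<bar> < 1" by (simp add: abs_mult)
  hence "n = 0" by linarith
  thus "x $ i = y $ i" using n by simp
qed

lemma integral_compact_eq_0: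
  fixes g :: "real ^ 'd \<Rightarrow> complex"
  assumes g: "cell_integrable g" and zero: "\<And>k. fourier_coeff g k = 0"
    and F: "compact F" "F \<subseteq> box 0 (\<chi> i. 2 * pi)"
  shows "(LINT x:F|lebesgue. g x) = 0"
proof (cases "F = {}")
  case True thus ?thesis by (simp add: set_lebesgue_integral_def)
next
  case False
  have "closed (torus_embed ` F)"
    by (intro compact_imp_closed compact_continuous_image continuous_on_torus_embed F)
  from integral_closed_preimage_eq_0[OF g zero this] False
  have "(LINT x:torus_cell|lebesgue. g x * of_real (indicat_real (torus_embed ` F) (torus_embed x))) = 0" by simp
  moreover have "indicat_real torus_cell x *\<^sub>R (g x * of_real (indicat_real (torus_embed ` F) (torus_embed x)))
    = indicat_real F x *\<^sub>R g x" for x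
  proof -
    have "F \<subseteq> torus_cell" using F(2) box_subset_cbox unfolding torus_cell_def by blast
    moreover have "x \<in> F" if "x \<in> torus_cell" "torus_embed x \<in> torus_embed ` F"
    proof -
      from that(2) obtain y where y: "y \<in> F" "torus_embed x = torus_embed y" by auto
      have "x = y" using torus_embed_inj[OF that(1) subsetD[OF F(2) y(1)] y(2)] .
      thus ?thesis using y(1) by simp
    qed
    ultimately show ?thesis by (auto simp: indicator_def)
  qed
  ultimately show ?thesis by (simp add: set_lebesgue_integral_def)
qed

text \<open>
The set where \<open>h\<close> is positive is, up to a null set, a countable union of compact sets.
\<close>

lemma AE_nonpos_of_compact_integrals:
  fixes h :: "real ^ 'd \<Rightarrow> real"
  assumes h: "set_integrable lebesgue torus_cell h"
    and zero: "\<And>F. compact F \<Longrightarrow> F \<subseteq> box 0 (\<chi> i. 2 * pi) \<Longrightarrow> (LINT x:F|lebesgue. h x) = 0"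
  shows "AE x in lebesgue. x \<in> torus_cell \<longrightarrow> h x \<le> 0"
proof -
  let ?B = "box 0 (\<chi> i. 2 * pi) :: (real ^ 'd) set"
  have Bsub: "?B \<subseteq> torus_cell" unfolding torus_cell_def by (rule box_subset_cbox)
  define S where "S = {x \<in> ?B. 0 < h x}"
  have "(\<lambda>x. indicat_real torus_cell x *\<^sub>R h x) \<in> borel_measurable lebesgue"
    using h unfolding set_integrable_def by auto
  hence "{x \<in> space lebesgue. 0 < indicat_real torus_cell x *\<^sub>R h x} \<in> sets lebesgue"
    by (intro borel_measurable_less) auto
  moreover have "S = ?B \<inter> {x \<in> space lebesgue. 0 < indicat_real torus_cell x *\<^sub>R h x}"
    using Bsub by (auto simp: S_def indicator_def split: if_splits)
  ultimately have S: "S \<in> sets lebesgue" by auto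
  obtain C N where CN: "fsigma C" "N \<in> null_sets lebesgue" "C \<union> N = S" "disjnt C N"
    using lebesgue_set_almost_fsigma[OF S] by metis
  obtain F :: "nat \<Rightarrow> (real ^ 'd) set" where F: "range F \<subseteq> Collect compact" and CF: "C = \<Union> (range F)"
    using fsigma_Union_compact CN(1) by metis
  have null: "F n \<in> null_sets lebesgue" for n
  proof -
    have Fn: "compact (F n)" "F n \<subseteq> ?B" and pos: "\<And>x. x \<in> F n \<Longrightarrow> 0 < h x"
      using F CF CN(3) by (auto simp: S_def)
    have Fm: "F n \<in> sets lebesgue" using Fn(1) by (simp add: lmeasurable_compact fmeasurableD)
    have int: "integrable lebesgue (\<lambda>x. indicat_real (F n) x *\<^sub>R h x)"
      using set_integrable_subset[OF h Fm] Fn(2) Bsub by (auto simp: set_integrable_def)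
    have nn: "AE x in lebesgue. 0 \<le> indicat_real (F n) x *\<^sub>R h x"
      using pos by (intro AE_I2) (auto simp: indicator_def intro: less_imp_le)
    have "AE x in lebesgue. indicat_real (F n) x *\<^sub>R h x = 0"
      using integral_nonneg_eq_0_iff_AE[OF int nn] zero[OF Fn] by (simp add: set_lebesgue_integral_def)
    hence "AE x in lebesgue. x \<notin> F n"
      by eventually_elim (use pos in \<open>force simp: indicator_def split: if_splits\<close>)
    thus ?thesis using AE_iff_null_sets[OF Fm] by simp
  qed
  have "C \<in> null_sets lebesgue" unfolding CF using null by auto
  hence "S \<in> null_sets lebesgue" using CN(2,3) by (auto simp: negligible_iff_null_sets)
  moreover have "torus_cell - ?B \<in> null_sets lebesgue"
    unfolding torus_cell_def negligible_iff_null_sets[symmetric] by (rule negligible_frontier_interval)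
  ultimately have "AE x in lebesgue. x \<notin> S \<and> x \<notin> torus_cell - ?B"
    by (intro AE_conjI AE_not_in)
  thus ?thesis by eventually_elim (auto simp: S_def not_less)
qed

text \<open>
Uniqueness: the Fourier coefficients determine an integrable function almost everywhere.
\<close>

theorem AE_eq_0_of_fourier_coeff:
  fixes g :: "real ^ 'd \<Rightarrow> complex"
  assumes g: "cell_integrable g" and zero: "\<And>k. fourier_coeff g k = 0"
  shows "AE x in lebesgue. x \<in> torus_cell \<longrightarrow> g x = 0"
proof -
  have main: "AE x in lebesgue. x \<in> torus_cell \<longrightarrow> L (g x) \<le> 0" if L: "bounded_linear L" for L :: "complex \<Rightarrow> real"
  proof (rule AE_nonpos_of_compact_integrals)
    have "integrable lebesgue (\<lambda>x. L (indicat_real torus_cell x *\<^sub>R g x))"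
      using g unfolding set_integrable_def by (rule integrable_bounded_linear[OF L])
    thus "set_integrable lebesgue torus_cell (\<lambda>x. L (g x))"
      by (simp add: set_integrable_def linear_scale[OF bounded_linear.linear[OF L]])
    fix F :: "(real ^ 'd) set" assume F: "compact F" "F \<subseteq> box 0 (\<chi> i. 2 * pi)"
    have Fs: "F \<subseteq> torus_cell" using F(2) box_subset_cbox unfolding torus_cell_def by blast
    have "integrable lebesgue (\<lambda>x. indicat_real F x *\<^sub>R g x)"
      using set_integrable_subset[OF g _ Fs] F(1) by (simp add: set_integrable_def lmeasurable_compact fmeasurableD)
    from integral_bounded_linear[OF L this] integral_compact_eq_0[OF g zero F]
    show "(LINT x:F|lebesgue. L (g x)) = 0"
      by (simp add: set_lebesgue_integral_def linear_scale[OF bounded_linear.linear[OF L]]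
          linear_0[OF bounded_linear.linear[OF L]])
  qed
  have "AE x in lebesgue. x \<in> torus_cell \<longrightarrow> - Re (g x) \<le> 0"
    "AE x in lebesgue. x \<in> torus_cell \<longrightarrow> - Im (g x) \<le> 0"
    by (intro main bounded_linear_minus bounded_linear_Re bounded_linear_Im)+
  with main[OF bounded_linear_Re] main[OF bounded_linear_Im]
  show ?thesis by eventually_elim (auto simp: complex_eq_iff)
qed

theorem AE_eq_fseries:
  fixes f :: "real ^ 'd \<Rightarrow> complex"
  assumes f: "cell_integrable f" and a: "ell1 (fourier_coeff f)"
  shows "AE x in lebesgue. x \<in> torus_cell \<longrightarrow> f x = fseries (fourier_coeff f) x"
proof -
  note s = cell_integrable_fseries[OF a]
  have "AE x in lebesgue. x \<in> torus_cell \<longrightarrow> f x - fseries (fourier_coeff f) x = 0"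
    using f s by (intro AE_eq_0_of_fourier_coeff cell_integrable_diff)
      (simp_all add: fourier_coeff_diff fourier_coeff_fseries[OF a])
  thus ?thesis by eventually_elim auto
qed

text \<open>
Coefficients of a product in which \<open>f\<close> has absolutely summable coefficients, without assuming that
\<open>f\<close> is equal to its Fourier series everywhere.
\<close>

theorem fourier_coeff_mult:
  fixes f g :: "real ^ 'd \<Rightarrow> complex"
  assumes f: "cell_integrable f" and a: "ell1 (fourier_coeff f)"
    and g: "cell_integrable g"
  shows "fourier_coeff (\<lambda>x. f x * g x) = conv (fourier_coeff f) (fourier_coeff g)"
    and "cell_integrable (\<lambda>x. f x * g x)"
proof -
  have fm: "(\<lambda>x. indicat_real torus_cell x *\<^sub>R f x) \<in> borel_measurable lebesgue"
    "(\<lambda>x. indicat_real torus_cell x *\<^sub>R g x) \<in> borel_measurable lebesgue"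
    using f g unfolding set_integrable_def by auto
  have "(\<lambda>x. (indicat_real torus_cell x *\<^sub>R f x) * (indicat_real torus_cell x *\<^sub>R g x)) \<in> borel_measurable lebesgue"
    using fm by (rule borel_measurable_times)
  moreover have "(indicat_real torus_cell x *\<^sub>R f x) * (indicat_real torus_cell x *\<^sub>R g x)
      = indicat_real torus_cell x *\<^sub>R (f x * g x)" for x
    by (simp add: indicator_def)
  ultimately have m1: "(\<lambda>x. indicat_real torus_cell x *\<^sub>R (f x * g x)) \<in> borel_measurable lebesgue" by (simp only:)
  have int: "cell_integrable (\<lambda>x. g x * fseries (fourier_coeff f) x)"
    by (rule cell_integrable_mult_fseries[OF g a])
  have ae: "AE x in lebesgue. indicat_real torus_cell x *\<^sub>R (g x * fseries (fourier_coeff f) x)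
      = indicat_real torus_cell x *\<^sub>R (f x * g x)"
    using AE_eq_fseries[OF f a] by eventually_elim (auto simp: indicator_def)
  show fg: "cell_integrable (\<lambda>x. f x * g x)"
    using integrable_cong_AE[OF _ m1 ae] int unfolding set_integrable_def by auto
  show "fourier_coeff (\<lambda>x. f x * g x) = conv (fourier_coeff f) (fourier_coeff g)"
  proof
    fix k
    have "(LINT x:torus_cell|lebesgue. f x * g x * cis (- freq_dot k x))
      = (LINT x:torus_cell|lebesgue. g x * fseries (fourier_coeff f) x * cis (- freq_dot k x))"
      unfolding set_lebesgue_integral_def
    proof (rule integral_cong_AE)
      show "(\<lambda>x. indicat_real torus_cell x *\<^sub>R (f x * g x * cis (- freq_dot k x))) \<in> borel_measurable lebesgue"
        "(\<lambda>x. indicat_real torus_cell x *\<^sub>R (g x * fseries (fourier_coeff f) x * cis (- freq_dot k x))) \<in> borel_measurable lebesgue"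
        using cell_integrable_mult_cis_minus[OF fg, of k] cell_integrable_mult_cis_minus[OF int, of k]
        unfolding set_integrable_def by auto
      show "AE x in lebesgue. indicat_real torus_cell x *\<^sub>R (f x * g x * cis (- freq_dot k x))
        = indicat_real torus_cell x *\<^sub>R (g x * fseries (fourier_coeff f) x * cis (- freq_dot k x))"
        using AE_eq_fseries[OF f a] by eventually_elim (auto simp: indicator_def)
    qed
    hence "fourier_coeff (\<lambda>x. f x * g x) k = fourier_coeff (\<lambda>x. g x * fseries (fourier_coeff f) x) k"
      by (simp add: fourier_coeff_def)
    thus "fourier_coeff (\<lambda>x. f x * g x) k = conv (fourier_coeff f) (fourier_coeff g) k"
      by (simp add: fourier_coeff_mult_fseries[OF g a])
  qed
qed

section \<open>The Klein--Gordon--Schroedinger system on the Fourier side\<close>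

text \<open>
The symbol $c \sqrt{|k|^2 + c^2}$ of the Klein--Gordon flow.
\<close>

definition kg_freq :: "real \<Rightarrow> int ^ 'd \<Rightarrow> real" where
  "kg_freq c k = c * sqrt (freq_sq k + c\<^sup>2)"

text \<open>
The symbol $c / \sqrt{|k|^2 + c^2}$.
\<close>

definition kg_damp :: "real \<Rightarrow> int ^ 'd \<Rightarrow> real" where
  "kg_damp c k = c / sqrt (freq_sq k + c\<^sup>2)"

text \<open>
The coefficients of the complex conjugate function.
\<close>

definition conj_coeff :: "(int ^ 'd \<Rightarrow> complex) \<Rightarrow> int ^ 'd \<Rightarrow> complex" where
  "conj_coeff a k = cnj (a (- k))"

lemma hs_conj_coeff [simp]:
  "hs s (conj_coeff a) = hs s a" "hnorm s (conj_coeff a) = hnorm s a"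
  using hs_reflect[of s a] by (simp_all add: conj_coeff_def[abs_def])

lemma hnorm_conj_coeff_diff [simp]:
  "hs s (\<lambda>k. conj_coeff a k - conj_coeff b k) = hs s (\<lambda>k. a k - b k)"
  "hnorm s (\<lambda>k. conj_coeff a k - conj_coeff b k) = hnorm s (\<lambda>k. a k - b k)"
  using hs_reflect[of s "\<lambda>k. a k - b k"] by (simp_all add: conj_coeff_def)

lemma kg_damp_bounds:
  assumes "0 < c" shows "0 \<le> kg_damp c k" "kg_damp c k \<le> 1"
proof -
  have "0 \<le> freq_sq k" by simp
  hence "sqrt (c\<^sup>2) \<le> sqrt (freq_sq k + c\<^sup>2)" by (intro real_sqrt_le_mono) linarith
  hence "c \<le> sqrt (freq_sq k + c\<^sup>2)" using assms by simp
  moreover from this have "0 < sqrt (freq_sq k + c\<^sup>2)" using assms by (rule less_le_trans[rotated])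
  ultimately show "0 \<le> kg_damp c k" "kg_damp c k \<le> 1"
    using assms unfolding kg_damp_def by (simp_all only: divide_le_eq_1_pos divide_nonneg_pos less_imp_le)
qed

lemma kg_freq_uminus [simp]: "kg_freq c (- k) = kg_freq c k"
  by (simp add: kg_freq_def)

text \<open>
With $x = |k|^2$ and $S = \sqrt{x + c^2}$ the left-hand side is $(x / 2) q$ with
$q = x / (S + c)^2$. Both $q \<le> 1$ and $q \<le> x / c^2$ hold, and the second bound is used with the
exponent \<open>\<alpha>\<close>.
\<close>

lemma kg_freq_approx:
  assumes c: "0 < c" and a: "0 \<le> \<alpha>" "\<alpha> \<le> 1"
  shows "\<bar>freq_sq k / 2 - (kg_freq c k - c\<^sup>2)\<bar> \<le> min 1 (c powr (- 2 * \<alpha>)) * weight k powr (1 + \<alpha>)"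
proof -
  define x where "x = freq_sq k"
  define S where "S = sqrt (x + c\<^sup>2)"
  have x: "0 \<le> x" by (simp add: x_def)
  have S2: "S\<^sup>2 = x + c\<^sup>2" using x by (simp add: S_def)
  have S: "0 < S" using c x by (simp add: S_def add_nonneg_pos)
  define q where "q = x / (S + c)\<^sup>2"
  have Sc: "0 < S + c" using S c by simp
  have "(x / 2 - (c * S - c\<^sup>2)) * (2 * (S + c)\<^sup>2) = x\<^sup>2"
  proof -
    have xx: "x = S\<^sup>2 - c\<^sup>2" using S2 by simp
    show ?thesis unfolding xx by (simp add: field_simps power2_eq_square)
  qed
  hence "x / 2 - (c * S - c\<^sup>2) = x\<^sup>2 / (2 * (S + c)\<^sup>2)"
    using Sc by (simp add: field_simps)
  also have "\<dots> = x / 2 * q" by (simp add: q_def power2_eq_square)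
  finally have eq: "x / 2 - (c * S - c\<^sup>2) = x / 2 * q" .
  have q0: "0 \<le> q" using x by (simp add: q_def)
  have "x \<le> (S + c)\<^sup>2"
    using S2 S c by (simp add: power2_sum)
  hence q1: "q \<le> 1" using Sc by (simp add: q_def divide_le_eq_1)
  have "c\<^sup>2 \<le> (S + c)\<^sup>2" using S c by (intro power_mono) auto
  hence qc: "q \<le> x / c\<^sup>2" unfolding q_def using x c Sc by (intro divide_left_mono mult_pos_pos zero_less_power) auto
  have w: "0 \<le> x" "x \<le> weight k" "1 \<le> weight k" by (auto simp: x_def weight_def)
  have "q \<le> min 1 (c powr (- 2 * \<alpha>)) * weight k powr \<alpha>"
  proof -
    have "q \<le> 1 * weight k powr \<alpha>"
      using q1 weight_powr_ge_1[OF a(1), of k] by linarith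
    moreover have "q \<le> c powr (- 2 * \<alpha>) * weight k powr \<alpha>"
    proof (cases "q = 0")
      case False
      hence "q = q powr 1" using q0 by simp
      also have "\<dots> \<le> q powr \<alpha>" using q0 q1 a False by (intro powr_mono') auto
      also have "\<dots> \<le> (x / c\<^sup>2) powr \<alpha>" using q0 qc a by (intro powr_mono2) auto
      also have "\<dots> = x powr \<alpha> * c powr (- 2 * \<alpha>)"
      proof -
        have "(c\<^sup>2) powr \<alpha> = (c powr 2) powr \<alpha>" using c by (simp add: powr_numeral)
        also have "\<dots> = c powr (2 * \<alpha>)" by (simp add: powr_powr)
        finally have "(c\<^sup>2) powr \<alpha> = c powr (2 * \<alpha>)" .
        moreover have "(x / c\<^sup>2) powr \<alpha> = x powr \<alpha> / (c\<^sup>2) powr \<alpha>"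
          using x c by (simp add: powr_divide)
        ultimately show ?thesis by (simp add: powr_minus divide_inverse)
      qed
      also have "\<dots> \<le> weight k powr \<alpha> * c powr (- 2 * \<alpha>)"
        using w a by (intro mult_right_mono powr_mono2) auto
      finally show ?thesis by (simp add: mult.commute)
    qed simp
    ultimately show ?thesis by (cases "1 \<le> c powr (- 2 * \<alpha>)") (auto simp: min_def)
  qed
  hence "x / 2 * q \<le> weight k * (min 1 (c powr (- 2 * \<alpha>)) * weight k powr \<alpha>)"
    using w q0 by (intro mult_mono) auto
  also have "\<dots> = min 1 (c powr (- 2 * \<alpha>)) * weight k powr (1 + \<alpha>)"
    by (simp add: powr_add)
  finally have "x / 2 * q \<le> min 1 (c powr (- 2 * \<alpha>)) * weight k powr (1 + \<alpha>)" .
  moreover have "freq_sq k / 2 - (kg_freq c k - c\<^sup>2) = x / 2 * q"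
    using eq by (simp add: kg_freq_def x_def S_def)
  moreover have "0 \<le> x / 2 * q" using x q0 by simp
  ultimately show ?thesis by simp
qed

text \<open>
Removing the free flow from a solution of the forced equation, started at time \<open>t\<close>.
\<close>

lemma twisted_derivative:
  fixes f g :: "real \<Rightarrow> complex"
  assumes d: "\<And>s. s \<in> {0..T} \<Longrightarrow> (f has_vector_derivative (- \<i> * of_real \<omega> * f s + g s)) (at s within {0..T})"
    and t: "0 \<le> t" "t + \<tau> \<le> T" and s: "s \<in> {0..\<tau>}"
  shows "((\<lambda>s. cis (\<omega> * s) * f (t + s)) has_vector_derivative cis (\<omega> * s) * g (t + s)) (at s within {0..\<tau>})"
proof -
  have ts: "t + s \<in> {0..T}" using t s by auto
  have sub: "(\<lambda>s. t + s) ` {0..\<tau>} \<subseteq> {0..T}" using t by auto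
  have "((f \<circ> (\<lambda>s. t + s)) has_vector_derivative 1 *\<^sub>R (- \<i> * of_real \<omega> * f (t + s) + g (t + s))) (at s within {0..\<tau>})"
  proof (rule vector_diff_chain_within)
    show "((\<lambda>s. t + s) has_vector_derivative 1) (at s within {0..\<tau>})"
      by (auto intro!: derivative_eq_intros simp: has_vector_derivative_def)
    show "(f has_vector_derivative (- \<i> * of_real \<omega> * f (t + s) + g (t + s))) (at (t + s) within (\<lambda>s. t + s) ` {0..\<tau>})"
      by (rule has_vector_derivative_within_subset[OF d[OF ts] sub])
  qed
  hence f: "((\<lambda>s. f (t + s)) has_vector_derivative (- \<i> * of_real \<omega> * f (t + s) + g (t + s))) (at s within {0..\<tau>})"
    by (simp add: o_def)
  have cis: "cis (\<omega> * s) = exp (s *\<^sub>R (\<i> * of_real \<omega>))" for s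
    by (simp add: cis_conv_exp scaleR_conv_of_real mult_ac)
  have "((\<lambda>s. cis (\<omega> * s)) has_vector_derivative cis (\<omega> * s) * (\<i> * of_real \<omega>)) (at s within {0..\<tau>})"
    unfolding cis by (rule exp_scaleR_has_vector_derivative_right)
  from has_vector_derivative_mult[OF this f] show ?thesis
    by (simp add: algebra_simps)
qed

lemma duhamel_error:
  fixes U G D D' :: "real \<Rightarrow> int ^ 'd \<Rightarrow> complex"
  assumes eq: "\<And>s k. s \<in> {0..T} \<Longrightarrow>
      ((\<lambda>s. U s k) has_vector_derivative (- \<i> * of_real (\<omega> k) * U s k + G s k)) (at s within {0..T})"
    and D: "\<And>s k. s \<in> {0..\<tau>} \<Longrightarrow> ((\<lambda>s. D s k) has_vector_derivative D' s k) (at s within {0..\<tau>})"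
    and D0: "\<And>k. D 0 k = 0"
    and t: "0 \<le> t" "t + \<tau> \<le> T" "0 \<le> \<tau>" and B: "0 \<le> B"
    and bound: "\<And>s. s \<in> {0..\<tau>} \<Longrightarrow> hs r (\<lambda>k. cis (\<omega> k * s) * G (t + s) k - D' s k)
      \<and> hnorm r (\<lambda>k. cis (\<omega> k * s) * G (t + s) k - D' s k) \<le> B"
  shows "hs r (\<lambda>k. U (t + \<tau>) k - cis (- \<omega> k * \<tau>) * (U t k + D \<tau> k))" (is ?G1)
    and "hnorm r (\<lambda>k. U (t + \<tau>) k - cis (- \<omega> k * \<tau>) * (U t k + D \<tau> k)) \<le> \<tau> * B" (is ?G2)
proof -
  define F where "F s k = cis (\<omega> k * s) * U (t + s) k - D s k" for s k
  have der: "((\<lambda>s. F s k) has_vector_derivative (cis (\<omega> k * s) * G (t + s) k - D' s k)) (at s within {0..\<tau>})"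
    if "s \<in> {0..\<tau>}" for s k
    unfolding F_def by (intro has_vector_derivative_diff twisted_derivative[OF eq] D t that)
  note mv = hnorm_mean_value[OF t(3) B der bound]
  have F: "F \<tau> k - F 0 k = cis (\<omega> k * \<tau>) * U (t + \<tau>) k - (U t k + D \<tau> k)" for k
    by (simp add: F_def D0)
  have "cis (\<omega> k * \<tau>) * U (t + \<tau>) k - (U t k + D \<tau> k)
      = cis (\<omega> k * \<tau>) * (U (t + \<tau>) k - cis (- \<omega> k * \<tau>) * (U t k + D \<tau> k))" for k
    by (simp add: right_diff_distrib cis_mult flip: mult.assoc)
  hence cm: "cmod (F \<tau> k - F 0 k) = cmod (U (t + \<tau>) k - cis (- \<omega> k * \<tau>) * (U t k + D \<tau> k))" for k
    unfolding F by (simp add: norm_mult)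
  show ?G1
    using mv(1) by (subst hs_cmod_eq(1)[OF cm, symmetric])
  show ?G2
    using mv(2) by (subst hs_cmod_eq(2)[OF cm, symmetric])
qed

text \<open>
The case \<open>D = 0\<close>: over a short time the solution stays close to the free flow.
\<close>

lemma free_flow_error:
  fixes U G :: "real \<Rightarrow> int ^ 'd \<Rightarrow> complex"
  assumes eq: "\<And>s k. s \<in> {0..T} \<Longrightarrow>
      ((\<lambda>s. U s k) has_vector_derivative (- \<i> * of_real (\<omega> k) * U s k + G s k)) (at s within {0..T})"
    and t: "0 \<le> t" "t + \<tau> \<le> T" "0 \<le> \<tau>" and B: "0 \<le> B"
    and bound: "\<And>s. s \<in> {t..t + \<tau>} \<Longrightarrow> hs r (G s) \<and> hnorm r (G s) \<le> B"
  shows "hs r (\<lambda>k. U (t + \<tau>) k - cis (- \<omega> k * \<tau>) * U t k)" (is ?G1)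
    and "hnorm r (\<lambda>k. U (t + \<tau>) k - cis (- \<omega> k * \<tau>) * U t k) \<le> \<tau> * B" (is ?G2)
proof -
  have b: "hs r (\<lambda>k. cis (\<omega> k * s) * G (t + s) k - 0) \<and> hnorm r (\<lambda>k. cis (\<omega> k * s) * G (t + s) k - 0) \<le> B"
    if "s \<in> {0..\<tau>}" for s
    using bound[of "t + s"] that hs_cmod_eq[of "\<lambda>k. cis (\<omega> k * s) * G (t + s) k" "G (t + s)" r]
    by (simp add: norm_mult)
  have d0: "((\<lambda>s. 0) has_vector_derivative (0::complex)) (at s within {0..\<tau>})" for s by simp
  from duhamel_error[OF eq d0 refl t B b]
  show ?G1
    and ?G2 by auto
qed

context sobolev_algebra
begin

lemma has_vector_derivative_conv_int_cis:
  fixes a b :: "int ^ 'd \<Rightarrow> complex"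
  assumes "hs r a" "hs r b"
  shows "((\<lambda>s. conv (\<lambda>j. int_cis (l j) s * a j) b k) has_vector_derivative
      conv (\<lambda>j. cis (l j * s) * a j) b k) (at s within S)"
proof -
  have "((\<lambda>s. \<Sum>\<^sub>\<infinity>j. a j * b (k - j) * int_cis (l j) s) has_vector_derivative
      (\<Sum>\<^sub>\<infinity>j. a j * b (k - j) * cis (l j * s))) (at s within S)"
    by (rule has_vector_derivative_infsum[OF conv_summable(2)[OF assms]])
       (auto intro: int_cis_has_vector_derivative int_cis_lipschitz norm_int_cis_le)
  thus ?thesis by (simp add: conv_def mult_ac)
qed

text \<open>
Two bilinear expressions that differ in their phases only. The first summand of the bound for the
phase difference costs one derivative on each factor, the second \<open>2 * p\<close> derivatives on the
product; the family built with the second weight is estimated separately in the assumptions \<open>Y\<close>,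
because it is absent (\<open>m = 0\<close>) when the factors are not regular enough.
\<close>

lemma conv_phase_error:
  fixes a b :: "int ^ 'd \<Rightarrow> complex"
  assumes a: "hs (r + 1) a" and b: "hs (r + 1) b" and s: "0 \<le> s" and m: "0 \<le> m"
    and phase: "\<And>k j. \<bar>\<omega> k + \<mu> j + \<nu> (k - j) - l j\<bar>
      \<le> weight j powr (1/2) * weight (k - j) powr (1/2) + m * weight k powr p"
    and Y: "hs r (\<lambda>k. of_real (weight k powr p * (\<Sum>\<^sub>\<infinity>j. cmod (a j) * cmod (b (k - j)))))"
      "hnorm r (\<lambda>k. of_real (weight k powr p * (\<Sum>\<^sub>\<infinity>j. cmod (a j) * cmod (b (k - j))))) \<le> Ny"
  shows "hs r (\<lambda>k. cis (\<omega> k * s) * conv (\<lambda>j. cis (\<mu> j * s) * a j) (\<lambda>j. cis (\<nu> j * s) * b j) k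
          - conv (\<lambda>j. cis (l j * s) * a j) b k)" (is "hs r ?c")
    and "hnorm r (\<lambda>k. cis (\<omega> k * s) * conv (\<lambda>j. cis (\<mu> j * s) * a j) (\<lambda>j. cis (\<nu> j * s) * b j) k
          - conv (\<lambda>j. cis (l j * s) * a j) b k)
      \<le> s * (algc * hnorm (r + 1) a * hnorm (r + 1) b + m * Ny)"
proof -
  have ar: "hs r a" "hs r b" using a b hs_order_mono(1)[of "r + 1" _ r] by auto
  have cisa: "hs r (\<lambda>j. cis (q j) * f j)" if "hs r f" for q f
    using that hs_cmod_eq(1)[of "\<lambda>j. cis (q j) * f j" f r] by (simp add: norm_mult)
  define X where "X k = (\<Sum>\<^sub>\<infinity>j. weight j powr (1/2) * cmod (a j) * (weight (k - j) powr (1/2) * cmod (b (k - j))))" for k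
  define Y where "Y k = weight k powr p * (\<Sum>\<^sub>\<infinity>j. cmod (a j) * cmod (b (k - j)))" for k
  have X0: "0 \<le> X k" "0 \<le> Y k" for k
    unfolding X_def Y_def by (auto intro!: infsum_nonneg mult_nonneg_nonneg)
  note Xs = hs_bilinear_gradient_summable[OF a b]
  note Ys = conv_summable(1)[OF ar]
  have main: "cmod (?c k) \<le> s * X k + s * m * Y k" for k
  proof -
    define z where "z j = (cis (\<omega> k * s) * (cis (\<mu> j * s) * cis (\<nu> (k - j) * s)) - cis (l j * s)) * (a j * b (k - j))" for j
    have s1: "(\<lambda>j. cis (\<omega> k * s) * (cis (\<mu> j * s) * a j * (cis (\<nu> (k - j) * s) * b (k - j)))) summable_on UNIV"
      by (intro summable_on_cmult_right conv_summable(3) cisa ar)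
    have s2: "(\<lambda>j. cis (l j * s) * a j * b (k - j)) summable_on UNIV"
      by (intro conv_summable(3) cisa ar)
    have "?c k = (\<Sum>\<^sub>\<infinity>j. cis (\<omega> k * s) * (cis (\<mu> j * s) * a j * (cis (\<nu> (k - j) * s) * b (k - j))))
        + (\<Sum>\<^sub>\<infinity>j. - (cis (l j * s) * a j * b (k - j)))"
      by (simp add: conv_def infsum_uminus infsum_cmult_right')
    also have "\<dots> = (\<Sum>\<^sub>\<infinity>j. z j)"
      by (subst infsum_add[symmetric]) (use s1 s2 in \<open>auto simp: summable_on_uminus z_def[abs_def] algebra_simps\<close>)
    finally have ck: "?c k = (\<Sum>\<^sub>\<infinity>j. z j)" .
    have zle: "cmod (z j) \<le> s * (weight j powr (1/2) * cmod (a j) * (weight (k - j) powr (1/2) * cmod (b (k - j))))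
        + s * m * (weight k powr p * (cmod (a j) * cmod (b (k - j))))" for j
    proof -
      have "cis (\<omega> k * s) * (cis (\<mu> j * s) * cis (\<nu> (k - j) * s)) - cis (l j * s)
        = cis (s * (\<omega> k + \<mu> j + \<nu> (k - j))) - cis (s * l j)"
        by (simp add: cis_mult algebra_simps)
      moreover have "cmod \<dots> \<le> \<bar>s * (\<omega> k + \<mu> j + \<nu> (k - j)) - s * l j\<bar>" by (rule norm_cis_diff_le)
      moreover have "\<dots> = s * \<bar>\<omega> k + \<mu> j + \<nu> (k - j) - l j\<bar>"
        using s by (simp add: abs_mult flip: right_diff_distrib)
      moreover have "\<dots> \<le> s * (weight j powr (1/2) * weight (k - j) powr (1/2) + m * weight k powr p)"
        by (intro mult_left_mono phase s)
      ultimately have "cmod (cis (\<omega> k * s) * (cis (\<mu> j * s) * cis (\<nu> (k - j) * s)) - cis (l j * s))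
        \<le> s * (weight j powr (1/2) * weight (k - j) powr (1/2) + m * weight k powr p)" by simp
      hence "cmod (z j) \<le> s * (weight j powr (1/2) * weight (k - j) powr (1/2) + m * weight k powr p) * (cmod (a j) * cmod (b (k - j)))"
        unfolding z_def norm_mult[of _ "a j * b (k - j)"] norm_mult[of "a j"] by (intro mult_right_mono) auto
      thus ?thesis by (simp add: algebra_simps)
    qed
    have sm: "(\<lambda>j. s * (weight j powr (1/2) * cmod (a j) * (weight (k - j) powr (1/2) * cmod (b (k - j))))
        + s * m * (weight k powr p * (cmod (a j) * cmod (b (k - j))))) summable_on UNIV"
      by (intro summable_on_add summable_on_cmult_right Xs Ys)
    have zs: "(\<lambda>j. norm (z j)) summable_on UNIV"
      by (rule summable_on_comparison_test[OF sm zle]) auto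
    have "cmod (?c k) \<le> (\<Sum>\<^sub>\<infinity>j. norm (z j))"
      unfolding ck by (rule norm_infsum_bound[OF zs])
    also have "\<dots> \<le> (\<Sum>\<^sub>\<infinity>j. s * (weight j powr (1/2) * cmod (a j) * (weight (k - j) powr (1/2) * cmod (b (k - j))))
        + s * m * (weight k powr p * (cmod (a j) * cmod (b (k - j)))))"
      by (intro infsum_mono zs sm zle)
    also have "\<dots> = s * X k + s * m * Y k"
      unfolding X_def Y_def
      by (subst infsum_add) (auto intro!: summable_on_cmult_right Xs Ys simp: infsum_cmult_right')
    finally show ?thesis .
  qed
  have Xn: "hs r (\<lambda>k. of_real (X k))" "hnorm r (\<lambda>k. of_real (X k) :: complex)
      \<le> algc * hnorm (r + 1) a * hnorm (r + 1) b"
    using hs_bilinear_gradient[OF a b, of "\<lambda>k. of_real (X k)"] X0 by (auto simp: X_def)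
  have Yn: "hs r (\<lambda>k. of_real (Y k))" "hnorm r (\<lambda>k. of_real (Y k) :: complex) \<le> Ny"
    using Y by (simp_all only: Y_def)
  define Z where "Z k = complex_of_real s * of_real (X k) + complex_of_real (s * m) * of_real (Y k)" for k
  have Zn: "hs r Z" "hnorm r Z \<le> s * hnorm r (\<lambda>k. of_real (X k) :: complex) + (s * m) * hnorm r (\<lambda>k. of_real (Y k) :: complex)"
    unfolding Z_def[abs_def]
    using hs_add[OF hs_cmult(1)[OF Xn(1), of "of_real s"] hs_cmult(1)[OF Yn(1), of "of_real (s * m)"]]
      hs_cmult(2)[OF Xn(1), of "of_real s"] hs_cmult(2)[OF Yn(1), of "of_real (s * m)"] s m
    by (auto simp: norm_mult abs_mult)
  have "cmod (?c k) \<le> cmod (Z k)" for k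
  proof -
    have "Z k = of_real (s * X k + s * m * Y k)" by (simp add: Z_def)
    moreover have "0 \<le> s * X k + s * m * Y k" using s m X0[of k] by simp
    ultimately have "cmod (Z k) = s * X k + s * m * Y k" by (simp only: norm_of_real abs_of_nonneg)
    thus ?thesis using main[of k] by simp
  qed
  note c = hs_mono[OF Zn(1) this]
  show "hs r ?c" by (rule c(1))
  have "hnorm r ?c \<le> s * hnorm r (\<lambda>k. of_real (X k) :: complex) + (s * m) * hnorm r (\<lambda>k. of_real (Y k) :: complex)"
    using c(2) Zn(2) by linarith
  also have "\<dots> \<le> s * (algc * hnorm (r + 1) a * hnorm (r + 1) b) + (s * m) * Ny"
    using Xn(2) Yn(2) s m by (intro add_mono mult_left_mono) auto
  finally show "hnorm r ?c \<le> s * (algc * hnorm (r + 1) a * hnorm (r + 1) b + m * Ny)"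
    by (simp add: algebra_simps)
qed

end

section \<open>Local error and stability\<close>

text \<open>
The approximation of the Duhamel integral used in the first component of the scheme. The integral
over the time from \<open>0\<close> to \<open>s\<close> has been carried out exactly, which produces \<open>int_cis\<close>.
\<close>

definition duhamel_u :: "real \<Rightarrow> (int ^ 'd \<Rightarrow> complex) \<Rightarrow> real \<Rightarrow> int ^ 'd \<Rightarrow> complex" where
  "duhamel_u c b s k = - \<i> * of_real (kg_damp c k)
     * conv (\<lambda>j. int_cis (- (freq_sq j + c\<^sup>2)) s * b j) (conj_coeff b) k"

text \<open>
The same for the second component.
\<close>

definition duhamel_psi ::
  "real \<Rightarrow> (int ^ 'd \<Rightarrow> complex) \<Rightarrow> (int ^ 'd \<Rightarrow> complex) \<Rightarrow> 
    real \<Rightarrow> int ^ 'd \<Rightarrow> complex" where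
  "duhamel_psi c a b s k = \<i> / 2
     * conv (\<lambda>j. int_cis (kg_freq c j + freq_sq j / 2) s * a j
                 + int_cis (- kg_freq c j + freq_sq j / 2) s * conj_coeff a j) b k"

text \<open>
The first component of one step of the scheme, on the level of coefficients.
\<close>

definition coeff_step_u ::
  "real \<Rightarrow> real \<Rightarrow> (int ^ 'd \<Rightarrow> complex) \<Rightarrow> (int ^ 'd \<Rightarrow> complex) \<Rightarrow> 
    int ^ 'd \<Rightarrow> complex" where
  "coeff_step_u c \<tau> a b k = cis (kg_freq c k * \<tau>) * (a k + duhamel_u c b \<tau> k)"

text \<open>
The second component of one step of the scheme.
\<close>

definition coeff_step_psi ::
  "real \<Rightarrow> real \<Rightarrow> (int ^ 'd \<Rightarrow> complex) \<Rightarrow> (int ^ 'd \<Rightarrow> complex) \<Rightarrow> 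
    int ^ 'd \<Rightarrow> complex" where
  "coeff_step_psi c \<tau> a b k = cis (- (freq_sq k / 2) * \<tau>) * (b k + duhamel_psi c a b \<tau> k)"

text \<open>
The system on the level of coefficients. The linear part is written as $- i \omega$ times the
coefficient, with $\omega = - c \sqrt{|k|^2 + c^2}$ for \<open>u\<close> and $\omega = |k|^2 / 2$ for \<open>\<psi>\<close>.
\<close>

definition coeff_solution ::
  "real \<Rightarrow> real \<Rightarrow> (real \<Rightarrow> int ^ 'd \<Rightarrow> complex) \<Rightarrow> (real \<Rightarrow> int ^ 'd \<Rightarrow> complex) \<Rightarrow> bool" where
  "coeff_solution c T U P \<longleftrightarrow> (\<forall>s\<in>{0..T}. \<forall>k.
     ((\<lambda>s. U s k) has_vector_derivative
        (- \<i> * of_real (- kg_freq c k) * U s k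
         + - \<i> * of_real (kg_damp c k) * conv (P s) (conj_coeff (P s)) k)) (at s within {0..T}) \<and>
     ((\<lambda>s. P s k) has_vector_derivative
        (- \<i> * of_real (freq_sq k / 2) * P s k
         + \<i> / 2 * conv (\<lambda>j. U s j + conj_coeff (U s) j) (P s) k)) (at s within {0..T}))"

lemma hs_cis_mult [simp]:
  "hs r (\<lambda>k. cis (q k) * f k) = hs r f" "hnorm r (\<lambda>k. cis (q k) * f k) = hnorm r f"
  by (rule hs_cmod_eq; simp add: norm_mult)+

lemma conj_coeff_cis:
  assumes "\<And>k. q (- k) = q k"
  shows "conj_coeff (\<lambda>k. cis (q k) * f k) = (\<lambda>k. cis (- q k) * conj_coeff f k)"
  by (rule ext) (simp add: conj_coeff_def assms cis_cnj)

lemma hs_add_conj_coeff: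
  assumes "hs r a"
  shows "hs r (\<lambda>k. a k + conj_coeff a k)" "hnorm r (\<lambda>k. a k + conj_coeff a k) \<le> 2 * hnorm r a"
  using hs_add[of r a "conj_coeff a"] assms by auto

lemma hs_add_conj_coeff_diff:
  assumes "hs r (\<lambda>k. a k - b k)"
  shows "hs r (\<lambda>k. (a k + conj_coeff a k) - (b k + conj_coeff b k))" (is ?G1)
    "hnorm r (\<lambda>k. (a k + conj_coeff a k) - (b k + conj_coeff b k)) \<le> 2 * hnorm r (\<lambda>k. a k - b k)" (is ?G2)
proof -
  have "(\<lambda>k. (a k + conj_coeff a k) - (b k + conj_coeff b k))
    = (\<lambda>k. (a k - b k) + conj_coeff (\<lambda>k. a k - b k) k)"
    by (auto simp: conj_coeff_def)
  with hs_add_conj_coeff[OF assms]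
  show ?G1
    ?G2 by simp_all
qed

context sobolev_algebra
begin

lemma solution_increment:
  fixes U P :: "real \<Rightarrow> int ^ 'd \<Rightarrow> complex"
  assumes sol: "coeff_solution c T U P" and c: "0 < c"
    and t: "0 \<le> t" "t + \<tau> \<le> T" "0 \<le> \<tau>"
    and U: "\<And>s. s \<in> {t..t + \<tau>} \<Longrightarrow> hs r (U s) \<and> hnorm r (U s) \<le> Mu"
    and P: "\<And>s. s \<in> {t..t + \<tau>} \<Longrightarrow> hs r (P s) \<and> hnorm r (P s) \<le> Mp"
  shows "hs r (\<lambda>k. U (t + \<tau>) k - cis (kg_freq c k * \<tau>) * U t k)"
    "hnorm r (\<lambda>k. U (t + \<tau>) k - cis (kg_freq c k * \<tau>) * U t k) \<le> \<tau> * (algc * Mp * Mp)" (is ?G1)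
    "hs r (\<lambda>k. P (t + \<tau>) k - cis (- (freq_sq k / 2) * \<tau>) * P t k)"
    "hnorm r (\<lambda>k. P (t + \<tau>) k - cis (- (freq_sq k / 2) * \<tau>) * P t k) \<le> \<tau> * (algc * Mu * Mp)" (is ?G2)
proof -
  have M: "0 \<le> Mu" "0 \<le> Mp"
    using U[of t] P[of t] t by (auto intro: order_trans[OF hnorm_nonneg])
  have "hs r (\<lambda>k. - \<i> * of_real (kg_damp c k) * conv (P s) (conj_coeff (P s)) k) \<and>
      hnorm r (\<lambda>k. - \<i> * of_real (kg_damp c k) * conv (P s) (conj_coeff (P s)) k) \<le> algc * Mp * Mp"
    if "s \<in> {t..t + \<tau>}" for s
  proof -
    have p: "hs r (P s)" "hnorm r (P s) \<le> Mp" using P[OF that] by auto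
    hence q: "hs r (conj_coeff (P s))" "hnorm r (conj_coeff (P s)) \<le> Mp" by auto
    have le: "cmod (- \<i> * of_real (kg_damp c k) * conv (P s) (conj_coeff (P s)) k) \<le> cmod (conv (P s) (conj_coeff (P s)) k)" for k
      using kg_damp_bounds[OF c, of k] by (simp add: norm_mult mult_left_le_one_le)
    note m = hs_mono[OF hs_conv(1)[OF p(1) q(1)] le]
    have "algc * hnorm r (P s) * hnorm r (conj_coeff (P s)) \<le> algc * Mp * Mp"
      using p q M by (intro mult_mono mult_nonneg_nonneg) auto
    with m hs_conv(2)[OF p(1) q(1)] show ?thesis by linarith
  qed
  note Gu = this
  have eu: "((\<lambda>s. U s k) has_vector_derivative
        (- \<i> * of_real (- kg_freq c k) * U s k
         + - \<i> * of_real (kg_damp c k) * conv (P s) (conj_coeff (P s)) k)) (at s within {0..T})"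
    "((\<lambda>s. P s k) has_vector_derivative
        (- \<i> * of_real (freq_sq k / 2) * P s k
         + \<i> / 2 * conv (\<lambda>j. U s j + conj_coeff (U s) j) (P s) k)) (at s within {0..T})"
    if "s \<in> {0..T}" for s k
    using sol that unfolding coeff_solution_def by blast+
  from free_flow_error[OF eu(1) t _ Gu] M
  show "hs r (\<lambda>k. U (t + \<tau>) k - cis (kg_freq c k * \<tau>) * U t k)"
    ?G1 by auto
  have "hs r (\<lambda>k. \<i> / 2 * conv (\<lambda>j. U s j + conj_coeff (U s) j) (P s) k) \<and>
      hnorm r (\<lambda>k. \<i> / 2 * conv (\<lambda>j. U s j + conj_coeff (U s) j) (P s) k) \<le> algc * Mu * Mp"
    if "s \<in> {t..t + \<tau>}" for s
  proof -
    have p: "hs r (P s)" "hnorm r (P s) \<le> Mp" and u: "hs r (U s)" "hnorm r (U s) \<le> Mu"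
      using P[OF that] U[OF that] by auto
    note v = hs_add_conj_coeff[OF u(1)]
    note h = hs_cmult[OF hs_conv(1)[OF v(1) p(1)], of "\<i> / 2"]
    have "hnorm r (\<lambda>k. \<i> / 2 * conv (\<lambda>j. U s j + conj_coeff (U s) j) (P s) k)
       \<le> 1 / 2 * hnorm r (conv (\<lambda>j. U s j + conj_coeff (U s) j) (P s))"
      using h(2) by (simp add: norm_divide)
    also have "\<dots> \<le> 1 / 2 * (algc * (2 * hnorm r (U s)) * hnorm r (P s))"
      using hs_conv(2)[OF v(1) p(1)] v(2)
      by (intro mult_left_mono order_trans[OF hs_conv(2)[OF v(1) p(1)]] mult_right_mono) auto
    also have "\<dots> = algc * hnorm r (U s) * hnorm r (P s)" by simp
    also have "\<dots> \<le> algc * Mu * Mp"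
      using p u M by (intro mult_mono mult_nonneg_nonneg) auto
    finally show ?thesis using h(1) by auto
  qed
  note Gp = this
  from free_flow_error[OF eu(2) t _ Gp] M
  show "hs r (\<lambda>k. P (t + \<tau>) k - cis (- (freq_sq k / 2) * \<tau>) * P t k)"
    ?G2 by auto
qed

text \<open>
The defect of the first component after one step. In \<open>A\<close>, the first summand stems from replacing
\<open>\<psi>\<close> by its free flow, the second and the third from replacing the phase.
\<close>

lemma local_error_u:
  fixes U P :: "real \<Rightarrow> int ^ 'd \<Rightarrow> complex"
  assumes sol: "coeff_solution c T U P" and c: "0 < c" and a: "0 \<le> \<alpha>" "\<alpha> \<le> 1"
    and t: "0 \<le> t" "t + \<tau> \<le> T" "0 \<le> \<tau>"
    and U: "\<And>s. s \<in> {t..t + \<tau>} \<Longrightarrow> hs r (U s) \<and> hnorm r (U s) \<le> Mu"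
    and P: "\<And>s. s \<in> {t..t + \<tau>} \<Longrightarrow> hs (r + 1) (P s) \<and> hnorm (r + 1) (P s) \<le> Mp"
    and Q: "hs (r + 2 * (1 + \<alpha>)) (P t) \<and> hnorm (r + 2 * (1 + \<alpha>)) (P t) \<le> Mq"
  defines "A \<equiv> 2 * algc\<^sup>2 * Mu * Mp\<^sup>2 + algc * Mp\<^sup>2
      + min 1 (c powr (- 2 * \<alpha>)) * (alg_const TYPE('d) (r + 2 * (1 + \<alpha>)) * Mq\<^sup>2)"
  shows "hs r (\<lambda>k. U (t + \<tau>) k - coeff_step_u c \<tau> (U t) (P t) k)"
    and "hnorm r (\<lambda>k. U (t + \<tau>) k - coeff_step_u c \<tau> (U t) (P t) k) \<le> \<tau> * (\<tau> * A)" (is ?G1)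
proof -
  let ?m = "min 1 (c powr (- 2 * \<alpha>))"
  let ?C2 = "alg_const TYPE('d) (r + 2 * (1 + \<alpha>))"
  define b where "b = P t"
  have Pr: "hs r (P s) \<and> hnorm r (P s) \<le> Mp" if "s \<in> {t..t + \<tau>}" for s
    using P[OF that] hs_order_mono[of "r + 1" "P s" r] by auto
  have tt: "t \<in> {t..t + \<tau>}" using t by auto
  have M: "0 \<le> Mu" "0 \<le> Mp" "0 \<le> Mq"
    using U[OF tt] P[OF tt] Q by (auto intro: order_trans[OF hnorm_nonneg])
  have m0: "0 \<le> ?m" by simp
  have A0: "0 \<le> A" unfolding A_def using M m0 by (intro add_nonneg_nonneg mult_nonneg_nonneg) auto
  have b: "hs r b" "hnorm r b \<le> Mp" "hs (r + 1) b" "hnorm (r + 1) b \<le> Mp"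
    "hs (r + 2 * (1 + \<alpha>)) b" "hnorm (r + 2 * (1 + \<alpha>)) b \<le> Mq"
    using Pr[OF tt] P[OF tt] Q by (auto simp: b_def)
  define D' where "D' s k = - \<i> * of_real (kg_damp c k)
     * conv (\<lambda>j. cis (- (freq_sq j + c\<^sup>2) * s) * b j) (conj_coeff b) k" for s k
  define G where "G s k = - \<i> * of_real (kg_damp c k) * conv (P s) (conj_coeff (P s)) k" for s k
  have eq: "((\<lambda>s. U s k) has_vector_derivative
        (- \<i> * of_real (- kg_freq c k) * U s k + G s k)) (at s within {0..T})"
    if "s \<in> {0..T}" for s k
    using sol that unfolding coeff_solution_def G_def by blast
  have D: "((\<lambda>s. duhamel_u c b s k) has_vector_derivative D' s k) (at s within {0..\<tau>})" for s k
    unfolding duhamel_u_def D'_def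
    by (intro has_vector_derivative_mult_right has_vector_derivative_conv_int_cis) (use b in auto)
  have D0: "duhamel_u c b 0 k = 0" for k
    by (simp add: duhamel_u_def conv_def)
  have "hs r (\<lambda>k. cis (- kg_freq c k * s) * G (t + s) k - D' s k)
    \<and> hnorm r (\<lambda>k. cis (- kg_freq c k * s) * G (t + s) k - D' s k) \<le> \<tau> * A"
    if s: "s \<in> {0..\<tau>}" for s
  proof -
    define p where "p = P (t + s)"
    \<comment> \<open>The free Schroedinger flow of the value at time \<open>t\<close>.\<close>
    define bs where "bs = (\<lambda>j. cis (- (freq_sq j / 2) * s) * b j)"
    have ts: "t + s \<in> {t..t + \<tau>}" using s by auto
    have p: "hs r p" "hnorm r p \<le> Mp" using Pr[OF ts] by (auto simp: p_def)
    have bs: "hs r bs" "hnorm r bs \<le> Mp" using b by (auto simp: bs_def)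
    have cbs: "conj_coeff bs = (\<lambda>j. cis (freq_sq j / 2 * s) * conj_coeff b j)"
      unfolding bs_def by (subst conj_coeff_cis) auto
    have incr: "hs r (\<lambda>k. p k - bs k)" "hnorm r (\<lambda>k. p k - bs k) \<le> s * (algc * Mu * Mp)"
      using solution_increment(3,4)[OF sol c, of t s Mu Mp] t s U Pr
      by (auto simp: p_def bs_def b_def)
    have 1: "hs r (\<lambda>k. conv p (conj_coeff p) k - conv bs (conj_coeff bs) k)"
      "hnorm r (\<lambda>k. conv p (conj_coeff p) k - conv bs (conj_coeff bs) k) \<le> s * (2 * algc\<^sup>2 * Mu * Mp\<^sup>2)"
    proof -
      have h: "hs r (conj_coeff p)" "hs r (conj_coeff bs)" using p bs by auto
      note d = hs_conv_diff[OF p(1) bs(1) h]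
      show "hs r (\<lambda>k. conv p (conj_coeff p) k - conv bs (conj_coeff bs) k)" by (rule d(1))
      have "hnorm r (\<lambda>k. conv p (conj_coeff p) k - conv bs (conj_coeff bs) k)
        \<le> algc * (hnorm r (\<lambda>k. p k - bs k) * hnorm r p + hnorm r bs * hnorm r (\<lambda>k. p k - bs k))"
        using d(2) by simp
      also have "\<dots> \<le> algc * (s * (algc * Mu * Mp) * Mp + Mp * (s * (algc * Mu * Mp)))"
        using p bs incr M s by (intro mult_left_mono add_mono mult_mono) auto
      also have "\<dots> = s * (2 * algc\<^sup>2 * Mu * Mp\<^sup>2)" by (simp add: power2_eq_square algebra_simps)
      finally show "hnorm r (\<lambda>k. conv p (conj_coeff p) k - conv bs (conj_coeff bs) k) \<le> s * (2 * algc\<^sup>2 * Mu * Mp\<^sup>2)" .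
    qed
    let ?Z = "\<lambda>k. cis (- kg_freq c k * s) * conv bs (conj_coeff bs) k
        - conv (\<lambda>j. cis (- (freq_sq j + c\<^sup>2) * s) * b j) (conj_coeff b) k"
    have 2: "hs r ?Z"
      "hnorm r ?Z
        \<le> s * (algc * Mp\<^sup>2 + ?m * (?C2 * Mq\<^sup>2))"
    proof -
      let ?Y = "\<lambda>k. complex_of_real (weight k powr (1 + \<alpha>) * (\<Sum>\<^sub>\<infinity>j. cmod (b j) * cmod (conj_coeff b (k - j))))"
      have h: "hs (r + 1) (conj_coeff b)" using b by simp
      have Yc: "cmod (?Y k) \<le> weight k powr (1 + \<alpha>) * (\<Sum>\<^sub>\<infinity>j. cmod (b j) * cmod (conj_coeff b (k - j)))" for k
      proof -
        have "0 \<le> weight k powr (1 + \<alpha>) * (\<Sum>\<^sub>\<infinity>j. cmod (b j) * cmod (conj_coeff b (k - j)))"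
          by (intro mult_nonneg_nonneg infsum_nonneg) auto
        thus ?thesis by (simp only: norm_of_real abs_of_nonneg order_refl)
      qed
      have "hs (r + 2 * (1 + \<alpha>)) (conj_coeff b)" using b by simp
      note Y = hs_bilinear_outer[OF _ r_gt b(5) this Yc]
      have Yb: "hs r ?Y" "hnorm r ?Y \<le> ?C2 * Mq\<^sup>2"
      proof -
        show "hs r ?Y" by (rule Y(1)) (use a in auto)
        have "hnorm r ?Y \<le> ?C2 * hnorm (r + 2 * (1 + \<alpha>)) b * hnorm (r + 2 * (1 + \<alpha>)) (conj_coeff b)"
          by (rule Y(2)) (use a in auto)
        also have "\<dots> \<le> ?C2 * Mq * Mq" using b M by (intro mult_mono mult_nonneg_nonneg) auto
        finally show "hnorm r ?Y \<le> ?C2 * Mq\<^sup>2" by (simp add: power2_eq_square mult.assoc)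
      qed
      have phase: "\<bar>- kg_freq c k + - (freq_sq j / 2) + freq_sq (k - j) / 2 - - (freq_sq j + c\<^sup>2)\<bar>
        \<le> weight j powr (1/2) * weight (k - j) powr (1/2) + ?m * weight k powr (1 + \<alpha>)" for k j :: "int ^ 'd"
      proof -
        have "- kg_freq c k + - (freq_sq j / 2) + freq_sq (k - j) / 2 - - (freq_sq j + c\<^sup>2)
          = (freq_sq k / 2 - (kg_freq c k - c\<^sup>2)) - (freq_sq k - freq_sq j - freq_sq (k - j)) / 2"
          by (simp add: field_simps)
        thus ?thesis using kg_freq_approx[OF c a, of k] freq_sq_inner_bound_weight[of k j] by linarith
      qed
      note cp = conv_phase_error[OF b(3) h _ m0 phase Yb, of s]
      show "hs r ?Z"
        unfolding cbs unfolding bs_def by (rule cp(1)) (use s in auto)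
      have "hnorm r ?Z
        \<le> s * (algc * hnorm (r + 1) b * hnorm (r + 1) (conj_coeff b) + ?m * (?C2 * Mq\<^sup>2))"
        unfolding cbs unfolding bs_def by (rule cp(2)) (use s in auto)
      also have "\<dots> \<le> s * (algc * Mp * Mp + ?m * (?C2 * Mq\<^sup>2))"
        using s b M by (intro mult_left_mono add_right_mono mult_mono mult_nonneg_nonneg) auto
      finally show "hnorm r ?Z
        \<le> s * (algc * Mp\<^sup>2 + ?m * (?C2 * Mq\<^sup>2))" by (simp add: power2_eq_square mult.assoc)
    qed
    define E where "E k = cis (- kg_freq c k * s) * (conv p (conj_coeff p) k - conv bs (conj_coeff bs) k)
      + (cis (- kg_freq c k * s) * conv bs (conj_coeff bs) k
        - conv (\<lambda>j. cis (- (freq_sq j + c\<^sup>2) * s) * b j) (conj_coeff b) k)" for k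
    have E: "hs r E" "hnorm r E \<le> s * (2 * algc\<^sup>2 * Mu * Mp\<^sup>2) + s * (algc * Mp\<^sup>2 + ?m * (?C2 * Mq\<^sup>2))"
    proof -
      have c1: "hs r (\<lambda>k. cis (- kg_freq c k * s) * (conv p (conj_coeff p) k - conv bs (conj_coeff bs) k))"
        using 1(1) by simp
      note ha = hs_add[OF c1 2(1)]
      show "hs r E" unfolding E_def[abs_def] by (rule ha(1))
      show "hnorm r E \<le> s * (2 * algc\<^sup>2 * Mu * Mp\<^sup>2) + s * (algc * Mp\<^sup>2 + ?m * (?C2 * Mq\<^sup>2))"
        unfolding E_def[abs_def] using ha(2) 1(2) 2(2) by simp
    qed
    have le: "cmod (cis (- kg_freq c k * s) * G (t + s) k - D' s k) \<le> cmod (E k)" for k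
    proof -
      have "cis (- kg_freq c k * s) * G (t + s) k - D' s k = - \<i> * of_real (kg_damp c k) * E k"
        by (simp add: G_def D'_def E_def p_def algebra_simps)
      thus ?thesis using kg_damp_bounds[OF c, of k] by (simp add: norm_mult mult_left_le_one_le)
    qed
    have "hnorm r (\<lambda>k. cis (- kg_freq c k * s) * G (t + s) k - D' s k) \<le> s * A"
      using hs_mono(2)[OF E(1) le] E(2) by (simp add: A_def algebra_simps)
    also have "\<dots> \<le> \<tau> * A" using s A0 by (intro mult_right_mono) auto
    finally show ?thesis using hs_mono(1)[OF E(1) le] by simp
  qed
  note bound = this
  have "0 \<le> \<tau> * A" using A0 t by simp
  note de = duhamel_error[OF eq D D0 t this bound]
  have st: "coeff_step_u c \<tau> (U t) (P t) k = cis (- (- kg_freq c k) * \<tau>) * (U t k + duhamel_u c b \<tau> k)" for k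
    by (simp add: coeff_step_u_def b_def)
  show "hs r (\<lambda>k. U (t + \<tau>) k - coeff_step_u c \<tau> (U t) (P t) k)"
    ?G1
    unfolding st by (rule de; assumption)+
qed

end

context sobolev_algebra
begin

lemma hs_int_cis_mult:
  assumes "hs r a"
  shows "hs r (\<lambda>j. int_cis (l j) s * a j)" "hnorm r (\<lambda>j. int_cis (l j) s * a j) \<le> \<bar>s\<bar> * hnorm r a" (is ?G1)
proof -
  have "cmod (int_cis (l j) s * a j) \<le> \<bar>s\<bar> * cmod (a j)" for j
    unfolding norm_mult by (intro mult_right_mono norm_int_cis_le) auto
  from hs_bound_mult[OF assms abs_ge_zero this]
  show "hs r (\<lambda>j. int_cis (l j) s * a j)" ?G1
    by auto
qed

text \<open>
The defect of the second component. The phases differ by an inner product of two frequencies only, so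
that one derivative suffices.
\<close>

lemma local_error_psi:
  fixes U P :: "real \<Rightarrow> int ^ 'd \<Rightarrow> complex"
  assumes sol: "coeff_solution c T U P" and c: "0 < c"
    and t: "0 \<le> t" "t + \<tau> \<le> T" "0 \<le> \<tau>"
    and U: "\<And>s. s \<in> {t..t + \<tau>} \<Longrightarrow> hs (r + 1) (U s) \<and> hnorm (r + 1) (U s) \<le> Mu"
    and P: "\<And>s. s \<in> {t..t + \<tau>} \<Longrightarrow> hs (r + 1) (P s) \<and> hnorm (r + 1) (P s) \<le> Mp"
  defines "A \<equiv> algc\<^sup>2 * (Mp * Mp\<^sup>2 + Mu\<^sup>2 * Mp) + algc * Mu * Mp"
  shows "hs r (\<lambda>k. P (t + \<tau>) k - coeff_step_psi c \<tau> (U t) (P t) k)"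
    and "hnorm r (\<lambda>k. P (t + \<tau>) k - coeff_step_psi c \<tau> (U t) (P t) k) \<le> \<tau> * (\<tau> * A)" (is ?G1)
proof -
  define a where "a = U t"
  define b where "b = P t"
  have Ur: "hs r (U s) \<and> hnorm r (U s) \<le> Mu" and Pr: "hs r (P s) \<and> hnorm r (P s) \<le> Mp"
    if "s \<in> {t..t + \<tau>}" for s
    using U[OF that] P[OF that] hs_order_mono[of "r + 1" "U s" r] hs_order_mono[of "r + 1" "P s" r] by auto
  have tt: "t \<in> {t..t + \<tau>}" using t by auto
  have M: "0 \<le> Mu" "0 \<le> Mp"
    using U[OF tt] P[OF tt] by (auto intro: order_trans[OF hnorm_nonneg])
  have A0: "0 \<le> A" unfolding A_def using M by (intro add_nonneg_nonneg mult_nonneg_nonneg) auto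
  have a: "hs r a" "hnorm r a \<le> Mu" "hs (r + 1) a" "hnorm (r + 1) a \<le> Mu"
    and b: "hs r b" "hnorm r b \<le> Mp" "hs (r + 1) b" "hnorm (r + 1) b \<le> Mp"
    using Ur[OF tt] U[OF tt] Pr[OF tt] P[OF tt] by (auto simp: a_def b_def)
  let ?l1 = "\<lambda>j. kg_freq c j + freq_sq j / 2" and ?l2 = "\<lambda>j. - kg_freq c j + freq_sq j / 2"
  define D' where "D' s k = \<i> / 2 * (conv (\<lambda>j. cis (?l1 j * s) * a j) b k
     + conv (\<lambda>j. cis (?l2 j * s) * conj_coeff a j) b k)" for s k
  define G where "G s k = \<i> / 2 * conv (\<lambda>j. U s j + conj_coeff (U s) j) (P s) k" for s k
  have eq: "((\<lambda>s. P s k) has_vector_derivative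
        (- \<i> * of_real (freq_sq k / 2) * P s k + G s k)) (at s within {0..T})"
    if "s \<in> {0..T}" for s k
    using sol that unfolding coeff_solution_def G_def by blast
  have duh: "duhamel_psi c a b s k = \<i> / 2 * (conv (\<lambda>j. int_cis (?l1 j) s * a j) b k
      + conv (\<lambda>j. int_cis (?l2 j) s * conj_coeff a j) b k)" for s k
    unfolding duhamel_psi_def using a b
    by (subst conv_add_left) (auto intro: hs_int_cis_mult)
  have D: "((\<lambda>s. duhamel_psi c a b s k) has_vector_derivative D' s k) (at s within {0..\<tau>})" for s k
    unfolding duh D'_def
    by (intro has_vector_derivative_mult_right has_vector_derivative_add has_vector_derivative_conv_int_cis)
       (use a b in auto)
  have D0: "duhamel_psi c a b 0 k = 0" for k
    by (simp add: duhamel_psi_def conv_def)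
  have "hs r (\<lambda>k. cis (freq_sq k / 2 * s) * G (t + s) k - D' s k)
    \<and> hnorm r (\<lambda>k. cis (freq_sq k / 2 * s) * G (t + s) k - D' s k) \<le> \<tau> * A"
    if s: "s \<in> {0..\<tau>}" for s
  proof -
    define p where "p = P (t + s)"
    define v where "v = U (t + s)"
    define bs where "bs = (\<lambda>j. cis (- (freq_sq j / 2) * s) * b j)"
    define as where "as = (\<lambda>j. cis (kg_freq c j * s) * a j)"
    have ts: "t + s \<in> {t..t + \<tau>}" using s by auto
    have p: "hs r p" "hnorm r p \<le> Mp" and v: "hs r v" "hnorm r v \<le> Mu"
      using Pr[OF ts] Ur[OF ts] by (auto simp: p_def v_def)
    have bs: "hs r bs" "hnorm r bs \<le> Mp" and as: "hs r as" "hnorm r as \<le> Mu"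
      using a b by (auto simp: bs_def as_def)
    have cas: "conj_coeff as = (\<lambda>j. cis (- kg_freq c j * s) * conj_coeff a j)"
      unfolding as_def by (subst conj_coeff_cis) auto
    have incr: "hs r (\<lambda>k. v k - as k)" "hnorm r (\<lambda>k. v k - as k) \<le> s * (algc * Mp * Mp)"
      "hs r (\<lambda>k. p k - bs k)" "hnorm r (\<lambda>k. p k - bs k) \<le> s * (algc * Mu * Mp)"
      using solution_increment[OF sol c, of t s Mu Mp] t s Ur Pr
      by (auto simp: p_def v_def as_def bs_def a_def b_def)
    define w where "w = (\<lambda>j. v j + conj_coeff v j)"
    define ws where "ws = (\<lambda>j. as j + conj_coeff as j)"
    have w: "hs r w" "hs r ws" "hnorm r ws \<le> 2 * Mu"
      using hs_add_conj_coeff[OF v(1)] hs_add_conj_coeff[OF as(1)] as(2) by (auto simp: w_def ws_def)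
    have wd: "hnorm r (\<lambda>k. w k - ws k) \<le> 2 * (s * (algc * Mp * Mp))"
      using hs_add_conj_coeff_diff(2)[OF incr(1)] incr(2) by (simp add: w_def ws_def)
    have 1: "hs r (\<lambda>k. conv w p k - conv ws bs k)"
      "hnorm r (\<lambda>k. conv w p k - conv ws bs k) \<le> s * (2 * (algc\<^sup>2 * (Mp * Mp\<^sup>2 + Mu\<^sup>2 * Mp)))"
    proof -
      note d = hs_conv_diff[OF w(1,2) p(1) bs(1)]
      show "hs r (\<lambda>k. conv w p k - conv ws bs k)" by (rule d(1))
      have "hnorm r (\<lambda>k. conv w p k - conv ws bs k)
        \<le> algc * (2 * (s * (algc * Mp * Mp)) * Mp + 2 * Mu * (s * (algc * Mu * Mp)))"
        using p w wd incr M s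
        by (intro order_trans[OF d(2)] mult_left_mono add_mono mult_mono) auto
      also have "\<dots> = s * (2 * (algc\<^sup>2 * (Mp * Mp\<^sup>2 + Mu\<^sup>2 * Mp)))" by (simp add: power2_eq_square algebra_simps)
      finally show "hnorm r (\<lambda>k. conv w p k - conv ws bs k) \<le> s * (2 * (algc\<^sup>2 * (Mp * Mp\<^sup>2 + Mu\<^sup>2 * Mp)))" .
    qed
    let ?Z = "\<lambda>f \<mu> k. cis (freq_sq k / 2 * s) * conv (\<lambda>j. cis (\<mu> j * s) * f j) bs k
        - conv (\<lambda>j. cis ((\<mu> j + freq_sq j / 2) * s) * f j) b k"
    have 2: "hs r (?Z f \<mu>)"
      "hnorm r (?Z f \<mu>) \<le> s * (algc * Mu * Mp)"
      if f: "hs (r + 1) f" "hnorm (r + 1) f \<le> Mu" for f \<mu>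
    proof -
      let ?Y = "\<lambda>k. complex_of_real (weight k powr 0 * (\<Sum>\<^sub>\<infinity>j. cmod (f j) * cmod (b (k - j))))"
      have fr: "hs r f" using f hs_order_mono(1)[of "r + 1" f r] by auto
      have Y: "hs r ?Y"
      proof (rule hs_conv_majorant(1)[OF r_gt fr b(1)])
        show "cmod (?Y k) \<le> (\<Sum>\<^sub>\<infinity>j. cmod (f j) * cmod (b (k - j)))" for k
          using infsum_nonneg[of UNIV "\<lambda>j. cmod (f j) * cmod (b (k - j))"] by simp
      qed
      have phase: "\<bar>freq_sq k / 2 + \<mu> j + - (freq_sq (k - j) / 2) - (\<mu> j + freq_sq j / 2)\<bar>
        \<le> weight j powr (1/2) * weight (k - j) powr (1/2) + 0 * weight k powr 0" for k j :: "int ^ 'd"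
      proof -
        have "freq_sq k / 2 + \<mu> j + - (freq_sq (k - j) / 2) - (\<mu> j + freq_sq j / 2)
          = (freq_sq k - freq_sq j - freq_sq (k - j)) / 2"
          by (simp add: field_simps)
        thus ?thesis using freq_sq_inner_bound_weight[of k j] by linarith
      qed
      note cp = conv_phase_error[OF f(1) b(3) _ order_refl phase Y order_refl, of s]
      show "hs r (?Z f \<mu>)"
        unfolding bs_def by (rule cp(1)) (use s in auto)
      have "hnorm r (?Z f \<mu>)
        \<le> s * (algc * hnorm (r + 1) f * hnorm (r + 1) b + 0 * hnorm r ?Y)"
        unfolding bs_def by (rule cp(2)) (use s in auto)
      also have "\<dots> \<le> s * (algc * Mu * Mp + 0 * hnorm r ?Y)"
        using s b f M by (intro mult_left_mono add_right_mono mult_mono mult_nonneg_nonneg) auto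
      finally show "hnorm r (?Z f \<mu>) \<le> s * (algc * Mu * Mp)" by simp
    qed
    have ca: "hs (r + 1) (conj_coeff a)" "hnorm (r + 1) (conj_coeff a) \<le> Mu" using a by auto
    note 2 = 2[OF a(3,4), of "kg_freq c"] 2[OF ca, of "\<lambda>j. - kg_freq c j"]
    define E1 where "E1 k = cis (freq_sq k / 2 * s) * (conv w p k - conv ws bs k)" for k
    define E2 where "E2 k = cis (freq_sq k / 2 * s) * conv as bs k - conv (\<lambda>j. cis (?l1 j * s) * a j) b k" for k
    define E3 where "E3 k = cis (freq_sq k / 2 * s) * conv (conj_coeff as) bs k
        - conv (\<lambda>j. cis (?l2 j * s) * conj_coeff a j) b k" for k
    have E1: "hs r E1" "hnorm r E1 \<le> s * (2 * (algc\<^sup>2 * (Mp * Mp\<^sup>2 + Mu\<^sup>2 * Mp)))"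
      using 1 by (simp_all add: E1_def[abs_def])
    have E2: "hs r E2" "hnorm r E2 \<le> s * (algc * Mu * Mp)"
      unfolding E2_def[abs_def] as_def by (fact 2(1), fact 2(2))
    have E3: "hs r E3" "hnorm r E3 \<le> s * (algc * Mu * Mp)"
      unfolding E3_def[abs_def] cas by (fact 2(3), fact 2(4))
    note E12 = hs_add[OF E1(1) E2(1)]
    note E = hs_add[OF E12(1) E3(1)]
    have eqE: "cis (freq_sq k / 2 * s) * G (t + s) k - D' s k = \<i> / 2 * (E1 k + E2 k + E3 k)" for k
    proof -
      have "conv ws bs k = conv as bs k + conv (conj_coeff as) bs k"
        unfolding ws_def by (rule conv_add_left) (use as bs in auto)
      thus ?thesis
        by (simp add: G_def D'_def E1_def E2_def E3_def p_def v_def w_def algebra_simps)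
    qed
    note h = hs_cmult[OF E(1), of "\<i> / 2"]
    have "hnorm r (\<lambda>k. \<i> / 2 * (E1 k + E2 k + E3 k)) \<le> 1 / 2 * hnorm r (\<lambda>k. E1 k + E2 k + E3 k)"
      using h(2) by (simp add: norm_divide)
    also have "\<dots> \<le> s * A"
      using E(2) E12(2) E1(2) E2(2) E3(2) by (simp add: A_def algebra_simps)
    also have "\<dots> \<le> \<tau> * A" using s A0 by (intro mult_right_mono) auto
    finally show ?thesis unfolding eqE using h(1) by simp
  qed
  note bound = this
  have "0 \<le> \<tau> * A" using A0 t by simp
  note de = duhamel_error[OF eq D D0 t this bound]
  have st: "coeff_step_psi c \<tau> (U t) (P t) k = cis (- (freq_sq k / 2) * \<tau>) * (P t k + duhamel_psi c a b \<tau> k)" for k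
    by (simp add: coeff_step_psi_def a_def b_def)
  show "hs r (\<lambda>k. P (t + \<tau>) k - coeff_step_psi c \<tau> (U t) (P t) k)"
    ?G1
    unfolding st by (rule de; assumption)+
qed

lemma hs_coeff_step:
  fixes a b :: "int ^ 'd \<Rightarrow> complex"
  assumes c: "0 < c" and a: "hs r a" and b: "hs r b"
  shows "hs r (coeff_step_u c \<tau> a b)" "hs r (coeff_step_psi c \<tau> a b)"
proof -
  have "hs r (conv (\<lambda>j. int_cis (- (freq_sq j + c\<^sup>2)) \<tau> * b j) (conj_coeff b))"
    using b by (intro hs_conv hs_int_cis_mult) auto
  moreover have "cmod (duhamel_u c b \<tau> k) \<le> cmod (conv (\<lambda>j. int_cis (- (freq_sq j + c\<^sup>2)) \<tau> * b j) (conj_coeff b) k)" for k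
    using kg_damp_bounds[OF c, of k] by (simp add: duhamel_u_def norm_mult mult_left_le_one_le)
  ultimately have "hs r (duhamel_u c b \<tau>)" by (rule hs_mono(1))
  thus "hs r (coeff_step_u c \<tau> a b)"
    using a unfolding coeff_step_u_def[abs_def] by (simp add: hs_add(1))
  have "hs r (duhamel_psi c a b \<tau>)"
    unfolding duhamel_psi_def[abs_def] using a b
    by (intro hs_cmult hs_conv hs_add hs_int_cis_mult) auto
  thus "hs r (coeff_step_psi c \<tau> a b)"
    using b unfolding coeff_step_psi_def[abs_def] by (simp add: hs_add(1))
qed

lemma stability_u:
  fixes a b a' b' :: "int ^ 'd \<Rightarrow> complex"
  assumes c: "0 < c" and \<tau>: "0 \<le> \<tau>" and h: "hs r a" "hs r b" "hs r a'" "hs r b'"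
  shows "hnorm r (\<lambda>k. coeff_step_u c \<tau> a b k - coeff_step_u c \<tau> a' b' k)
    \<le> hnorm r (\<lambda>k. a k - a' k) + \<tau> * (algc * (hnorm r b + hnorm r b') * hnorm r (\<lambda>k. b k - b' k))"
proof -
  let ?l = "\<lambda>j. - (freq_sq j + c\<^sup>2)"
  let ?W = "\<lambda>b j. int_cis (?l j) \<tau> * b j"
  let ?E = "\<lambda>k. conv (?W b) (conj_coeff b) k - conv (?W b') (conj_coeff b') k"
  have W: "hs r (?W b)" "hs r (?W b')" "hnorm r (?W b') \<le> \<tau> * hnorm r b'"
    using hs_int_cis_mult[OF h(2), of ?l \<tau>] hs_int_cis_mult[OF h(4), of ?l \<tau>] \<tau> by simp_all
  have Wd: "hnorm r (\<lambda>k. ?W b k - ?W b' k) \<le> \<tau> * hnorm r (\<lambda>k. b k - b' k)"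
    using hs_int_cis_mult(2)[OF hs_diff(1)[OF h(2,4)], of ?l \<tau>] \<tau> by (simp add: right_diff_distrib)
  have cb: "hs r (conj_coeff b)" "hs r (conj_coeff b')" using h by auto
  note d = hs_conv_diff[OF W(1,2) cb]
  have "hnorm r ?E \<le> algc * (\<tau> * hnorm r (\<lambda>k. b k - b' k) * hnorm r b + \<tau> * hnorm r b' * hnorm r (\<lambda>k. b k - b' k))"
    using d(2) Wd W(3) \<tau> by (intro order_trans[OF d(2)] mult_left_mono add_mono mult_mono) auto
  hence E: "hnorm r ?E \<le> \<tau> * (algc * (hnorm r b + hnorm r b') * hnorm r (\<lambda>k. b k - b' k))"
    by (simp add: algebra_simps)
  have D: "hs r (\<lambda>k. duhamel_u c b \<tau> k - duhamel_u c b' \<tau> k)"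
    "hnorm r (\<lambda>k. duhamel_u c b \<tau> k - duhamel_u c b' \<tau> k) \<le> hnorm r ?E"
  proof -
    have "cmod (duhamel_u c b \<tau> k - duhamel_u c b' \<tau> k) \<le> cmod (?E k)" for k
    proof -
      have "duhamel_u c b \<tau> k - duhamel_u c b' \<tau> k = - \<i> * of_real (kg_damp c k) * ?E k"
        by (simp only: duhamel_u_def right_diff_distrib)
      hence "cmod (duhamel_u c b \<tau> k - duhamel_u c b' \<tau> k) = \<bar>kg_damp c k\<bar> * cmod (?E k)"
        by (simp only: norm_mult norm_of_real norm_minus_cancel norm_ii mult_1)
      thus ?thesis using kg_damp_bounds[OF c, of k] by (simp add: mult_left_le_one_le)
    qed
    from hs_mono[OF d(1) this] show "hs r (\<lambda>k. duhamel_u c b \<tau> k - duhamel_u c b' \<tau> k)"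
      "hnorm r (\<lambda>k. duhamel_u c b \<tau> k - duhamel_u c b' \<tau> k) \<le> hnorm r ?E" by auto
  qed
  have "coeff_step_u c \<tau> a b k - coeff_step_u c \<tau> a' b' k
      = cis (kg_freq c k * \<tau>) * ((a k - a' k) + (duhamel_u c b \<tau> k - duhamel_u c b' \<tau> k))" for k
    by (simp add: coeff_step_u_def algebra_simps)
  hence "hnorm r (\<lambda>k. coeff_step_u c \<tau> a b k - coeff_step_u c \<tau> a' b' k)
    = hnorm r (\<lambda>k. (a k - a' k) + (duhamel_u c b \<tau> k - duhamel_u c b' \<tau> k))" by simp
  also have "\<dots> \<le> hnorm r (\<lambda>k. a k - a' k) + hnorm r (\<lambda>k. duhamel_u c b \<tau> k - duhamel_u c b' \<tau> k)"
    by (rule hs_add(2)[OF hs_diff(1)[OF h(1,3)] D(1)])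
  finally show ?thesis using D(2) E by linarith
qed

lemma stability_psi:
  fixes a b a' b' :: "int ^ 'd \<Rightarrow> complex"
  assumes \<tau>: "0 \<le> \<tau>" and h: "hs r a" "hs r b" "hs r a'" "hs r b'"
  shows "hnorm r (\<lambda>k. coeff_step_psi c \<tau> a b k - coeff_step_psi c \<tau> a' b' k)
    \<le> hnorm r (\<lambda>k. b k - b' k)
      + \<tau> * (algc * (hnorm r b * hnorm r (\<lambda>k. a k - a' k) + hnorm r a' * hnorm r (\<lambda>k. b k - b' k)))"
proof -
  let ?W = "\<lambda>a j. int_cis (kg_freq c j + freq_sq j / 2) \<tau> * a j
                 + int_cis (- kg_freq c j + freq_sq j / 2) \<tau> * conj_coeff a j"
  have Wn: "hs r (?W f)" "hnorm r (?W f) \<le> 2 * (\<tau> * hnorm r f)" if f: "hs r f" for f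
  proof -
    have cf: "hs r (conj_coeff f)" using f by simp
    note i1 = hs_int_cis_mult[OF f, of "\<lambda>j. kg_freq c j + freq_sq j / 2" \<tau>]
    note i2 = hs_int_cis_mult[OF cf, of "\<lambda>j. - kg_freq c j + freq_sq j / 2" \<tau>]
    from hs_add[OF i1(1) i2(1)] i1(2) i2(2) \<tau>
    show "hs r (?W f)" "hnorm r (?W f) \<le> 2 * (\<tau> * hnorm r f)" by auto
  qed
  have Wd: "hnorm r (\<lambda>k. ?W a k - ?W a' k) \<le> 2 * (\<tau> * hnorm r (\<lambda>k. a k - a' k))"
  proof -
    have "(\<lambda>k. ?W a k - ?W a' k) = ?W (\<lambda>k. a k - a' k)"
      by (rule ext) (simp add: conj_coeff_def algebra_simps)
    thus ?thesis using Wn(2)[OF hs_diff(1)[OF h(1,3)]] by simp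
  qed
  let ?E = "\<lambda>k. conv (?W a) b k - conv (?W a') b' k"
  note d = hs_conv_diff[OF Wn(1)[OF h(1)] Wn(1)[OF h(3)] h(2,4)]
  have "hnorm r ?E \<le> algc * (2 * (\<tau> * hnorm r (\<lambda>k. a k - a' k)) * hnorm r b
      + 2 * (\<tau> * hnorm r a') * hnorm r (\<lambda>k. b k - b' k))"
    using Wd Wn(2)[OF h(3)] \<tau> by (intro order_trans[OF d(2)] mult_left_mono add_mono mult_mono) auto
  hence E: "1 / 2 * hnorm r ?E \<le> \<tau> * (algc * (hnorm r b * hnorm r (\<lambda>k. a k - a' k) + hnorm r a' * hnorm r (\<lambda>k. b k - b' k)))"
    by (simp add: algebra_simps)
  have eqD: "(\<lambda>k. duhamel_psi c a b \<tau> k - duhamel_psi c a' b' \<tau> k) = (\<lambda>k. \<i> / 2 * ?E k)"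
    by (rule ext) (simp only: duhamel_psi_def right_diff_distrib)
  have D: "hs r (\<lambda>k. duhamel_psi c a b \<tau> k - duhamel_psi c a' b' \<tau> k)"
    "hnorm r (\<lambda>k. duhamel_psi c a b \<tau> k - duhamel_psi c a' b' \<tau> k) \<le> 1 / 2 * hnorm r ?E"
    unfolding eqD using hs_cmult[OF d(1), of "\<i> / 2"] by (auto simp: norm_divide)
  have "coeff_step_psi c \<tau> a b k - coeff_step_psi c \<tau> a' b' k
      = cis (- (freq_sq k / 2) * \<tau>) * ((b k - b' k) + (duhamel_psi c a b \<tau> k - duhamel_psi c a' b' \<tau> k))" for k
    by (simp add: coeff_step_psi_def algebra_simps)
  hence "hnorm r (\<lambda>k. coeff_step_psi c \<tau> a b k - coeff_step_psi c \<tau> a' b' k)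
    = hnorm r (\<lambda>k. (b k - b' k) + (duhamel_psi c a b \<tau> k - duhamel_psi c a' b' \<tau> k))" by simp
  also have "\<dots> \<le> hnorm r (\<lambda>k. b k - b' k) + hnorm r (\<lambda>k. duhamel_psi c a b \<tau> k - duhamel_psi c a' b' \<tau> k)"
    by (rule hs_add(2)[OF hs_diff(1)[OF h(2,4)] D(1)])
  finally show ?thesis using D(2) E by linarith
qed

end

section \<open>From functions to coefficients\<close>

lemma conv_cmult_left: "conv (\<lambda>j. z * a j) b k = z * conv a b k"
  unfolding conv_def mult.assoc by (rule infsum_cmult_right')

lemma fseries_add:
  assumes "ell1 a" "ell1 b"
  shows "fseries a x + fseries b x = fseries (\<lambda>k. a k + b k) x"
proof -
  have "(\<lambda>k. f k * cis (freq_dot k x)) summable_on UNIV" if "ell1 f" for f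
  proof (rule abs_summable_summable)
    show "(\<lambda>k. norm (f k * cis (freq_dot k x))) summable_on UNIV"
      using that by (simp add: norm_mult)
  qed
  from infsum_add[OF this[OF assms(1)] this[OF assms(2)]] show ?thesis
    by (simp add: fseries_def distrib_right)
qed

text \<open>
The symbols of the multipliers in the scheme, in real form.
\<close>

lemma symbol_simps:
  "exp (\<i> * of_real \<tau> * of_real c * nabla_symbol c k) = cis (kg_freq c k * \<tau>)" (is ?G1)
  "of_real c * inverse (nabla_symbol c k) = of_real (kg_damp c k)" (is ?G2)
  "of_real c * nabla_symbol c k = of_real (kg_freq c k)" (is ?G3)
  "of_real \<tau> * phi1 (\<i> * of_real \<tau> * (laplace_symbol k - of_real (c\<^sup>2))) = int_cis (- (freq_sq k + c\<^sup>2)) \<tau>" (is ?G4)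
  "of_real \<tau> * phi1 (\<i> * of_real \<tau> * (of_real c * nabla_symbol c k - 1 / 2 * laplace_symbol k))
    = int_cis (kg_freq c k + freq_sq k / 2) \<tau>" (is ?G5)
  "of_real \<tau> * phi1 (- \<i> * of_real \<tau> * (of_real c * nabla_symbol c k + 1 / 2 * laplace_symbol k))
    = int_cis (- kg_freq c k + freq_sq k / 2) \<tau>" (is ?G6)
  "exp (\<i> / 2 * of_real \<tau> * laplace_symbol k) = cis (- (freq_sq k / 2) * \<tau>)" (is ?G7)
proof -
  show ?G1
    unfolding cis_conv_exp nabla_symbol_def kg_freq_def of_real_mult by (simp only: mult_ac)
  show ?G2
    by (simp add: nabla_symbol_def kg_damp_def divide_inverse)
  show ?G3
    by (simp add: nabla_symbol_def kg_freq_def)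
  show ?G4
    by (simp add: laplace_symbol_def int_cis_def)
  show ?G5
    by (simp add: laplace_symbol_def nabla_symbol_def int_cis_def kg_freq_def)
  have "- \<i> * of_real \<tau> * (of_real c * nabla_symbol c k + 1 / 2 * laplace_symbol k)
    = \<i> * of_real \<tau> * of_real (- kg_freq c k + freq_sq k / 2)"
    by (simp add: laplace_symbol_def nabla_symbol_def kg_freq_def algebra_simps)
  thus ?G6
    by (simp only: int_cis_def)
  show ?G7
    by (simp add: cis_conv_exp laplace_symbol_def mult_ac)
qed

lemma fourier_coeff_cnj_fun: "fourier_coeff (\<lambda>x. cnj (f x)) = conj_coeff (fourier_coeff f)"
  by (rule ext) (simp add: fourier_coeff_cnj conj_coeff_def)

context sobolev_algebra
begin

lemma hs_phi_multiplier:
  fixes a :: "int ^ 'd \<Rightarrow> complex"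
  assumes "0 < \<tau>" "hs r a" "\<And>k. of_real \<tau> * m k = int_cis (l k) \<tau>"
  shows "hs r (\<lambda>k. m k * a k)"
proof (rule hs_bound_mult(1)[OF assms(2) zero_le_one])
  fix k
  have "\<tau> * cmod (m k) = cmod (int_cis (l k) \<tau>)"
    using assms(1) unfolding assms(3)[symmetric] by (simp add: norm_mult)
  also have "\<dots> \<le> \<tau> * 1" using norm_int_cis_le[of "l k" \<tau>] assms(1) by simp
  finally have "cmod (m k) \<le> 1" using assms(1) by simp
  thus "cmod (m k * a k) \<le> 1 * cmod (a k)" unfolding norm_mult by (intro mult_right_mono) auto
qed

lemma fourier_coeff_step_u:
  fixes u \<psi> :: "real ^ 'd \<Rightarrow> complex"
  assumes c: "0 < c" and \<tau>: "0 < \<tau>"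
    and int: "cell_integrable u" "cell_integrable \<psi>"
    and hs: "hs r (fourier_coeff u)" "hs r (fourier_coeff \<psi>)"
  shows "cell_integrable (KGS_step_u c \<tau> u \<psi>)"
    and "fourier_coeff (KGS_step_u c \<tau> u \<psi>) = coeff_step_u c \<tau> (fourier_coeff u) (fourier_coeff \<psi>)"
proof -
  let ?a = "fourier_coeff u" and ?b = "fourier_coeff \<psi>"
  let ?l = "\<lambda>k. - (freq_sq k + c\<^sup>2)"
  define p where "p = (\<lambda>k. phi1 (\<i> * of_real \<tau> * (laplace_symbol k - of_real (c\<^sup>2))) * ?b k)"
  have p: "hs r p" unfolding p_def by (rule hs_phi_multiplier[OF \<tau> hs(2) symbol_simps(4)])
  define q where "q = conv p (conj_coeff ?b)"
  have q: "hs r q" unfolding q_def using p hs by (intro hs_conv) auto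
  have fq: "fourier_coeff (\<lambda>y. cnj (\<psi> y) * fseries p y) = q"
    unfolding q_def by (simp add: fourier_coeff_mult_fseries[OF cell_integrable_cnj[OF int(2)] hs_l1[OF p]] fourier_coeff_cnj_fun)
  define A where "A = (\<lambda>k. cis (kg_freq c k * \<tau>) * ?a k)"
  define B where "B = (\<lambda>k. of_real (kg_damp c k) * cis (kg_freq c k * \<tau>) * q k)"
  have A: "hs r A" using hs by (simp add: A_def)
  have B: "hs r B"
  proof (rule hs_mono(1)[OF q])
    show "cmod (B k) \<le> cmod (q k)" for k
      using kg_damp_bounds[OF c, of k] by (simp add: B_def norm_mult mult_left_le_one_le)
  qed
  have eq: "KGS_step_u c \<tau> u \<psi> = (\<lambda>x. fseries A x - \<i> * of_real \<tau> * fseries B x)"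
    unfolding KGS_step_u_def fourier_multiplier_eq p_def[symmetric] fq symbol_simps A_def B_def ..
  note iA = cell_integrable_fseries[OF hs_l1[OF A]] and iB = cell_integrable_fseries[OF hs_l1[OF B]]
  show "cell_integrable (KGS_step_u c \<tau> u \<psi>)"
    unfolding eq by (intro cell_integrable_diff cell_integrable_cmult iA iB)
  show "fourier_coeff (KGS_step_u c \<tau> u \<psi>) = coeff_step_u c \<tau> ?a ?b"
  proof
    fix k
    have e1: "fourier_coeff (KGS_step_u c \<tau> u \<psi>) k = A k - \<i> * of_real \<tau> * B k"
      unfolding eq using iA cell_integrable_cmult[OF iB]
      by (simp add: fourier_coeff_diff fourier_coeff_cmult fourier_coeff_fseries hs_l1 A B)
    have e2: "of_real \<tau> * q k = conv (\<lambda>j. int_cis (?l j) \<tau> * ?b j) (conj_coeff ?b) k"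
      unfolding q_def p_def conv_cmult_left[symmetric] mult.assoc[symmetric] symbol_simps ..
    show "fourier_coeff (KGS_step_u c \<tau> u \<psi>) k = coeff_step_u c \<tau> ?a ?b k"
      unfolding coeff_step_u_def duhamel_u_def e2[symmetric] e1 A_def B_def by (simp add: algebra_simps)
  qed
qed

lemma fourier_coeff_step_psi:
  fixes u \<psi> :: "real ^ 'd \<Rightarrow> complex"
  assumes \<tau>: "0 < \<tau>"
    and int: "cell_integrable u" "cell_integrable \<psi>"
    and hs: "hs r (fourier_coeff u)" "hs r (fourier_coeff \<psi>)"
  shows "cell_integrable (KGS_step_psi c \<tau> u \<psi>)"
    and "fourier_coeff (KGS_step_psi c \<tau> u \<psi>) = coeff_step_psi c \<tau> (fourier_coeff u) (fourier_coeff \<psi>)"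
proof -
  let ?a = "fourier_coeff u" and ?b = "fourier_coeff \<psi>"
  let ?l1 = "\<lambda>k. kg_freq c k + freq_sq k / 2" and ?l2 = "\<lambda>k. - kg_freq c k + freq_sq k / 2"
  define p1 where "p1 = (\<lambda>k. phi1 (\<i> * of_real \<tau> * (of_real c * nabla_symbol c k - 1 / 2 * laplace_symbol k)) * ?a k)"
  define p2 where "p2 = (\<lambda>k. phi1 (- \<i> * of_real \<tau> * (of_real c * nabla_symbol c k + 1 / 2 * laplace_symbol k)) * conj_coeff ?a k)"
  have ca: "hs r (conj_coeff ?a)" using hs by simp
  have p1: "hs r p1" unfolding p1_def by (rule hs_phi_multiplier[OF \<tau> hs(1) symbol_simps(5)])
  have p2: "hs r p2" unfolding p2_def by (rule hs_phi_multiplier[OF \<tau> ca symbol_simps(6)])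
  define p where "p = (\<lambda>k. p1 k + p2 k)"
  have p: "hs r p" unfolding p_def by (rule hs_add(1)[OF p1 p2])
  define q where "q = conv p ?b"
  have q: "hs r q" unfolding q_def using p hs by (intro hs_conv) auto
  have fq: "fourier_coeff (\<lambda>y. \<psi> y * (fseries p1 y + fseries p2 y)) = q"
    unfolding fseries_add[OF hs_l1[OF p1] hs_l1[OF p2]] p_def[symmetric] q_def
    by (rule fourier_coeff_mult_fseries[OF int(2) hs_l1[OF p]])
  define A where "A = (\<lambda>k. cis (- (freq_sq k / 2) * \<tau>) * ?b k)"
  define B where "B = (\<lambda>k. cis (- (freq_sq k / 2) * \<tau>) * q k)"
  have A: "hs r A" using hs by (simp add: A_def)
  have B: "hs r B" using q by (simp add: B_def)
  have eq: "KGS_step_psi c \<tau> u \<psi> = (\<lambda>x. fseries A x + \<i> / 2 * of_real \<tau> * fseries B x)"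
    unfolding KGS_step_psi_def fourier_multiplier_eq fourier_coeff_cnj_fun p1_def[symmetric] p2_def[symmetric]
      fq unfolding symbol_simps(7) A_def B_def ..
  note iA = cell_integrable_fseries[OF hs_l1[OF A]] and iB = cell_integrable_fseries[OF hs_l1[OF B]]
  show "cell_integrable (KGS_step_psi c \<tau> u \<psi>)"
    unfolding eq by (intro cell_integrable_add cell_integrable_cmult iA iB)
  show "fourier_coeff (KGS_step_psi c \<tau> u \<psi>) = coeff_step_psi c \<tau> ?a ?b"
  proof
    fix k
    have e1: "fourier_coeff (KGS_step_psi c \<tau> u \<psi>) k = A k + \<i> / 2 * of_real \<tau> * B k"
      unfolding eq fourier_coeff_add[OF iA cell_integrable_cmult[OF iB]] fourier_coeff_cmult
        fourier_coeff_fseries[OF hs_l1[OF A]] fourier_coeff_fseries[OF hs_l1[OF B]] ..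
    have e2: "of_real \<tau> * q k = conv (\<lambda>j. int_cis (?l1 j) \<tau> * ?a j + int_cis (?l2 j) \<tau> * conj_coeff ?a j) ?b k"
    proof -
      have "of_real \<tau> * p1 j = int_cis (?l1 j) \<tau> * ?a j" for j
        unfolding symbol_simps(5)[symmetric] by (simp only: p1_def mult.assoc)
      moreover have "of_real \<tau> * p2 j = int_cis (?l2 j) \<tau> * conj_coeff ?a j" for j
        unfolding symbol_simps(6)[symmetric] by (simp only: p2_def mult.assoc)
      ultimately show ?thesis
        unfolding q_def p_def conv_cmult_left[symmetric] distrib_left by (simp only:)
    qed
    show "fourier_coeff (KGS_step_psi c \<tau> u \<psi>) k = coeff_step_psi c \<tau> ?a ?b k"
      unfolding coeff_step_psi_def duhamel_psi_def e2[symmetric] e1 A_def B_def by (simp add: algebra_simps)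
  qed
qed

text \<open>
A derivative in the Sobolev norm is a derivative of every coefficient.
\<close>

lemma sobolev_curve_derivative:
  fixes f :: "real \<Rightarrow> real ^ 'd \<Rightarrow> complex"
  assumes d: "sobolev_deriv T r f t f'" and t: "t \<in> {0..T}"
    and int: "\<And>s. s \<in> {0..T} \<Longrightarrow> cell_integrable (f s)"
    and hs: "\<And>s. s \<in> {0..T} \<Longrightarrow> hs r (fourier_coeff (f s))"
  shows "((\<lambda>s. fourier_coeff (f s) k) has_vector_derivative fourier_coeff f' k) (at t within {0..T})"
proof -
  let ?q = "\<lambda>s x. (f s x - f t x) / of_real (s - t) - f' x"
  have f': "cell_integrable f'" "hs r (fourier_coeff f')"
    using d by (auto simp: sobolev_deriv_def intro: sobolev_cell_integrable sobolev_hs)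
  have fc: "fourier_coeff (?q s) = (\<lambda>k. inverse (of_real (s - t)) * (fourier_coeff (f s) k - fourier_coeff (f t) k) - fourier_coeff f' k)"
    if "s \<in> {0..T}" for s
  proof
    fix k
    have i: "cell_integrable (\<lambda>x. f s x - f t x)" by (intro cell_integrable_diff int that t)
    have "fourier_coeff (?q s) k = fourier_coeff (\<lambda>x. inverse (of_real (s - t)) * (f s x - f t x) - f' x) k"
      by (simp add: divide_inverse mult.commute)
    also have "\<dots> = inverse (of_real (s - t)) * (fourier_coeff (f s) k - fourier_coeff (f t) k) - fourier_coeff f' k"
      unfolding fourier_coeff_diff[OF cell_integrable_cmult[OF i] f'(1)] fourier_coeff_cmult
        fourier_coeff_diff[OF int[OF that] int[OF t]] ..
    finally show "fourier_coeff (?q s) k = inverse (of_real (s - t)) * (fourier_coeff (f s) k - fourier_coeff (f t) k) - fourier_coeff f' k" .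
  qed
  have "((\<lambda>s. (fourier_coeff (f s) k - fourier_coeff (f t) k) / of_real (s - t) - fourier_coeff f' k) \<longlongrightarrow> 0) (at t within {0..T})"
  proof (rule Lim_null_comparison)
    show "((\<lambda>s. sobolev_norm r (?q s)) \<longlongrightarrow> 0) (at t within {0..T})"
      using d by (simp add: sobolev_deriv_def)
    have "norm ((fourier_coeff (f s) k - fourier_coeff (f t) k) / of_real (s - t) - fourier_coeff f' k) \<le> sobolev_norm r (?q s)"
      if s: "s \<in> {0..T}" for s
    proof -
      have "hs r (fourier_coeff (?q s))"
        unfolding fc[OF s] by (intro hs_diff hs_cmult hs s t f')
      moreover have "(fourier_coeff (f s) k - fourier_coeff (f t) k) / of_real (s - t) - fourier_coeff f' k
        = fourier_coeff (?q s) k"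
        unfolding fc[OF s] by (simp add: divide_inverse mult.commute)
      ultimately show ?thesis
        unfolding sobolev_norm_eq by (simp only: cmod_le_hnorm[OF _ r_nonneg])
    qed
    thus "\<forall>\<^sub>F s in at t within {0..T}. norm ((fourier_coeff (f s) k - fourier_coeff (f t) k) / of_real (s - t) - fourier_coeff f' k)
        \<le> sobolev_norm r (?q s)"
      by (simp add: eventually_at_filter)
  qed
  thus ?thesis unfolding has_vector_derivative_iff_quotient by (rule Lim_null[THEN iffD2])
qed

text \<open>
Two derivatives of \<open>\<psi>\<close> make the Fourier series of $\Delta \psi$ converge absolutely, so that the
coefficients of the multipliers in the equations can be read off.
\<close>

lemma coeff_solution_of_KGS_solution:
  fixes u \<psi> :: "real \<Rightarrow> real ^ 'd \<Rightarrow> complex"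
  assumes c: "0 < c" and q: "r + 2 \<le> q"
    and u: "\<And>t. t \<in> {0..T} \<Longrightarrow> u t \<in> sobolev (r + 1)"
    and \<psi>: "\<And>t. t \<in> {0..T} \<Longrightarrow> \<psi> t \<in> sobolev q"
    and sol: "KGS_solution c T r u \<psi>"
  shows "coeff_solution c T (\<lambda>t. fourier_coeff (u t)) (\<lambda>t. fourier_coeff (\<psi> t))"
  unfolding coeff_solution_def
proof (intro ballI allI)
  fix t k assume t: "t \<in> {0..T}"
  have iu: "cell_integrable (u s)" and i\<psi>: "cell_integrable (\<psi> s)"
    and hu1: "hs (r + 1) (fourier_coeff (u s))" and hu: "hs r (fourier_coeff (u s))"
    and h\<psi>2: "hs (r + 2) (fourier_coeff (\<psi> s))" and h\<psi>: "hs r (fourier_coeff (\<psi> s))" if "s \<in> {0..T}" for s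
    using u[OF that] \<psi>[OF that] q hs_order_mono(1)[of "r + 1" "fourier_coeff (u s)" r]
      hs_order_mono(1)[of q "fourier_coeff (\<psi> s)" "r + 2"] hs_order_mono(1)[of q "fourier_coeff (\<psi> s)" r]
    by (auto intro: sobolev_cell_integrable sobolev_hs)
  let ?U = "fourier_coeff (u t)" and ?P = "fourier_coeff (\<psi> t)"
  have cP: "hs r (conj_coeff ?P)" and cU: "hs r (conj_coeff ?U)" using h\<psi>[OF t] hu[OF t] by auto
  obtain u' \<psi>' where du: "sobolev_deriv T r u t u'" and d\<psi>: "sobolev_deriv T r \<psi> t \<psi>'"
    and equ: "\<And>x. \<i> * u' x
             + fourier_multiplier (\<lambda>k. of_real c * nabla_symbol c k) (u t) x
             - fourier_multiplier (\<lambda>k. of_real c * inverse (nabla_symbol c k))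
                 (\<lambda>y. of_real ((cmod (\<psi> t y))\<^sup>2)) x = 0"
    and eq\<psi>: "\<And>x. \<i> * \<psi>' x
             + 1 / 2 * fourier_multiplier laplace_symbol (\<psi> t) x
             + 1 / 2 * \<psi> t x * (u t x + cnj (u t x)) = 0"
    using sol t unfolding KGS_solution_def by blast
  have "fourier_coeff (\<lambda>y. of_real ((cmod (\<psi> t y))\<^sup>2)) = conv ?P (conj_coeff ?P)"
    unfolding complex_norm_square fourier_coeff_cnj_fun[symmetric]
    by (rule fourier_coeff_mult(1)[OF i\<psi>[OF t] hs_l1[OF h\<psi>[OF t]] cell_integrable_cnj[OF i\<psi>[OF t]]])
  note sq = this
  have A: "hs r (\<lambda>k. of_real (kg_freq c k) * ?U k)"
  proof -
    have h1: "hs r (\<lambda>k. of_real (weight k powr (1/2)) * ?U k)" using hu1[OF t] by (simp add: hs_weight_shift)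
    have h2: "cmod (of_real (kg_freq c k) * ?U k) \<le> (c * (1 + c)) * cmod (of_real (weight k powr (1/2)) * ?U k)" for k
    proof -
      have "sqrt (freq_sq k + c\<^sup>2) \<le> sqrt (freq_sq k) + sqrt (c\<^sup>2)" by (rule sqrt_add_le_add_sqrt) auto
      also have "\<dots> \<le> sqrt (weight k) + c * sqrt (weight k)"
        using c by (intro add_mono real_sqrt_le_mono) (auto simp: weight_def)
      finally have "kg_freq c k \<le> c * ((1 + c) * sqrt (weight k))"
        unfolding kg_freq_def using c by (intro mult_left_mono) (auto simp: algebra_simps)
      moreover have "0 \<le> kg_freq c k" using c by (auto simp: kg_freq_def intro!: mult_nonneg_nonneg)
      ultimately have "\<bar>kg_freq c k\<bar> \<le> (c * (1 + c)) * weight k powr (1/2)" by (simp add: powr_half_sqrt mult.assoc)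
      hence "\<bar>kg_freq c k\<bar> * cmod (?U k) \<le> (c * (1 + c)) * weight k powr (1/2) * cmod (?U k)"
        by (intro mult_right_mono) auto
      thus ?thesis by (simp add: norm_mult mult.assoc)
    qed
    have h3: "0 \<le> c * (1 + c)" using c by simp
    from hs_bound_mult(1)[OF h1 h3 h2] show ?thesis .
  qed
  have B: "hs r (\<lambda>k. of_real (kg_damp c k) * conv ?P (conj_coeff ?P) k)"
  proof (rule hs_mono(1)[OF hs_conv(1)[OF h\<psi>[OF t] cP]])
    show "cmod (of_real (kg_damp c k) * conv ?P (conj_coeff ?P) k) \<le> cmod (conv ?P (conj_coeff ?P) k)" for k
      using kg_damp_bounds[OF c, of k] by (simp add: norm_mult mult_left_le_one_le)
  qed
  have u': "u' = (\<lambda>x. \<i> * (fseries (\<lambda>k. of_real (kg_freq c k) * ?U k) x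
      - fseries (\<lambda>k. of_real (kg_damp c k) * conv ?P (conj_coeff ?P) k) x))"
  proof
    fix x
    have "u' x = - \<i> * (\<i> * u' x)" by simp
    also have "\<i> * u' x = - (fseries (\<lambda>k. of_real (kg_freq c k) * ?U k) x
      - fseries (\<lambda>k. of_real (kg_damp c k) * conv ?P (conj_coeff ?P) k) x)"
      using equ[of x] unfolding fourier_multiplier_eq symbol_simps sq by (simp add: algebra_simps eq_neg_iff_add_eq_0)
    finally show "u' x = \<i> * (fseries (\<lambda>k. of_real (kg_freq c k) * ?U k) x
      - fseries (\<lambda>k. of_real (kg_damp c k) * conv ?P (conj_coeff ?P) k) x)"
      by (simp only: minus_mult_minus)
  qed
  have fu': "fourier_coeff u' k = - \<i> * of_real (- kg_freq c k) * ?U k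
         + - \<i> * of_real (kg_damp c k) * conv ?P (conj_coeff ?P) k"
    unfolding u' fourier_coeff_cmult
      fourier_coeff_diff[OF cell_integrable_fseries[OF hs_l1[OF A]] cell_integrable_fseries[OF hs_l1[OF B]]]
      fourier_coeff_fseries[OF hs_l1[OF A]] fourier_coeff_fseries[OF hs_l1[OF B]]
    by (simp add: algebra_simps)
  have L: "hs r (\<lambda>k. laplace_symbol k * ?P k)"
  proof -
    have "hs r (\<lambda>k. of_real (weight k powr 1) * ?P k)"
      using h\<psi>2[OF t] hs_weight_shift(1)[of r 1 ?P] by simp
    moreover have "cmod (laplace_symbol k * ?P k) \<le> cmod (of_real (weight k powr 1) * ?P k)" for k
    proof -
      have "freq_sq k \<le> weight k" by (simp add: weight_def)
      hence "freq_sq k * cmod (?P k) \<le> weight k * cmod (?P k)" by (rule mult_right_mono) simp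
      thus ?thesis by (simp add: laplace_symbol_def norm_mult)
    qed
    ultimately show ?thesis by (rule hs_mono(1))
  qed
  have iv: "cell_integrable (\<lambda>x. u t x + cnj (u t x))"
    by (intro cell_integrable_add cell_integrable_cnj iu t)
  have fv: "fourier_coeff (\<lambda>x. u t x + cnj (u t x)) = (\<lambda>j. ?U j + conj_coeff ?U j)"
    by (rule ext) (simp add: fourier_coeff_add iu[OF t] cell_integrable_cnj fourier_coeff_cnj conj_coeff_def)
  note pm = fourier_coeff_mult[OF i\<psi>[OF t] hs_l1[OF h\<psi>[OF t]] iv, unfolded fv]
  have \<psi>': "\<psi>' = (\<lambda>x. \<i> / 2 * (fseries (\<lambda>k. laplace_symbol k * ?P k) x + \<psi> t x * (u t x + cnj (u t x))))"
  proof
    fix x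
    have "\<psi>' x = - \<i> * (\<i> * \<psi>' x)" by simp
    also have "\<i> * \<psi>' x = - (1 / 2 * fseries (\<lambda>k. laplace_symbol k * ?P k) x + 1 / 2 * \<psi> t x * (u t x + cnj (u t x)))"
      using eq\<psi>[of x] unfolding fourier_multiplier_eq by (simp only: eq_neg_iff_add_eq_0 add.assoc)
    finally show "\<psi>' x = \<i> / 2 * (fseries (\<lambda>k. laplace_symbol k * ?P k) x + \<psi> t x * (u t x + cnj (u t x)))"
      by (simp add: algebra_simps)
  qed
  have f\<psi>': "fourier_coeff \<psi>' k = - \<i> * of_real (freq_sq k / 2) * ?P k
         + \<i> / 2 * conv (\<lambda>j. ?U j + conj_coeff ?U j) ?P k"
    unfolding \<psi>' fourier_coeff_cmult fourier_coeff_add[OF cell_integrable_fseries[OF hs_l1[OF L]] pm(2)]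
      fourier_coeff_fseries[OF hs_l1[OF L]] pm(1) conv_commute[of ?P]
    by (simp add: laplace_symbol_def algebra_simps)
  show "((\<lambda>s. fourier_coeff (u s) k) has_vector_derivative
        (- \<i> * of_real (- kg_freq c k) * ?U k
         + - \<i> * of_real (kg_damp c k) * conv ?P (conj_coeff ?P) k)) (at t within {0..T}) \<and>
     ((\<lambda>s. fourier_coeff (\<psi> s) k) has_vector_derivative
        (- \<i> * of_real (freq_sq k / 2) * ?P k
         + \<i> / 2 * conv (\<lambda>j. ?U j + conj_coeff ?U j) ?P k)) (at t within {0..T})"
    using sobolev_curve_derivative[OF du t iu hu, of k] sobolev_curve_derivative[OF d\<psi> t i\<psi> h\<psi>, of k]
    unfolding fu' f\<psi>' by simp
qed

end

lemma sobolev_continuous_bdd_above: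
  assumes "sobolev_continuous T s f"
  shows "bdd_above ((\<lambda>t. sobolev_norm s (f t)) ` {0..T})"
proof -
  have f: "f t \<in> sobolev s" if "t \<in> {0..T}" for t using assms that by (auto simp: sobolev_continuous_def)
  have "continuous_on {0..T} (\<lambda>t. sobolev_norm s (f t))"
    unfolding continuous_on_def
  proof
    fix t assume t: "t \<in> {0..T}"
    have lim: "((\<lambda>t'. sobolev_norm s (\<lambda>x. f t' x - f t x)) \<longlongrightarrow> 0) (at t within {0..T})"
      using assms t by (auto simp: sobolev_continuous_def)
    have "((\<lambda>t'. sobolev_norm s (f t') - sobolev_norm s (f t)) \<longlongrightarrow> 0) (at t within {0..T})"
    proof (rule Lim_null_comparison[OF _ lim])
      have "\<bar>sobolev_norm s (f t') - sobolev_norm s (f t)\<bar> \<le> sobolev_norm s (\<lambda>x. f t' x - f t x)"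
        if t': "t' \<in> {0..T}" for t'
      proof -
        let ?a = "fourier_coeff (f t')" and ?b = "fourier_coeff (f t)"
        have h: "hs s ?a" "hs s ?b" using f[OF t] f[OF t'] by (auto intro: sobolev_hs)
        have d: "sobolev_norm s (\<lambda>x. f t' x - f t x) = hnorm s (\<lambda>k. ?a k - ?b k)"
          unfolding sobolev_norm_eq using f[OF t] f[OF t']
          by (intro arg_cong[of _ _ "hnorm s"] ext) (auto intro!: fourier_coeff_diff intro: sobolev_cell_integrable)
        have "hnorm s (\<lambda>k. ?b k - ?a k) = hnorm s (\<lambda>k. ?a k - ?b k)"
          by (rule hs_cmod_eq(2)) (rule norm_minus_commute)
        thus ?thesis
          using hs_add(2)[OF hs_diff(1)[OF h] h(2)] hs_add(2)[OF hs_diff(1)[OF h(2,1)] h(1)]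
          unfolding d unfolding sobolev_norm_eq by simp
      qed
      thus "\<forall>\<^sub>F t' in at t within {0..T}. norm (sobolev_norm s (f t') - sobolev_norm s (f t)) \<le> sobolev_norm s (\<lambda>x. f t' x - f t x)"
        by (simp add: eventually_at_filter)
    qed
    thus "((\<lambda>t. sobolev_norm s (f t)) \<longlongrightarrow> sobolev_norm s (f t)) (at t within {0..T})"
      by (rule Lim_null[THEN iffD2])
  qed
  from compact_continuous_image[OF this compact_Icc] show ?thesis
    by (intro bounded_imp_bdd_above compact_imp_bounded)
qed

section \<open>Convergence\<close>

text \<open>
Only steps before \<open>n\<close> are needed, because the step estimate is available only while the error is
small.
\<close>

lemma discrete_gronwall:
  fixes e :: "nat \<Rightarrow> real"
  assumes e0: "e 0 \<le> 0" and L: "0 \<le> L" and \<tau>: "0 \<le> \<tau>" and A: "0 \<le> A"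
    and step: "\<And>j. j < n \<Longrightarrow> e (Suc j) \<le> (1 + \<tau> * L) * e j + \<tau> * (\<tau> * A)"
  shows "e n \<le> real n * \<tau> * (\<tau> * A) * exp (L * (real n * \<tau>))"
  using step
proof (induction n)
  case 0 thus ?case using e0 by simp
next
  case (Suc n)
  let ?E = "exp (L * (real n * \<tau>))" and ?F = "exp (L * (real (Suc n) * \<tau>))"
  have IH: "e n \<le> real n * \<tau> * (\<tau> * A) * ?E" using Suc by simp
  have EF: "(1 + \<tau> * L) * ?E \<le> ?F"
  proof -
    have "(1 + \<tau> * L) * ?E \<le> exp (\<tau> * L) * ?E"
      by (intro mult_right_mono exp_ge_add_one_self) simp
    also have "\<dots> = ?F" by (simp add: algebra_simps flip: exp_add)
    finally show ?thesis .
  qed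
  have F1: "1 \<le> ?F" using L \<tau> by simp
  have "e (Suc n) \<le> (1 + \<tau> * L) * e n + \<tau> * (\<tau> * A)" using Suc.prems by simp
  also have "\<dots> \<le> (1 + \<tau> * L) * (real n * \<tau> * (\<tau> * A) * ?E) + \<tau> * (\<tau> * A) * 1"
    using IH L \<tau> by (intro add_mono mult_left_mono) auto
  also have "\<dots> = real n * \<tau> * (\<tau> * A) * ((1 + \<tau> * L) * ?E) + \<tau> * (\<tau> * A) * 1"
    by (simp only: mult_ac)
  also have "\<dots> \<le> real n * \<tau> * (\<tau> * A) * ?F + \<tau> * (\<tau> * A) * ?F"
    using EF F1 \<tau> A by (intro add_mono mult_left_mono) auto
  also have "\<dots> = real (Suc n) * \<tau> * (\<tau> * A) * ?F" by (simp add: algebra_simps)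
  finally show ?case .
qed

context sobolev_algebra
begin

text \<open>
The growth rate of errors under one step, for numerical values at distance at most \<open>1\<close> from a
solution bounded by \<open>Mu\<close> and \<open>Mp\<close>.
\<close>

definition lip_const :: "real \<Rightarrow> real \<Rightarrow> real" where
  "lip_const Mu Mp = algc * (Mu + 3 * Mp + 2)"

text \<open>
The part of the local error that needs one derivative.
\<close>

definition err_const :: "real \<Rightarrow> real \<Rightarrow> real" where
  "err_const Mu Mp = 2 * algc\<^sup>2 * Mu * Mp\<^sup>2 + algc * Mp\<^sup>2
     + algc\<^sup>2 * (Mp * Mp\<^sup>2 + Mu\<^sup>2 * Mp) + algc * Mu * Mp"

text \<open>
The part of the local error that comes from the dispersion relation.
\<close>

definition disp_const :: "real \<Rightarrow> real \<Rightarrow> real \<Rightarrow> real" where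
  "disp_const \<alpha> c Mq = min 1 (c powr (- 2 * \<alpha>)) * (alg_const TYPE('d) (r + 2 * (1 + \<alpha>)) * Mq\<^sup>2)"

lemma one_step_error:
  fixes U P :: "real \<Rightarrow> int ^ 'd \<Rightarrow> complex" and x y :: "int ^ 'd \<Rightarrow> complex"
  assumes sol: "coeff_solution c T U P" and c: "0 < c" and a: "0 \<le> \<alpha>" "\<alpha> \<le> 1"
    and t: "0 \<le> t" "t + \<tau> \<le> T" "0 \<le> \<tau>"
    and U: "\<And>s. s \<in> {t..t + \<tau>} \<Longrightarrow> hs (r + 1) (U s) \<and> hnorm (r + 1) (U s) \<le> Mu"
    and P: "\<And>s. s \<in> {t..t + \<tau>} \<Longrightarrow> hs (r + 1) (P s) \<and> hnorm (r + 1) (P s) \<le> Mp"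
    and Q: "hs (r + 2 * (1 + \<alpha>)) (P t) \<and> hnorm (r + 2 * (1 + \<alpha>)) (P t) \<le> Mq"
    and xy: "hs r x" "hs r y"
    and e1: "hnorm r (\<lambda>k. U t k - x k) + hnorm r (\<lambda>k. P t k - y k) \<le> 1"
  shows "hnorm r (\<lambda>k. U (t + \<tau>) k - coeff_step_u c \<tau> x y k) + hnorm r (\<lambda>k. P (t + \<tau>) k - coeff_step_psi c \<tau> x y k)
    \<le> (1 + \<tau> * lip_const Mu Mp) * (hnorm r (\<lambda>k. U t k - x k) + hnorm r (\<lambda>k. P t k - y k))
      + \<tau> * (\<tau> * (err_const Mu Mp + disp_const \<alpha> c Mq))"
proof -
  let ?du = "hnorm r (\<lambda>k. U t k - x k)" and ?dp = "hnorm r (\<lambda>k. P t k - y k)"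
  have Ur: "hs r (U s) \<and> hnorm r (U s) \<le> Mu" and Pr: "hs r (P s) \<and> hnorm r (P s) \<le> Mp"
    if "s \<in> {t..t + \<tau>}" for s
    using U[OF that] P[OF that] hs_order_mono[of "r + 1" "U s" r] hs_order_mono[of "r + 1" "P s" r] by auto
  have tt: "t \<in> {t..t + \<tau>}" using t by auto
  have u: "hs r (U t)" "hnorm r (U t) \<le> Mu" and p: "hs r (P t)" "hnorm r (P t) \<le> Mp"
    using Ur[OF tt] Pr[OF tt] by auto
  have M: "0 \<le> Mu" "0 \<le> Mp" using u p by (auto intro: order_trans[OF hnorm_nonneg])
  have xn: "hnorm r x \<le> Mu + 1" and yn: "hnorm r y \<le> Mp + 1"
  proof -
    have "hnorm r x \<le> hnorm r (U t) + ?du" "hnorm r y \<le> hnorm r (P t) + ?dp"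
      using hs_diff(2)[OF u(1) hs_diff(1)[OF u(1) xy(1)]] hs_diff(2)[OF p(1) hs_diff(1)[OF p(1) xy(2)]] by auto
    moreover have "0 \<le> ?du" "0 \<le> ?dp" by auto
    ultimately show "hnorm r x \<le> Mu + 1" "hnorm r y \<le> Mp + 1" using e1 u p by linarith+
  qed
  note lu = local_error_u[OF sol c a t Ur P Q]
  note lp = local_error_psi[OF sol c t U P]
  note st = hs_coeff_step[OF c u(1) p(1), of \<tau>] hs_coeff_step[OF c xy, of \<tau>]
  have su: "hnorm r (\<lambda>k. coeff_step_u c \<tau> (U t) (P t) k - coeff_step_u c \<tau> x y k)
      \<le> ?du + \<tau> * (algc * (2 * Mp + 1) * ?dp)"
  proof -
    have "hnorm r (P t) + hnorm r y \<le> 2 * Mp + 1" using p yn by linarith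
    hence "\<tau> * (algc * (hnorm r (P t) + hnorm r y) * ?dp) \<le> \<tau> * (algc * (2 * Mp + 1) * ?dp)"
      using t by (intro mult_left_mono mult_right_mono) auto
    thus ?thesis using stability_u[OF c t(3) u(1) p(1) xy] by linarith
  qed
  have sp: "hnorm r (\<lambda>k. coeff_step_psi c \<tau> (U t) (P t) k - coeff_step_psi c \<tau> x y k)
      \<le> ?dp + \<tau> * (algc * (Mp * ?du + (Mu + 1) * ?dp))"
  proof -
    have "\<tau> * (algc * (hnorm r (P t) * ?du + hnorm r x * ?dp)) \<le> \<tau> * (algc * (Mp * ?du + (Mu + 1) * ?dp))"
      using t p xn by (intro mult_left_mono add_mono mult_right_mono) auto
    thus ?thesis using stability_psi[OF t(3) u(1) p(1) xy, of c] by linarith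
  qed
  have "hnorm r (\<lambda>k. U (t + \<tau>) k - coeff_step_u c \<tau> x y k)
      \<le> hnorm r (\<lambda>k. U (t + \<tau>) k - coeff_step_u c \<tau> (U t) (P t) k)
        + hnorm r (\<lambda>k. coeff_step_u c \<tau> (U t) (P t) k - coeff_step_u c \<tau> x y k)"
    by (rule hnorm_triangle3[OF lu(1) hs_diff(1)[OF st(1,3)]])
  moreover have "hnorm r (\<lambda>k. P (t + \<tau>) k - coeff_step_psi c \<tau> x y k)
      \<le> hnorm r (\<lambda>k. P (t + \<tau>) k - coeff_step_psi c \<tau> (U t) (P t) k)
        + hnorm r (\<lambda>k. coeff_step_psi c \<tau> (U t) (P t) k - coeff_step_psi c \<tau> x y k)"
    by (rule hnorm_triangle3[OF lp(1) hs_diff(1)[OF st(2,4)]])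
  ultimately have sum: "hnorm r (\<lambda>k. U (t + \<tau>) k - coeff_step_u c \<tau> x y k) + hnorm r (\<lambda>k. P (t + \<tau>) k - coeff_step_psi c \<tau> x y k)
    \<le> (?du + ?dp) + \<tau> * (algc * (2 * Mp + 1) * ?dp + algc * (Mp * ?du + (Mu + 1) * ?dp))
      + \<tau> * (\<tau> * (err_const Mu Mp + disp_const \<alpha> c Mq))"
    using lu(2) lp(2) su sp by (simp add: err_const_def disp_const_def distrib_left add_ac)
  have "algc * (2 * Mp + 1) * ?dp + algc * (Mp * ?du + (Mu + 1) * ?dp) \<le> lip_const Mu Mp * (?du + ?dp)"
  proof -
    have "algc * (2 * Mp + 1) * ?dp + algc * (Mp * ?du + (Mu + 1) * ?dp)
      = algc * (Mp * ?du + (Mu + 2 * Mp + 2) * ?dp)" by (simp add: algebra_simps)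
    also have "\<dots> \<le> algc * ((Mu + 3 * Mp + 2) * ?du + (Mu + 3 * Mp + 2) * ?dp)"
      using M by (intro mult_left_mono add_mono mult_right_mono) auto
    finally show ?thesis by (simp add: lip_const_def algebra_simps)
  qed
  from mult_left_mono[OF this t(3)] sum show ?thesis by (simp add: distrib_left distrib_right)
qed

lemma scheme_coefficients:
  fixes u0 \<psi>0 :: "real ^ 'd \<Rightarrow> complex"
  assumes c: "0 < c" and \<tau>: "0 < \<tau>" and i: "cell_integrable u0" "cell_integrable \<psi>0"
    and h: "hs r (fourier_coeff u0)" "hs r (fourier_coeff \<psi>0)"
  defines "x n \<equiv> fst (KGS_scheme c \<tau> u0 \<psi>0 n)" and "y n \<equiv> snd (KGS_scheme c \<tau> u0 \<psi>0 n)"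
  shows "cell_integrable (x n)" "cell_integrable (y n)"
    "hs r (fourier_coeff (x n))" "hs r (fourier_coeff (y n))"
    "fourier_coeff (x (Suc n)) = coeff_step_u c \<tau> (fourier_coeff (x n)) (fourier_coeff (y n))" (is ?G1)
    "fourier_coeff (y (Suc n)) = coeff_step_psi c \<tau> (fourier_coeff (x n)) (fourier_coeff (y n))" (is ?G2)
proof -
  have xs: "x (Suc n) = KGS_step_u c \<tau> (x n) (y n)" "y (Suc n) = KGS_step_psi c \<tau> (x n) (y n)" for n
    by (simp_all add: x_def y_def case_prod_unfold)
  have inv: "cell_integrable (x n) \<and> cell_integrable (y n) \<and> hs r (fourier_coeff (x n)) \<and> hs r (fourier_coeff (y n))" for n
  proof (induction n)
    case 0 show ?case using i h by (simp add: x_def y_def)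
  next
    case (Suc n)
    thus ?case unfolding xs
      using fourier_coeff_step_u[OF c \<tau>, of "x n" "y n"] fourier_coeff_step_psi[OF \<tau>, of "x n" "y n" c]
        hs_coeff_step[OF c, of "fourier_coeff (x n)" "fourier_coeff (y n)" \<tau>] by simp
  qed
  thus "cell_integrable (x n)" "cell_integrable (y n)"
    "hs r (fourier_coeff (x n))" "hs r (fourier_coeff (y n))" by auto
  show ?G1
    ?G2
    unfolding xs using inv[of n] fourier_coeff_step_u(2)[OF c \<tau>] fourier_coeff_step_psi(2)[OF \<tau>] by auto
qed

text \<open>
The global error, as long as the errors before step \<open>n\<close> do not exceed \<open>1\<close>. All bounds are required
up to time \<open>S\<close> only.
\<close>

lemma convergence_conditional:
  fixes U P :: "real \<Rightarrow> int ^ 'd \<Rightarrow> complex" and x y :: "nat \<Rightarrow> int ^ 'd \<Rightarrow> complex"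
  assumes sol: "coeff_solution c T U P" and c: "0 < c" and a: "0 \<le> \<alpha>" "\<alpha> \<le> 1"
    and \<tau>: "0 \<le> \<tau>" and n: "real n * \<tau> \<le> S" "S \<le> T"
    and U: "\<And>s. s \<in> {0..S} \<Longrightarrow> hs (r + 1) (U s) \<and> hnorm (r + 1) (U s) \<le> Mu"
    and P: "\<And>s. s \<in> {0..S} \<Longrightarrow> hs (r + 1) (P s) \<and> hnorm (r + 1) (P s) \<le> Mp"
    and Q: "\<And>s. s \<in> {0..S} \<Longrightarrow> hs (r + 2 * (1 + \<alpha>)) (P s) \<and> hnorm (r + 2 * (1 + \<alpha>)) (P s) \<le> Mq"
    and xy: "\<And>j. hs r (x j)" "\<And>j. hs r (y j)"
    and init: "x 0 = U 0" "y 0 = P 0"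
    and step: "\<And>j. x (Suc j) = coeff_step_u c \<tau> (x j) (y j)" "\<And>j. y (Suc j) = coeff_step_psi c \<tau> (x j) (y j)"
  defines "e j \<equiv> hnorm r (\<lambda>k. U (real j * \<tau>) k - x j k) + hnorm r (\<lambda>k. P (real j * \<tau>) k - y j k)"
  assumes e1: "\<And>j. j < n \<Longrightarrow> e j \<le> 1"
  shows "e n \<le> \<tau> * (T * (err_const Mu Mp + disp_const \<alpha> c Mq) * exp (lip_const Mu Mp * T))"
proof -
  have S0: "0 \<le> S" using n(1) \<tau> by (meson mult_nonneg_nonneg of_nat_0_le_iff order_trans)
  have z: "0 \<in> {0..S}" using S0 by auto
  have M: "0 \<le> Mu" "0 \<le> Mp" "0 \<le> Mq"
    using U[OF z] P[OF z] Q[OF z] by (auto intro: order_trans[OF hnorm_nonneg])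
  let ?L = "lip_const Mu Mp" and ?A = "err_const Mu Mp + disp_const \<alpha> c Mq"
  have L: "0 \<le> ?L" unfolding lip_const_def using M by simp
  have A: "0 \<le> ?A" unfolding err_const_def disp_const_def using M
    by (intro add_nonneg_nonneg mult_nonneg_nonneg) auto
  have "e (Suc j) \<le> (1 + \<tau> * ?L) * e j + \<tau> * (\<tau> * ?A)" if j: "j < n" for j
  proof -
    have "real (Suc j) * \<tau> \<le> real n * \<tau>" using j \<tau> by (intro mult_right_mono) auto
    hence jt: "real j * \<tau> + \<tau> \<le> S" using n by (simp add: algebra_simps)
    have sub: "s \<in> {0..S}" if "s \<in> {real j * \<tau>..real j * \<tau> + \<tau>}" for s
      using that jt \<tau> by (auto intro: order_trans[of 0 "real j * \<tau>"])
    have j0: "0 \<le> real j * \<tau>" using \<tau> by simp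
    have jS: "real j * \<tau> \<in> {0..S}" by (rule sub) (use \<tau> in simp)
    have jT: "real j * \<tau> + \<tau> \<le> T" using jt n by linarith
    from one_step_error[OF sol c a j0 jT \<tau> U[OF sub] P[OF sub] Q[OF jS] xy(1) xy(2) e1[OF j, unfolded e_def]]
    show ?thesis unfolding e_def step by (simp add: algebra_simps)
  qed
  from discrete_gronwall[of e, OF _ L \<tau> A this]
  have "e n \<le> real n * \<tau> * (\<tau> * ?A) * exp (?L * (real n * \<tau>))"
    by (simp add: e_def init)
  also have "\<dots> \<le> T * (\<tau> * ?A) * exp (?L * T)"
  proof -
    have nT: "real n * \<tau> \<le> T" "0 \<le> real n * \<tau>" "0 \<le> T" using n \<tau> S0 by auto
    have "exp (?L * (real n * \<tau>)) \<le> exp (?L * T)"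
      using mult_left_mono[OF nT(1) L] by simp
    moreover have "real n * \<tau> * (\<tau> * ?A) \<le> T * (\<tau> * ?A)"
      using nT \<tau> A by (intro mult_right_mono) auto
    ultimately show ?thesis using nT \<tau> A by (intro mult_mono) auto
  qed
  finally show ?thesis by (simp add: mult_ac)
qed

text \<open>
The step size restriction comes from the bounds on the whole interval, and the final estimate from
those up to the next grid point.
\<close>

lemma convergence:
  fixes u \<psi> :: "real \<Rightarrow> real ^ 'd \<Rightarrow> complex"
  assumes T: "0 < T" and a: "0 \<le> \<alpha>" "\<alpha> \<le> 1" and c: "0 < c"
    and u: "sobolev_continuous T (r + 1) u" and \<psi>: "sobolev_continuous T (r + 2 * (1 + \<alpha>)) \<psi>"
    and sol: "KGS_solution c T r u \<psi>"
  shows "\<exists>\<tau>0>0. \<forall>\<tau> n. 0 < \<tau> \<longrightarrow> \<tau> \<le> \<tau>0 \<longrightarrow> real (Suc n) * \<tau> \<le> T \<longrightarrow>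
    (let Mu = SUP t\<in>{0..real (Suc n) * \<tau>}. sobolev_norm (r + 1) (u t);
         Mp = SUP t\<in>{0..real (Suc n) * \<tau>}. sobolev_norm (r + 1) (\<psi> t);
         Mq = SUP t\<in>{0..real (Suc n) * \<tau>}. sobolev_norm (r + 2 * (1 + \<alpha>)) (\<psi> t)
     in sobolev_norm r (\<lambda>x. u (real n * \<tau>) x - fst (KGS_scheme c \<tau> (u 0) (\<psi> 0) n) x)
        + sobolev_norm r (\<lambda>x. \<psi> (real n * \<tau>) x - snd (KGS_scheme c \<tau> (u 0) (\<psi> 0) n) x)
        \<le> \<tau> * (T * (err_const Mu Mp + disp_const \<alpha> c Mq) * exp (lip_const Mu Mp * T)))"
proof -
  let ?q = "r + 2 * (1 + \<alpha>)"
  define U where "U t = fourier_coeff (u t)" for t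
  define P where "P t = fourier_coeff (\<psi> t)" for t
  have us: "u t \<in> sobolev (r + 1)" and \<psi>s: "\<psi> t \<in> sobolev ?q" if "t \<in> {0..T}" for t
    using u \<psi> that by (auto simp: sobolev_continuous_def)
  have csol: "coeff_solution c T U P"
    unfolding U_def[abs_def] P_def[abs_def]
    by (rule coeff_solution_of_KGS_solution[OF c _ us \<psi>s sol]) (use a in auto)
  have iu: "cell_integrable (u t)" and i\<psi>: "cell_integrable (\<psi> t)" if "t \<in> {0..T}" for t
    using us[OF that] \<psi>s[OF that] by (auto intro: sobolev_cell_integrable)
  have hU: "hs (r + 1) (U t)" and hQ: "hs ?q (P t)" if "t \<in> {0..T}" for t
    using us[OF that] \<psi>s[OF that] by (auto simp: U_def P_def intro: sobolev_hs)
  have hP: "hs (r + 1) (P t)" "hnorm (r + 1) (P t) \<le> hnorm ?q (P t)" if "t \<in> {0..T}" for t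
    using hs_order_mono[OF hQ[OF that], of "r + 1"] a by auto
  have hr: "hs r (U t)" "hs r (P t)" if "t \<in> {0..T}" for t
    using hs_order_mono(1)[OF hU[OF that], of r] hs_order_mono(1)[OF hP(1)[OF that], of r] by auto
  have bu: "bdd_above ((\<lambda>t. hnorm (r + 1) (U t)) ` {0..T})"
    and bq: "bdd_above ((\<lambda>t. hnorm ?q (P t)) ` {0..T})"
    using sobolev_continuous_bdd_above[OF u] sobolev_continuous_bdd_above[OF \<psi>]
    by (simp_all add: sobolev_norm_eq U_def P_def)
  have bp: "bdd_above ((\<lambda>t. hnorm (r + 1) (P t)) ` {0..T})"
  proof -
    obtain B where "\<And>t. t \<in> {0..T} \<Longrightarrow> hnorm ?q (P t) \<le> B"
      using bq unfolding bdd_above_def by (meson imageI)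
    hence "\<And>t. t \<in> {0..T} \<Longrightarrow> hnorm (r + 1) (P t) \<le> B" using hP(2) by (meson order_trans)
    thus ?thesis by (auto intro!: bdd_aboveI[of _ B])
  qed
  define Su where "Su S = (SUP t\<in>{0..S}. hnorm (r + 1) (U t))" for S
  define Sp where "Sp S = (SUP t\<in>{0..S}. hnorm (r + 1) (P t))" for S
  define Sq where "Sq S = (SUP t\<in>{0..S}. hnorm ?q (P t))" for S
  have bds: "hs (r + 1) (U s) \<and> hnorm (r + 1) (U s) \<le> Su S"
      "hs (r + 1) (P s) \<and> hnorm (r + 1) (P s) \<le> Sp S"
      "hs ?q (P s) \<and> hnorm ?q (P s) \<le> Sq S" if S: "S \<le> T" and s: "s \<in> {0..S}" for s S
  proof -
    have sub: "f ` {0..S} \<subseteq> f ` {0..T}" for f :: "real \<Rightarrow> real" using S by (intro image_mono) auto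
    have sT: "s \<in> {0..T}" using S s by auto
    show "hs (r + 1) (U s) \<and> hnorm (r + 1) (U s) \<le> Su S"
      "hs (r + 1) (P s) \<and> hnorm (r + 1) (P s) \<le> Sp S"
      "hs ?q (P s) \<and> hnorm ?q (P s) \<le> Sq S"
      unfolding Su_def Sp_def Sq_def
      using hU[OF sT] hP(1)[OF sT] hQ[OF sT]
        cSUP_upper[OF s bdd_above_mono[OF bu sub]] cSUP_upper[OF s bdd_above_mono[OF bp sub]]
        cSUP_upper[OF s bdd_above_mono[OF bq sub]] by auto
  qed
  define bound where "bound S = T * (err_const (Su S) (Sp S) + disp_const \<alpha> c (Sq S)) * exp (lip_const (Su S) (Sp S) * T)" for S
  define \<tau>0 where "\<tau>0 = 1 / (\<bar>bound T\<bar> + 1)"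
  have \<tau>0: "0 < \<tau>0" by (simp add: \<tau>0_def add_nonneg_pos)
  have "sobolev_norm r (\<lambda>z. u (real n * \<tau>) z - fst (KGS_scheme c \<tau> (u 0) (\<psi> 0) n) z)
        + sobolev_norm r (\<lambda>z. \<psi> (real n * \<tau>) z - snd (KGS_scheme c \<tau> (u 0) (\<psi> 0) n) z)
        \<le> \<tau> * bound (real (Suc n) * \<tau>)"
    if \<tau>: "0 < \<tau>" "\<tau> \<le> \<tau>0" and nT: "real (Suc n) * \<tau> \<le> T" for \<tau> n
  proof -
    define X where "X n = fst (KGS_scheme c \<tau> (u 0) (\<psi> 0) n)" for n
    define Y where "Y n = snd (KGS_scheme c \<tau> (u 0) (\<psi> 0) n)" for n
    define x where "x n = fourier_coeff (X n)" for n
    define y where "y n = fourier_coeff (Y n)" for n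
    have z: "0 \<in> {0..T}" using T by auto
    note sc = scheme_coefficients[OF c \<tau>(1) iu[OF z] i\<psi>[OF z] hr(1)[OF z, unfolded U_def] hr(2)[OF z, unfolded P_def],
        folded X_def Y_def, folded x_def y_def]
    define e where "e j = hnorm r (\<lambda>k. U (real j * \<tau>) k - x j k) + hnorm r (\<lambda>k. P (real j * \<tau>) k - y j k)" for j
    have init: "x 0 = U 0" "y 0 = P 0" by (simp_all add: x_def y_def X_def Y_def U_def P_def)
    have cond: "e m \<le> \<tau> * bound S" if "real m * \<tau> \<le> S" "S \<le> T" "\<And>j. j < m \<Longrightarrow> e j \<le> 1" for m S
      unfolding e_def bound_def
      by (rule convergence_conditional[OF csol c a less_imp_le[OF \<tau>(1)] that(1,2) bds(1)[OF that(2)] bds(2)[OF that(2)]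
          bds(3)[OF that(2)] sc(3,4) init sc(5,6) that(3)[unfolded e_def]])
    \<comment> \<open>Bootstrap: the bounds over the whole interval keep the error below \<open>1\<close>.\<close>
    have le1: "e m \<le> 1" if "real m * \<tau> \<le> T" for m
      using that
    proof (induction m rule: less_induct)
      case (less m)
      have "e j \<le> 1" if "j < m" for j
      proof (rule less.IH[OF that])
        have "real j * \<tau> \<le> real m * \<tau>" using that \<tau> by (intro mult_right_mono) auto
        thus "real j * \<tau> \<le> T" using less.prems by linarith
      qed
      hence "e m \<le> \<tau> * bound T" using cond[of m T] less.prems by simp
      also have "\<dots> \<le> \<tau> * (\<bar>bound T\<bar> + 1)" using \<tau> by (intro mult_left_mono) auto
      also have "\<dots> \<le> \<tau>0 * (\<bar>bound T\<bar> + 1)" using \<tau> by (intro mult_right_mono) auto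
      also have "\<dots> = 1" by (simp add: \<tau>0_def add_nonneg_eq_0_iff)
      finally show ?case .
    qed
    have nle: "real n * \<tau> \<le> real (Suc n) * \<tau>" using \<tau> by (intro mult_right_mono) auto
    have "e n \<le> \<tau> * bound (real (Suc n) * \<tau>)"
    proof (rule cond[OF nle nT])
      fix j assume "j < n"
      hence "real j * \<tau> \<le> real (Suc n) * \<tau>" using \<tau> by (intro mult_right_mono) auto
      thus "e j \<le> 1" using nT by (intro le1) linarith
    qed
    moreover have "real n * \<tau> \<in> {0..T}" using order_trans[OF nle nT] \<tau> by simp
    hence "fourier_coeff (\<lambda>z. u (real n * \<tau>) z - X n z) = (\<lambda>k. U (real n * \<tau>) k - x n k)"
        "fourier_coeff (\<lambda>z. \<psi> (real n * \<tau>) z - Y n z) = (\<lambda>k. P (real n * \<tau>) k - y n k)"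
      unfolding U_def P_def x_def y_def
      by (auto intro!: ext fourier_coeff_diff iu i\<psi> sc(1) sc(2))
    hence "sobolev_norm r (\<lambda>z. u (real n * \<tau>) z - X n z) + sobolev_norm r (\<lambda>z. \<psi> (real n * \<tau>) z - Y n z) = e n"
      unfolding sobolev_norm_eq e_def by simp
    ultimately show ?thesis by (simp add: X_def Y_def)
  qed
  thus ?thesis
    unfolding Let_def sobolev_norm_eq[of "r + 1"] sobolev_norm_eq[of ?q] U_def[symmetric] P_def[symmetric]
      Su_def[symmetric] Sp_def[symmetric] Sq_def[symmetric] bound_def[symmetric]
    using \<tau>0 by blast
qed

end

theorem theorem3p6:
  fixes r T \<alpha> :: real
  assumes "r > real CARD('d::finite) / 2" and "T > 0" and "0 \<le> \<alpha>" and "\<alpha> \<le> 1"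
  shows "\<exists>(K1 :: real \<Rightarrow> real \<Rightarrow> real) (K2 :: real \<Rightarrow> real).
    \<forall>(c :: real) (u :: real \<Rightarrow> real ^ 'd \<Rightarrow> complex) (\<psi> :: real \<Rightarrow> real ^ 'd \<Rightarrow> complex).
      c > 0 \<longrightarrow>
      sobolev_continuous T (r + 1) u \<longrightarrow>
      sobolev_continuous T (r + 2 * (1 + \<alpha>)) \<psi> \<longrightarrow>
      KGS_solution c T r u \<psi> \<longrightarrow>
      (\<exists>\<tau>0>0. \<forall>\<tau> n. 0 < \<tau> \<longrightarrow> \<tau> \<le> \<tau>0 \<longrightarrow> real (Suc n) * \<tau> \<le> T \<longrightarrow>
        sobolev_norm r (\<lambda>x. u (real n * \<tau>) x - fst (KGS_scheme c \<tau> (u 0) (\<psi> 0) n) x)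
        + sobolev_norm r (\<lambda>x. \<psi> (real n * \<tau>) x - snd (KGS_scheme c \<tau> (u 0) (\<psi> 0) n) x)
        \<le> \<tau> * K1 (SUP t\<in>{0..real (Suc n) * \<tau>}. sobolev_norm (r + 1) (u t))
                   (SUP t\<in>{0..real (Suc n) * \<tau>}. sobolev_norm (r + 1) (\<psi> t))
          + \<tau> * c powr (- 2 * \<alpha>)
            * K2 (SUP t\<in>{0..real (Suc n) * \<tau>}. sobolev_norm (r + 2 * (1 + \<alpha>)) (\<psi> t)))"
proof -
  interpret sobolev_algebra r "TYPE('d)" by unfold_locales (rule assms(1))
  let ?C = "alg_const TYPE('d) (r + 2 * (1 + \<alpha>))"
  define Y where "Y Mu Mp = ?C * T * exp (lip_const Mu Mp * T)" for Mu Mp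
  define K1 where "K1 Mu Mp = T * err_const Mu Mp * exp (lip_const Mu Mp * T) + (Y Mu Mp)\<^sup>2" for Mu Mp
  define K2 where "K2 Mq = (Mq\<^sup>2)\<^sup>2" for Mq :: real
  have split: "\<tau> * (T * (err_const Mu Mp + disp_const \<alpha> c Mq) * exp (lip_const Mu Mp * T))
      \<le> \<tau> * K1 Mu Mp + \<tau> * c powr (- 2 * \<alpha>) * K2 Mq" if "0 < \<tau>" for \<tau> c Mu Mp Mq
  proof -
    let ?m = "min 1 (c powr (- 2 * \<alpha>))"
    have m: "0 \<le> ?m" "?m \<le> 1" "?m \<le> c powr (- 2 * \<alpha>)" by auto
    \<comment> \<open>Young's inequality separates the regularity of \<open>\<psi>\<close> from the Gronwall factor.\<close>
    have "T * disp_const \<alpha> c Mq * exp (lip_const Mu Mp * T) = ?m * (Mq\<^sup>2 * Y Mu Mp)"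
      by (simp only: disp_const_def Y_def mult_ac)
    also have "\<dots> \<le> ?m * ((Mq\<^sup>2)\<^sup>2 + (Y Mu Mp)\<^sup>2)"
    proof (rule mult_left_mono[OF _ m(1)])
      have "2 * (Mq\<^sup>2 * Y Mu Mp) \<le> (Mq\<^sup>2)\<^sup>2 + (Y Mu Mp)\<^sup>2"
        using sum_squares_bound[of "Mq\<^sup>2" "Y Mu Mp"] by (simp only: mult.assoc)
      moreover have "0 \<le> Mq\<^sup>2 * Y Mu Mp" using assms(2) by (simp add: Y_def)
      ultimately show "Mq\<^sup>2 * Y Mu Mp \<le> (Mq\<^sup>2)\<^sup>2 + (Y Mu Mp)\<^sup>2" by linarith
    qed
    also have "\<dots> = ?m * (Mq\<^sup>2)\<^sup>2 + ?m * (Y Mu Mp)\<^sup>2" by (rule distrib_left)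
    also have "\<dots> \<le> c powr (- 2 * \<alpha>) * (Mq\<^sup>2)\<^sup>2 + 1 * (Y Mu Mp)\<^sup>2"
      using m by (intro add_mono mult_right_mono) auto
    finally have "T * (err_const Mu Mp + disp_const \<alpha> c Mq) * exp (lip_const Mu Mp * T)
      \<le> K1 Mu Mp + c powr (- 2 * \<alpha>) * K2 Mq"
      unfolding K1_def K2_def by (simp add: distrib_left distrib_right)
    from mult_left_mono[OF this, of \<tau>] that show ?thesis by (simp add: distrib_left mult.assoc)
  qed
  show ?thesis
  proof (intro exI[of _ K1] exI[of _ K2] allI impI)
    fix c :: real and u \<psi> :: "real \<Rightarrow> real ^ 'd \<Rightarrow> complex"
    assume "c > 0" "sobolev_continuous T (r + 1) u" "sobolev_continuous T (r + 2 * (1 + \<alpha>)) \<psi>" "KGS_solution c T r u \<psi>"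
    from convergence[OF assms(2,3,4) this]
    obtain \<tau>0 where "\<tau>0 > 0" and conv: "\<And>\<tau> n. 0 < \<tau> \<Longrightarrow> \<tau> \<le> \<tau>0 \<Longrightarrow> real (Suc n) * \<tau> \<le> T \<Longrightarrow>
        sobolev_norm r (\<lambda>x. u (real n * \<tau>) x - fst (KGS_scheme c \<tau> (u 0) (\<psi> 0) n) x)
        + sobolev_norm r (\<lambda>x. \<psi> (real n * \<tau>) x - snd (KGS_scheme c \<tau> (u 0) (\<psi> 0) n) x)
        \<le> \<tau> * (T * (err_const (SUP t\<in>{0..real (Suc n) * \<tau>}. sobolev_norm (r + 1) (u t))
                   (SUP t\<in>{0..real (Suc n) * \<tau>}. sobolev_norm (r + 1) (\<psi> t))
             + disp_const \<alpha> c (SUP t\<in>{0..real (Suc n) * \<tau>}. sobolev_norm (r + 2 * (1 + \<alpha>)) (\<psi> t)))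
           * exp (lip_const (SUP t\<in>{0..real (Suc n) * \<tau>}. sobolev_norm (r + 1) (u t))
                   (SUP t\<in>{0..real (Suc n) * \<tau>}. sobolev_norm (r + 1) (\<psi> t)) * T))"
      unfolding Let_def by blast
    show "\<exists>\<tau>0>0. \<forall>\<tau> n. 0 < \<tau> \<longrightarrow> \<tau> \<le> \<tau>0 \<longrightarrow> real (Suc n) * \<tau> \<le> T \<longrightarrow>
        sobolev_norm r (\<lambda>x. u (real n * \<tau>) x - fst (KGS_scheme c \<tau> (u 0) (\<psi> 0) n) x)
        + sobolev_norm r (\<lambda>x. \<psi> (real n * \<tau>) x - snd (KGS_scheme c \<tau> (u 0) (\<psi> 0) n) x)
        \<le> \<tau> * K1 (SUP t\<in>{0..real (Suc n) * \<tau>}. sobolev_norm (r + 1) (u t))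
                   (SUP t\<in>{0..real (Suc n) * \<tau>}. sobolev_norm (r + 1) (\<psi> t))
          + \<tau> * c powr (- 2 * \<alpha>)
            * K2 (SUP t\<in>{0..real (Suc n) * \<tau>}. sobolev_norm (r + 2 * (1 + \<alpha>)) (\<psi> t))"
      by (intro exI[of _ \<tau>0] conjI allI impI \<open>\<tau>0 > 0\<close>, rule order_trans[OF conv split])
  qed
qed

end
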